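(* Let $X=\{X_t,t\in R_+\}$ be a real valued Lévy process with characteristic exponent $\psi$, and assume that $X$ has local times $\{L_t^x,(x,t)\in R\times R_+\}$. For $\alpha>0$, let $u^\alpha(x,y)=E^x\big(L^y_{\xi_\alpha}\big)$, where $\xi_\alpha$ is an exponential time with mean $1/\alpha$ independent of $X$. Then, for every $\alpha>0$, the $\alpha$-potential density satisfies $$u^\alpha(x,y)=R_\alpha(x,y)+H_\alpha(x,y)\quad\text{and}\quad u^\alpha(y,x)=R_\alpha(x,y)-H_\alpha(x,y),$$ where $$R_\alpha(x,y)=\frac1\pi\int_0^\infty\frac{\cos\lambda(x-y)\,\mathrm{Re}(\alpha+\psi(\lambda))}{|\alpha+\psi(\lambda)|^2}\,d\lambda$$ and $$H_\alpha(x,y)=\frac1\pi\int_0^\infty\frac{\sin\lambda(x-y)\,\mathrm{Im}(\alpha+\psi(\lambda))}{|\alpha+\psi(\lambda)|^2}\,d\lambda .$$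
   Context: The characteristic exponent $\psi$ of $X$ is defined by $E e^{i\lambda X_t}=e^{-t\psi(\lambda)}$, $\lambda\in R$, $t\ge 0$ (with $X_0=0$). $E^x$ denotes expectation for the process started at $x$. Local times are normalized in the usual way as densities of the occupation measure of $X$ with respect to Lebesgue measure. The function $u^\alpha$ is the $\alpha$-potential density of $X$, equivalently the zero potential density of the process $X$ killed at the time $\xi_\alpha$. *)

theory Defs
  imports "HOL-Probability.Probability"
begin

text \<open>
  Time is the set of nonnegative reals, written \<open>{0..}\<close>; values of processes and paths at negative
  times are irrelevant.
\<close>

definition cadlag :: "(real \<Rightarrow> real) \<Rightarrow> bool" where
  "cadlag w \<longleftrightarrow>
     (\<forall>t\<ge>0. (w \<longlongrightarrow> w t) (at_right t)) \<and> (\<forall>t>0. \<exists>l. (w \<longlongrightarrow> l) (at_left t))"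

definition levy_process :: "'a measure \<Rightarrow> (real \<Rightarrow> 'a \<Rightarrow> real) \<Rightarrow> bool" where
  "levy_process M X \<longleftrightarrow>
     prob_space M \<and>
     (\<forall>t\<ge>0. X t \<in> borel_measurable M) \<and>
     (\<forall>\<omega>\<in>space M. X 0 \<omega> = 0) \<and>
     (\<forall>\<omega>\<in>space M. cadlag (\<lambda>t. X t \<omega>)) \<and>
     (\<forall>(\<tau> :: nat \<Rightarrow> real) n. 0 \<le> \<tau> 0 \<and> mono \<tau> \<longrightarrow>
        prob_space.indep_vars M (\<lambda>_. borel) (\<lambda>i \<omega>. X (\<tau> (Suc i)) \<omega> - X (\<tau> i) \<omega>) {..<n}) \<and>
     (\<forall>s\<ge>0. \<forall>t\<ge>0. distr M borel (\<lambda>\<omega>. X (s + t) \<omega> - X s \<omega>) = distr M borel (X t))"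

text \<open>
  The identity is required for all times \<open>t \<ge> 0\<close> at once, which determines \<open>\<psi>\<close> uniquely.
\<close>

definition characteristic_exponent ::
    "'a measure \<Rightarrow> (real \<Rightarrow> 'a \<Rightarrow> real) \<Rightarrow> (real \<Rightarrow> complex) \<Rightarrow> bool" where
  "characteristic_exponent M X \<psi> \<longleftrightarrow>
     (\<forall>t\<ge>0. \<forall>v. char (distr M borel (X t)) v = exp (- (of_real t * \<psi> v)))"

text \<open>
  Paths live on the space of cadlag functions with the \<open>\<sigma>\<close>-algebra generated by the coordinates.
  Being elements of a product over \<open>{0..}\<close>, they are \<open>undefined\<close> at negative times.
\<close>

definition path_space :: "(real \<Rightarrow> real) measure" where
  "path_space = restrict_space (\<Pi>\<^sub>M t\<in>{0..}. borel) {w. cadlag w}"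

definition path_filtration :: "real \<Rightarrow> (real \<Rightarrow> real) measure" where
  "path_filtration t =
     vimage_algebra (space path_space) (\<lambda>w. restrict w {0..t}) (\<Pi>\<^sub>M s\<in>{0..t}. borel)"

definition path_shift :: "real \<Rightarrow> (real \<Rightarrow> real) \<Rightarrow> real \<Rightarrow> real" where
  "path_shift s w = (\<lambda>t\<in>{0..}. w (s + t))"

definition path_translate :: "real \<Rightarrow> (real \<Rightarrow> real) \<Rightarrow> real \<Rightarrow> real" where
  "path_translate a w = (\<lambda>t\<in>{0..}. a + w t)"

text \<open>The measure \<open>P\<^sup>x\<close>: the law on path space of the process started at \<open>x\<close>.\<close>

definition law_from :: "'a measure \<Rightarrow> (real \<Rightarrow> 'a \<Rightarrow> real) \<Rightarrow> real \<Rightarrow> (real \<Rightarrow> real) measure" where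
  "law_from M X x = distr M path_space (\<lambda>\<omega>. \<lambda>t\<in>{0..}. x + X t \<omega>)"

text \<open>
  \<open>A t w\<close> is the value at time \<open>t\<close> of a (perfect) continuous additive functional of the Markov
  process \<open>(P\<^sup>x)\<^sub>x\<close>, adapted up to null sets, i.e. to the augmented natural filtration.
\<close>

definition continuous_additive_functional ::
    "'a measure \<Rightarrow> (real \<Rightarrow> 'a \<Rightarrow> real) \<Rightarrow> (real \<Rightarrow> (real \<Rightarrow> real) \<Rightarrow> real) \<Rightarrow> bool" where
  "continuous_additive_functional M X A \<longleftrightarrow>
     (\<forall>x. \<forall>t\<ge>0. \<exists>g\<in>borel_measurable (path_filtration t). AE w in law_from M X x. A t w = g w) \<and>
     (\<forall>x. AE w in law_from M X x.
        A 0 w = 0 \<and> mono_on {0..} (\<lambda>t. A t w) \<and> continuous_on {0..} (\<lambda>t. A t w) \<and>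
        (\<forall>s\<ge>0. \<forall>t\<ge>0. A (s + t) w = A s w + A t (path_shift s w)))"

text \<open>
  A local time at \<open>y\<close> is a continuous additive functional with support \<open>{y}\<close> in the sense of
  Blumenthal and Getoor: with \<open>R = inf {t. A t > 0}\<close>, one has \<open>P\<^sup>y(R = 0) = 1\<close>, and
  \<open>P\<^sup>x(R = 0) = 0\<close> for \<open>x \<noteq> y\<close>.
\<close>

definition local_time_at ::
    "'a measure \<Rightarrow> (real \<Rightarrow> 'a \<Rightarrow> real) \<Rightarrow> real \<Rightarrow> (real \<Rightarrow> (real \<Rightarrow> real) \<Rightarrow> real) \<Rightarrow> bool" where
  "local_time_at M X y A \<longleftrightarrow>
     continuous_additive_functional M X A \<and>
     (AE w in law_from M X y. \<forall>t>0. A t w > 0) \<and>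
     (\<forall>x. x \<noteq> y \<longrightarrow> (AE w in law_from M X x. \<exists>t>0. A t w = 0))"

text \<open>
  A local time at \<open>y\<close> is unique up to a constant factor. The last two clauses below fix these
  constants: the local times are densities of the occupation measure with respect to Lebesgue
  measure. As this determines the constant only for almost every level \<open>y\<close>, the family is moreover
  required to respect the spatial homogeneity of \<open>X\<close>: the local time of \<open>a + w\<close> at \<open>y + a\<close> is that of
  \<open>w\<close> at \<open>y\<close>. Joint measurability is stated for all real \<open>t\<close>; a family indexed by \<open>t \<ge> 0\<close> may be
  extended by 0.
\<close>

definition local_times ::
    "'a measure \<Rightarrow> (real \<Rightarrow> 'a \<Rightarrow> real) \<Rightarrow> (real \<Rightarrow> real \<Rightarrow> (real \<Rightarrow> real) \<Rightarrow> real) \<Rightarrow> bool" where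
  "local_times M X L \<longleftrightarrow>
     (\<lambda>(y, t, w). L y t w) \<in> borel_measurable (borel \<Otimes>\<^sub>M borel \<Otimes>\<^sub>M path_space) \<and>
     (\<forall>y. local_time_at M X y (L y)) \<and>
     (\<forall>x. AE w in law_from M X x. \<forall>t\<ge>0.
        distr (restrict_space lborel {0..t}) borel w = density lborel (\<lambda>y. ennreal (L y t w))) \<and>
     (\<forall>x y a. AE w in law_from M X x. \<forall>t\<ge>0. L (y + a) t (path_translate a w) = L y t w)"

text \<open>
  \<open>P\<^sup>x\<close> enlarged by an independent exponential time \<open>\<xi>\<^sub>\<alpha>\<close> with mean \<open>1 / \<alpha>\<close> (the second coordinate).
\<close>

definition law_from_exp ::
    "'a measure \<Rightarrow> (real \<Rightarrow> 'a \<Rightarrow> real) \<Rightarrow> real \<Rightarrow> real \<Rightarrow> ((real \<Rightarrow> real) \<times> real) measure" where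
  "law_from_exp M X \<alpha> x = law_from M X x \<Otimes>\<^sub>M density lborel (exponential_density \<alpha>)"

definition potential_density ::
    "'a measure \<Rightarrow> (real \<Rightarrow> 'a \<Rightarrow> real) \<Rightarrow> (real \<Rightarrow> real \<Rightarrow> (real \<Rightarrow> real) \<Rightarrow> real) \<Rightarrow>
     real \<Rightarrow> real \<Rightarrow> real \<Rightarrow> real" where
  "potential_density M X L \<alpha> x y = (\<integral>(w, \<xi>). L y \<xi> w \<partial>law_from_exp M X \<alpha> x)"

definition R_integrand :: "(real \<Rightarrow> complex) \<Rightarrow> real \<Rightarrow> real \<Rightarrow> real \<Rightarrow> real \<Rightarrow> real" where
  "R_integrand \<psi> \<alpha> x y v =
     cos (v * (x - y)) * Re (of_real \<alpha> + \<psi> v) / (cmod (of_real \<alpha> + \<psi> v))\<^sup>2"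

definition H_integrand :: "(real \<Rightarrow> complex) \<Rightarrow> real \<Rightarrow> real \<Rightarrow> real \<Rightarrow> real \<Rightarrow> real" where
  "H_integrand \<psi> \<alpha> x y v =
     sin (v * (x - y)) * Im (of_real \<alpha> + \<psi> v) / (cmod (of_real \<alpha> + \<psi> v))\<^sup>2"

text \<open>
  The integral in \<open>H_fun\<close> is in general only conditionally convergent (e.g. for a completely
  asymmetric Cauchy process), so both are Henstock-Kurzweil integrals over \<open>{0..}\<close>, which for
  these integrands are the improper integrals \<open>lim\<^sub>N \<integral>\<^sub>0\<^sup>N\<close>.
\<close>

definition R_fun :: "(real \<Rightarrow> complex) \<Rightarrow> real \<Rightarrow> real \<Rightarrow> real \<Rightarrow> real" where
  "R_fun \<psi> \<alpha> x y = 1 / pi * integral {0..} (R_integrand \<psi> \<alpha> x y)"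

definition H_fun :: "(real \<Rightarrow> complex) \<Rightarrow> real \<Rightarrow> real \<Rightarrow> real \<Rightarrow> real" where
  "H_fun \<psi> \<alpha> x y = 1 / pi * integral {0..} (H_integrand \<psi> \<alpha> x y)"

end

theory Submission
  imports Defs "HOL-Real_Asymp.Real_Asymp"
begin

text \<open>
  Let \<open>R\<close> be the first time at which the local time at \<open>y\<close> becomes positive. The process sits at \<open>y\<close>
  at time \<open>R\<close>, so the strong Markov property gives a constant \<open>c \<le> 1\<close> with \<open>u(x,y) = c u(y,y)\<close> and
  \<open>c u(y,z) \<le> u(x,z)\<close>. Consequently \<open>G(s) = u(0,s)\<close> satisfies \<open>G(s) \<le> G(0)\<close> and
  \<open>G(s) G(r) \<le> G(0) G(s+r)\<close>; since it is integrable it is finite, and continuity at \<open>0\<close>, hence everywhere,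
  follows from the smallness of local time over short times. By the occupation formula the Fourier
  transform of \<open>G\<close> is \<open>\<phi> = 1 / (\<alpha> + \<psi>)\<close>.

  The real part of \<open>\<phi>\<close> is nonnegative and is the transform of the even part of \<open>G\<close>, so Gaussian
  summation makes it integrable and Fourier inversion yields \<open>R\<^sub>\<alpha>\<close>. The imaginary part need not be
  integrable. For \<open>z \<noteq> 0\<close> one instead inverts the transform of \<open>(e\<^sup>i\<^sup>h\<^sup>s - 1) G(s)\<close>, where \<open>h = \<pi> / |z|\<close>: it is
  \<open>\<phi>(l + h) - \<phi>(l)\<close>, which is integrable because the increments of \<open>\<psi>\<close> are controlled by
  \<open>|E (e\<^sup>i\<^sup>l\<^sup>X - 1)(e\<^sup>i\<^sup>h\<^sup>X - 1)|\<close>, and this recovers the symmetric improper integral of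
  \<open>\<phi>(l) e\<^sup>-\<^sup>i\<^sup>l\<^sup>z\<close>.
\<close>

section \<open>Path space\<close>

text \<open>The identities are claimed for every pair of levels, while a transform determines a
  function only up to null sets. This is why \<open>G\<close> must be continuous at every point, and
  why homogeneity of the local times, which turns \<open>u x y\<close> into
  \<open>G (y - x)\<close>, is used from the start. The strong Markov property is proved at one
  random time only: adaptedness holds merely up to null sets, so the simple Markov property at each
  point of a dyadic grid is summed and the grid refined from the right. Additivity of local time can
  be applied at that random time because its exceptional null set is common to all times. On the
  transform side everything rests on the bound Re(\<alpha> + \<psi>) \<ge> \<alpha>, that is
  |\<phi>|^2 \<le> Re \<phi> / \<alpha>: once Re \<phi> is integrable, \<phi> is square integrable.
  Square integrability is used twice, for the shifted term in the bound on |\<phi>(l + h) -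
  \<phi>(l)| and for the end windows of fixed length h that remain when a symmetric interval is
  shifted by h.\<close>

lemma cadlag_cong:
  assumes "\<And>t. t \<ge> 0 \<Longrightarrow> w t = w' t"
  shows "cadlag w \<longleftrightarrow> cadlag w'"
proof -
  have 1: "(w \<longlongrightarrow> w t) (at_right t) \<longleftrightarrow> (w' \<longlongrightarrow> w' t) (at_right t)" if "t \<ge> 0" for t
    using that assms[of t] by (intro filterlim_cong) (auto simp: eventually_at_filter assms)
  have 2: "(w \<longlongrightarrow> l) (at_left t) \<longleftrightarrow> (w' \<longlongrightarrow> l) (at_left t)" if "t > 0" for t l
  proof (intro filterlim_cong refl)
    show "\<forall>\<^sub>F s in at_left t. w s = w' s"
      using eventually_at_left_field[of "\<lambda>s. w s = w' s" t] that assms by (auto intro!: exI[of _ 0])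
  qed
  show ?thesis
    unfolding cadlag_def by (auto simp: 1 2)
qed

lemma cadlag_shift_add:
  assumes "cadlag w" "r \<ge> 0"
  shows "cadlag (\<lambda>t. a + w (r + t))"
  unfolding cadlag_def
proof safe
  fix t :: real assume "t \<ge> 0"
  then have "(w \<longlongrightarrow> w (r + t)) (at_right (r + t))"
    using assms by (auto simp: cadlag_def)
  then have "((\<lambda>t. w (r + t)) \<longlongrightarrow> w (r + t)) (at_right t)"
    by (simp add: filterlim_at_right_to_0[of _ _ "r + t"] filterlim_at_right_to_0[of _ _ t] add_ac)
  then show "((\<lambda>t. a + w (r + t)) \<longlongrightarrow> a + w (r + t)) (at_right t)"
    by (intro tendsto_intros)
next
  fix t :: real assume "t > 0"
  then obtain l where "(w \<longlongrightarrow> l) (at_left (r + t))"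
    using assms by (auto simp: cadlag_def dest!: spec[of _ "r + t"])
  then have "((\<lambda>t. w (r + t)) \<longlongrightarrow> l) (at_left t)"
    by (simp add: at_left_minus[of t] at_left_minus[of "r + t"] filterlim_filtermap
      filterlim_at_right_to_0[of _ _ "- r - t"] filterlim_at_right_to_0[of _ _ "-t"] algebra_simps)
  then have "((\<lambda>t. a + w (r + t)) \<longlongrightarrow> a + l) (at_left t)"
    by (intro tendsto_intros)
  then show "\<exists>l. ((\<lambda>t. a + w (r + t)) \<longlongrightarrow> l) (at_left t)" ..
qed

lemma space_path_space: "space path_space = {w \<in> extensional {0..}. cadlag w}"
  by (auto simp: path_space_def space_restrict_space space_PiM PiE_UNIV_domain PiE_def)

lemma cadlag_path: "w \<in> space path_space \<Longrightarrow> cadlag w"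
  by (simp add: space_path_space)

text \<open>Elements of the product are extensional, so a map into \<open>path_space\<close> must
  take the value \<open>undefined\<close> at negative times; beyond that, the coordinates
  decide.\<close>

lemma path_measurableI:
  assumes "\<And>x t. x \<in> space M \<Longrightarrow> t < 0 \<Longrightarrow> f x t = undefined"
    and "\<And>x. x \<in> space M \<Longrightarrow> cadlag (f x)"
    and "\<And>t. t \<ge> 0 \<Longrightarrow> (\<lambda>x. f x t) \<in> borel_measurable M"
  shows "f \<in> M \<rightarrow>\<^sub>M path_space"
  unfolding path_space_def
proof (rule measurable_restrict_space2)
  show "f \<in> space M \<rightarrow> {w. cadlag w}" using assms by auto
  have "(\<lambda>x. \<lambda>t\<in>{0..}. f x t) \<in> M \<rightarrow>\<^sub>M (\<Pi>\<^sub>M t\<in>{0..}. borel)"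
    by (rule measurable_restrict) (use assms in auto)
  moreover have "(\<lambda>t\<in>{0..}. f x t) = f x" if "x \<in> space M" for x
    using that assms(1)[of x] by (auto simp: restrict_def fun_eq_iff)
  ultimately show "f \<in> M \<rightarrow>\<^sub>M (\<Pi>\<^sub>M t\<in>{0..}. borel)"
    by (subst measurable_cong[of _ _ "\<lambda>x. \<lambda>t\<in>{0..}. f x t"]) auto
qed

lemma path_to_PiM: "(\<lambda>w. w) \<in> path_space \<rightarrow>\<^sub>M (\<Pi>\<^sub>M t\<in>{0..}. borel)"
  unfolding path_space_def by (rule measurable_restrict_space1) simp

lemma path_eval_measurable: "t \<ge> 0 \<Longrightarrow> (\<lambda>w. w t) \<in> borel_measurable path_space"
  unfolding path_space_def
  by (intro measurable_restrict_space1 measurable_component_singleton) auto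

lemma path_restrict_measurable:
  "s \<ge> 0 \<Longrightarrow> (\<lambda>w. restrict w {0..s}) \<in> path_space \<rightarrow>\<^sub>M (\<Pi>\<^sub>M t\<in>{0..s}. borel)"
  by (rule measurable_restrict) (auto intro: path_eval_measurable)

lemma cadlag_LIMSEQ:
  assumes "cadlag w" "\<And>n. s n > t" "s \<longlonglongrightarrow> t" "t \<ge> 0"
  shows "(\<lambda>n. w (s n)) \<longlonglongrightarrow> w t"
proof -
  have "filterlim s (at_right t) sequentially"
    using assms by (auto simp: filterlim_at intro!: always_eventually)
  then show ?thesis
    using assms filterlim_compose[of w "nhds (w t)" "at_right t" s] by (auto simp: cadlag_def)
qed

text \<open>Evaluation at a variable time is a limit of evaluations at grid times just to the right
  of it, by right continuity. At each level the grid time takes countably many values, so the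
  approximations are measurable.\<close>

lemma path_joint_measurable:
  "(\<lambda>(t, w). w (max 0 t)) \<in> borel_measurable (borel \<Otimes>\<^sub>M path_space)"
proof -
  \<comment> \<open>The \<open>+ 1\<close> places the grid time strictly to the right of
    \<open>max 0 t\<close>, at distance at most \<open>1 / Suc n\<close>, as
    \<open>cadlag_LIMSEQ\<close> requires.\<close>
  define s where "s n t = real (nat \<lfloor>real (Suc n) * max 0 t\<rfloor> + 1) / real (Suc n)" for n :: nat and t :: real
  have 1: "(\<lambda>(t, w). w (s n t)) \<in> borel_measurable (borel \<Otimes>\<^sub>M path_space)" for n
  proof -
    have "(\<lambda>x. snd x (real (nat \<lfloor>real (Suc n) * max 0 (fst x)\<rfloor> + 1) / real (Suc n)))
       \<in> borel_measurable (borel \<Otimes>\<^sub>M path_space)"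
    proof (rule measurable_compose_countable[where f="\<lambda>k x. snd x (real (k + 1) / real (Suc n))"])
      fix k :: nat
      show "(\<lambda>x. snd x (real (k + 1) / real (Suc n))) \<in> borel_measurable ((borel :: real measure) \<Otimes>\<^sub>M path_space)"
        by (rule measurable_compose[OF measurable_snd path_eval_measurable]) simp
    qed measurable
    then show ?thesis by (simp add: s_def case_prod_beta')
  qed
  have 2: "(\<lambda>n. case x of (t, w) \<Rightarrow> w (s n t)) \<longlonglongrightarrow> (case x of (t, w) \<Rightarrow> w (max 0 t))"
    if x: "x \<in> space (borel \<Otimes>\<^sub>M path_space)" for x :: "real \<times> (real \<Rightarrow> real)"
  proof -
  obtain t w where [simp]: "x = (t, w)" by force
  have w: "cadlag w" using x by (auto simp: space_pair_measure cadlag_path)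
  have b: "max 0 t < s n t \<and> s n t \<le> max 0 t + 1 / real (Suc n)" for n
  proof -
    define y where "y = real (Suc n) * max 0 t"
    have y: "y < of_int \<lfloor>y\<rfloor> + 1" "of_int \<lfloor>y\<rfloor> \<le> y" by linarith+
    have "y \<ge> 0" by (simp add: y_def)
    then have "real (nat \<lfloor>y\<rfloor> + 1) = of_int \<lfloor>y\<rfloor> + 1" by simp
    then have "s n t = (of_int \<lfloor>y\<rfloor> + 1) / real (Suc n)" by (simp only: s_def y_def)
    moreover have "max 0 t = y / real (Suc n)" by (simp add: y_def del: of_nat_Suc)
    ultimately show ?thesis using y
      by (simp add: add_divide_distrib[symmetric] divide_le_cancel divide_less_cancel del: of_nat_Suc)
  qed
  have 3: "(\<lambda>n. max 0 t + 1 / real (Suc n)) \<longlonglongrightarrow> max 0 t"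
    using tendsto_add[OF tendsto_const LIMSEQ_inverse_real_of_nat, of "max 0 t"] by (simp add: inverse_eq_divide)
  have "(\<lambda>n. s n t) \<longlonglongrightarrow> max 0 t"
  proof (rule tendsto_sandwich[OF _ _ tendsto_const 3])
    show "\<forall>\<^sub>F n in sequentially. max 0 t \<le> s n t"
      using b by (intro always_eventually allI less_imp_le) simp
    show "\<forall>\<^sub>F n in sequentially. s n t \<le> max 0 t + 1 / real (Suc n)"
      by (rule always_eventually) (simp add: b del: of_nat_Suc)
  qed
  then have "(\<lambda>n. w (s n t)) \<longlonglongrightarrow> w (max 0 t)"
    by (rule cadlag_LIMSEQ[OF w conjunct1[OF b]]) simp
  then show ?thesis by simp
  qed
  show ?thesis
    by (rule borel_measurable_LIMSEQ_metric[OF 1 2])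
qed

lemma path_eval_compose:
  assumes "f \<in> borel_measurable N" "g \<in> N \<rightarrow>\<^sub>M path_space"
  shows "(\<lambda>x. g x (max 0 (f x))) \<in> borel_measurable N"
  using measurable_compose[OF measurable_Pair[OF assms] path_joint_measurable] by (simp only: prod.case)

text \<open>The increments after time \<open>r\<close>, not the shifted path, are what is
  independent of the past. Clipping by \<open>max 0 r\<close> makes the map total and jointly
  measurable in \<open>r\<close>, so that a random time can be inserted.\<close>

definition path_incr :: "real \<Rightarrow> (real \<Rightarrow> real) \<Rightarrow> real \<Rightarrow> real" where
  "path_incr r w = (\<lambda>t\<in>{0..}. w (max 0 r + t) - w (max 0 r))"

lemma path_incr_measurable [measurable]:
  "(\<lambda>(r, w). path_incr r w) \<in> borel \<Otimes>\<^sub>M path_space \<rightarrow>\<^sub>M path_space"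
proof (rule path_measurableI)
  fix x :: "real \<times> (real \<Rightarrow> real)" assume x: "x \<in> space (borel \<Otimes>\<^sub>M path_space)"
  obtain r w where [simp]: "x = (r, w)" by force
  have "cadlag (\<lambda>t. - w (max 0 r) + w (max 0 r + t))"
    using x by (intro cadlag_shift_add[of w "max 0 r" "- w (max 0 r)"]) (auto simp: space_pair_measure cadlag_path)
  moreover have "cadlag (path_incr r w) \<longleftrightarrow> cadlag (\<lambda>t. - w (max 0 r) + w (max 0 r + t))"
    by (rule cadlag_cong) (simp add: path_incr_def)
  ultimately show "cadlag (case x of (r, w) \<Rightarrow> path_incr r w)"
    by simp
next
  fix t :: real assume t: "t \<ge> 0"
  have "(\<lambda>x. snd x (max 0 (max 0 (fst x) + t)) - snd x (max 0 (fst x))) \<in> borel_measurable (borel \<Otimes>\<^sub>M path_space)"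
    by (intro borel_measurable_diff path_eval_compose[where g=snd and f="\<lambda>x. max 0 (fst x) + t"]
      path_eval_compose[where g=snd and f=fst]) measurable
  moreover have "(case x of (r, w) \<Rightarrow> path_incr r w) t = snd x (max 0 (max 0 (fst x) + t)) - snd x (max 0 (fst x))"
    for x using t by (simp add: path_incr_def max_absorb2 split: prod.split)
  ultimately show "(\<lambda>x. (case x of (r, w) \<Rightarrow> path_incr r w) t) \<in> borel_measurable (borel \<Otimes>\<^sub>M path_space)"
    by (simp only:)
next
  fix x :: "real \<times> (real \<Rightarrow> real)" and t :: real assume t: "t < 0"
  obtain r w where "x = (r, w)" by force
  then show "(case x of (r, w) \<Rightarrow> path_incr r w) t = undefined"
    using t by (simp add: path_incr_def)
qed

lemma path_translate_measurable [measurable]: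
  "(\<lambda>(a, w). path_translate a w) \<in> borel \<Otimes>\<^sub>M path_space \<rightarrow>\<^sub>M path_space"
proof (rule path_measurableI)
  fix x :: "real \<times> (real \<Rightarrow> real)" assume x: "x \<in> space (borel \<Otimes>\<^sub>M path_space)"
  obtain r w where [simp]: "x = (r, w)" by force
  have "cadlag (\<lambda>t. r + w (0 + t))"
    using x by (intro cadlag_shift_add[of w 0 r]) (auto simp: space_pair_measure cadlag_path)
  moreover have "cadlag (path_translate r w) \<longleftrightarrow> cadlag (\<lambda>t. r + w (0 + t))"
    by (rule cadlag_cong) (simp add: path_translate_def)
  ultimately show "cadlag (case x of (r, w) \<Rightarrow> path_translate r w)"
    by simp
next
  fix t :: real assume t: "t \<ge> 0"
  have "(\<lambda>x. fst x + snd x t) \<in> borel_measurable (borel \<Otimes>\<^sub>M path_space)"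
    by (rule borel_measurable_add[OF measurable_fst measurable_compose[OF measurable_snd path_eval_measurable[OF t]]])
  then show "(\<lambda>x. (case x of (a, w) \<Rightarrow> path_translate a w) t) \<in> borel_measurable (borel \<Otimes>\<^sub>M path_space)"
    using t by (simp add: path_translate_def case_prod_beta')
next
  fix x :: "real \<times> (real \<Rightarrow> real)" and t :: real assume t: "t < 0"
  obtain r w where "x = (r, w)" by force
  then show "(case x of (r, w) \<Rightarrow> path_translate r w) t = undefined"
    using t by (simp add: path_translate_def)
qed

text \<open>Splits the future into the position at \<open>r\<close>, which belongs to the past, and
  the increments, which have law \<open>P 0\<close>. This is how statements about increments become
  statements about shifted paths.\<close>

lemma path_shift_eq:
  assumes "r \<ge> 0"
  shows "path_shift r w = path_translate (w r) (path_incr r w)"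
proof
  fix t show "path_shift r w t = path_translate (w r) (path_incr r w) t"
    using assms unfolding path_shift_def path_translate_def path_incr_def
    by (simp add: max_absorb2)
qed

text \<open>Uniqueness from cylinder sets is available on the full product, so both measures are
  pushed there. Nothing is lost, because every measurable set of paths is the trace of a product set
  on the cadlag paths.\<close>

lemma path_measure_eqI:
  assumes M: "sets M = sets path_space" and N: "sets N = sets path_space" and fin: "finite_measure M"
    and eq: "\<And>J B. finite J \<Longrightarrow> J \<subseteq> {0..} \<Longrightarrow> (\<And>t. t \<in> J \<Longrightarrow> B t \<in> sets borel) \<Longrightarrow>
      emeasure M {w \<in> space path_space. \<forall>t\<in>J. w t \<in> B t} = emeasure N {w \<in> space path_space. \<forall>t\<in>J. w t \<in> B t}"
  shows "M = N"
proof -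
  let ?P = "Pi\<^sub>M {0..} (\<lambda>_. borel) :: (real \<Rightarrow> real) measure"
  have [measurable]: "(\<lambda>w. w) \<in> measurable M ?P" "(\<lambda>w. w) \<in> measurable N ?P"
    using path_to_PiM by (simp_all only: measurable_cong_sets[OF M refl] measurable_cong_sets[OF N refl])
  have sp: "space M = space path_space" "space N = space path_space"
    using M N by (auto dest: sets_eq_imp_space_eq)
  have eq': "distr M ?P (\<lambda>w. w) = distr N ?P (\<lambda>w. w)"
  proof (rule measure_eqI_PiM_infinite)
    fix A :: "real \<Rightarrow> real set" and J :: "real set"
    assume J: "finite J" "J \<subseteq> {0..}" "\<And>i. i \<in> J \<Longrightarrow> A i \<in> sets borel"
    have "(\<lambda>w. w) -` prod_emb {0..} (\<lambda>_. borel) J (Pi\<^sub>E J A) \<inter> space path_space = {w \<in> space path_space. \<forall>t\<in>J. w t \<in> A t}"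
      by (auto simp: prod_emb_def space_path_space PiE_iff extensional_def)
    moreover have "prod_emb {0..} (\<lambda>_. borel) J (Pi\<^sub>E J A) \<in> sets ?P"
      using J by (intro sets_PiM_I) auto
    ultimately show "emeasure (distr M ?P (\<lambda>w. w)) (prod_emb {0..} (\<lambda>_. borel) J (Pi\<^sub>E J A)) =
        emeasure (distr N ?P (\<lambda>w. w)) (prod_emb {0..} (\<lambda>_. borel) J (Pi\<^sub>E J A))"
      using eq[OF J] by (simp add: emeasure_distr sp)
  qed (auto intro!: finite_measure.finite_measure_distr fin)
  show ?thesis
  proof (rule measure_eqI)
    show "sets M = sets N" using M N by simp
    fix A assume "A \<in> sets M"
    then obtain B where B: "B \<in> sets ?P" "A = {w. cadlag w} \<inter> B"
      by (auto simp: M path_space_def sets_restrict_space)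
    then have A: "A = (\<lambda>w. w) -` B \<inter> space path_space"
      using sets.sets_into_space[OF B(1)] by (auto simp: space_path_space space_PiM PiE_iff)
    show "emeasure M A = emeasure N A"
      using arg_cong[OF eq', of "\<lambda>M. emeasure M B"] B by (simp add: emeasure_distr sp A)
  qed
qed

section \<open>The Markov property\<close>

text \<open>\<open>levy_process\<close> speaks of increments along a monotone sequence of times;
  this produces such a sequence through a given finite set.\<close>

lemma finite_enumeration:
  fixes T :: "real set"
  assumes "finite T" "T \<subseteq> {0..}" "0 \<in> T"
  obtains \<tau> :: "nat \<Rightarrow> real" and n where "mono \<tau>" "\<tau> 0 = 0" "\<tau> ` {..n} = T" "n = card T - 1"
proof
  let ?l = "sorted_list_of_set T"
  define n where "n = card T - 1"
  \<comment> \<open>\<open>min i n\<close> freezes the sequence at its last time, so that it is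
    monotone on all of \<open>nat\<close>, as \<open>X_indep\<close> demands.\<close>
  define \<tau> where "\<tau> i = ?l ! min i n" for i
  have len: "length ?l = Suc n"
    using assms card_gt_0_iff[of T] by (auto simp: n_def)
  show "mono \<tau>"
    unfolding \<tau>_def mono_def using len by (auto intro!: sorted_nth_mono)
  show im: "\<tau> ` {..n} = T"
  proof -
    have "\<tau> ` {..n} = (!) ?l ` {..n}"
      by (auto simp: \<tau>_def)
    moreover have "{..n} = {0..<length ?l}"
      using len by (simp add: atLeast0LessThan lessThan_Suc_atMost del: length_sorted_list_of_set)
    moreover have "(!) ?l ` {0..<length ?l} = T"
      using assms(1) by (subst nth_image) simp_all
    ultimately show ?thesis by (simp only:)
  qed
  obtain i where "\<tau> i = 0" using im assms by force
  moreover have "\<tau> 0 \<in> T" using im by auto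
  ultimately show "\<tau> 0 = 0"
    using monoD[OF \<open>mono \<tau>\<close>, of 0 i] assms by force
qed (rule refl)

locale levy =
  fixes M :: "'a measure" and X :: "real \<Rightarrow> 'a \<Rightarrow> real"
  assumes levy: "levy_process M X"
begin

sublocale prob_space M
  using levy unfolding levy_process_def by blast

abbreviation P :: "real \<Rightarrow> (real \<Rightarrow> real) measure" where
  "P \<equiv> law_from M X"

lemmas levy_conjs = levy[unfolded levy_process_def]

lemma X_measurable: "t \<ge> 0 \<Longrightarrow> X t \<in> borel_measurable M"
  using levy_conjs[THEN conjunct2, THEN conjunct1] by blast

lemma X_zero: "\<omega> \<in> space M \<Longrightarrow> X 0 \<omega> = 0"
  using levy_conjs[THEN conjunct2, THEN conjunct2, THEN conjunct1] by blast

lemma X_cadlag: "\<omega> \<in> space M \<Longrightarrow> cadlag (\<lambda>t. X t \<omega>)"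
  using levy_conjs[THEN conjunct2, THEN conjunct2, THEN conjunct2, THEN conjunct1] by blast

lemma X_indep:
  assumes "0 \<le> \<tau> 0" "mono \<tau>"
  shows "indep_vars (\<lambda>_. borel) (\<lambda>i \<omega>. X (\<tau> (Suc i)) \<omega> - X (\<tau> i) \<omega>) {..<n}"
  by (rule levy_conjs[THEN conjunct2, THEN conjunct2, THEN conjunct2, THEN conjunct2, THEN conjunct1,
    THEN spec[of _ \<tau>], THEN spec[of _ n], THEN mp]) (use assms in simp)

lemma X_stationary:
  "0 \<le> s \<Longrightarrow> s \<le> t \<Longrightarrow> distr M borel (\<lambda>\<omega>. X t \<omega> - X s \<omega>) = distr M borel (X (t - s))"
proof -
  assume "0 \<le> s" "s \<le> t"
  then have "distr M borel (\<lambda>\<omega>. X (s + (t - s)) \<omega> - X s \<omega>) = distr M borel (X (t - s))"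
    using levy unfolding levy_process_def by (metis diff_ge_0_iff_ge)
  then show ?thesis by simp
qed

lemma path_map_measurable [measurable]: "(\<lambda>\<omega>. \<lambda>t\<in>{0..}. x + X t \<omega>) \<in> M \<rightarrow>\<^sub>M path_space"
proof (rule path_measurableI)
  fix \<omega> assume "\<omega> \<in> space M"
  then have "cadlag (\<lambda>t. X t \<omega>)" by (rule X_cadlag)
  then have "cadlag (\<lambda>t. x + X (0 + t) \<omega>)" by (rule cadlag_shift_add) simp
  then show "cadlag (\<lambda>t\<in>{0..}. x + X t \<omega>)"
    by (subst cadlag_cong[of _ "\<lambda>t. x + X (0 + t) \<omega>"]) auto
next
  fix t :: real assume t: "t \<ge> 0"
  have "(\<lambda>\<omega>. x + X t \<omega>) \<in> borel_measurable M"
    by (rule borel_measurable_add[OF borel_measurable_const X_measurable[OF t]])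
  with t show "(\<lambda>\<omega>. (\<lambda>t\<in>{0..}. x + X t \<omega>) t) \<in> borel_measurable M"
    by simp
qed simp

lemma sets_P [simp, measurable_cong]: "sets (P x) = sets path_space"
  by (simp add: law_from_def)

lemma space_P [simp]: "space (P x) = space path_space"
  by (simp add: law_from_def)

sublocale P: prob_space "P x" for x
  unfolding law_from_def by (rule prob_space_distr) measurable

lemma emeasure_P:
  assumes "{w \<in> space path_space. Q w} \<in> sets path_space"
  shows "emeasure (P x) {w \<in> space path_space. Q w} = emeasure M {\<omega> \<in> space M. Q (\<lambda>t\<in>{0..}. x + X t \<omega>)}"
proof -
  have "emeasure (P x) {w \<in> space path_space. Q w} =
      emeasure M ((\<lambda>\<omega>. \<lambda>t\<in>{0..}. x + X t \<omega>) -` {w \<in> space path_space. Q w} \<inter> space M)"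
    unfolding law_from_def by (rule emeasure_distr[OF path_map_measurable assms])
  also have "(\<lambda>\<omega>. \<lambda>t\<in>{0..}. x + X t \<omega>) -` {w \<in> space path_space. Q w} \<inter> space M =
      {\<omega> \<in> space M. Q (\<lambda>t\<in>{0..}. x + X t \<omega>)}"
    using measurable_space[OF path_map_measurable] by auto
  finally show ?thesis .
qed

text \<open>Stationarity is assumed for one increment at a time. Independence makes the joint law of
  the grid increments a product of one-dimensional laws, none of which depends on the starting time,
  and \<open>X (s + k) - X s\<close> is a partial sum of these increments.\<close>

lemma increments_stationary:
  assumes "finite K" "K \<subseteq> {0..}" "s \<ge> 0" and B: "\<And>k. k \<in> K \<Longrightarrow> B k \<in> sets borel"
  shows "emeasure M {\<omega> \<in> space M. \<forall>k\<in>K. X (s + k) \<omega> - X s \<omega> \<in> B k} = emeasure M {\<omega> \<in> space M. \<forall>k\<in>K. X k \<omega> \<in> B k}"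
proof -
  \<comment> \<open>Adding the time 1 guarantees at least one grid interval: the product form of
    independence used below asks for a nonempty index set.\<close>
  have T: "finite (insert 0 (insert 1 K))" "insert 0 (insert 1 K) \<subseteq> {0::real..}" "0 \<in> insert 0 (insert 1 K)"
    using assms by auto
  obtain \<tau> :: "nat \<Rightarrow> real" and n where \<tau>: "mono \<tau>" "\<tau> 0 = 0" "\<tau> ` {..n} = insert 0 (insert 1 K)" "n = card (insert 0 (insert 1 K)) - 1"
    by (rule finite_enumeration[OF T])
  have pos: "\<tau> i \<ge> 0" for i using monoD[OF \<tau>(1), of 0 i] \<tau>(2) by simp
  have "n > 0"
    using assms(1) card_mono[OF T(1), of "{0, 1}"] \<tau>(4) by auto
  have "\<exists>i\<in>{..n}. \<tau> i = k" if "k \<in> K" for k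
    using that \<tau>(3) by (metis imageE insertCI)
  then obtain idx where idx: "\<And>k. k \<in> K \<Longrightarrow> idx k \<le> n \<and> \<tau> (idx k) = k"
    by (metis atMost_iff)
  define Y where "Y r i \<omega> = X (r + \<tau> (Suc i)) \<omega> - X (r + \<tau> i) \<omega>" for r i \<omega>
  have Ym: "Y r i \<in> borel_measurable M" if "r \<ge> 0" for r i
    using that pos unfolding Y_def by (intro borel_measurable_diff X_measurable) auto
  have law: "distr M (\<Pi>\<^sub>M i\<in>{..<n}. borel) (\<lambda>\<omega>. \<lambda>i\<in>{..<n}. Y r i \<omega>) = (\<Pi>\<^sub>M i\<in>{..<n}. distr M borel (X (\<tau> (Suc i) - \<tau> i)))"
    if r: "r \<ge> 0" for r
  proof -
    have "indep_vars (\<lambda>_. borel) (Y r) {..<n}"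
      using X_indep[of "\<lambda>i. r + \<tau> i" n] r pos \<tau>(1) unfolding Y_def by (auto simp: mono_def)
    then have "distr M (\<Pi>\<^sub>M i\<in>{..<n}. borel) (\<lambda>\<omega>. \<lambda>i\<in>{..<n}. Y r i \<omega>) = (\<Pi>\<^sub>M i\<in>{..<n}. distr M borel (Y r i))"
      using \<open>n > 0\<close> Ym r by (subst (asm) indep_vars_iff_distr_eq_PiM') auto
    moreover have "distr M borel (Y r i) = distr M borel (X (\<tau> (Suc i) - \<tau> i))" for i
      using X_stationary[of "r + \<tau> i" "r + \<tau> (Suc i)"] r pos monoD[OF \<tau>(1), of i "Suc i"]
      unfolding Y_def by (simp add: add_nonneg_nonneg)
    ultimately show ?thesis by (simp only:)
  qed
  define E where "E = {f \<in> space (\<Pi>\<^sub>M i\<in>{..<n}. (borel :: real measure)). \<forall>k\<in>K. (\<Sum>i<idx k. f i) \<in> B k}"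
  have E: "E \<in> sets (\<Pi>\<^sub>M i\<in>{..<n}. (borel :: real measure))"
    unfolding E_def
  proof (rule sets.sets_Collect_finite_All[OF _ assms(1)])
    fix k assume k: "k \<in> K"
    have "(\<lambda>f. \<Sum>i<idx k. f i) \<in> borel_measurable (\<Pi>\<^sub>M i\<in>{..<n}. (borel :: real measure))"
      using idx[OF k] by (intro borel_measurable_sum measurable_component_singleton) auto
    from measurable_sets_Collect[OF this, of "\<lambda>x. x \<in> B k"] B[OF k]
    show "{f \<in> space (\<Pi>\<^sub>M i\<in>{..<n}. (borel :: real measure)). (\<Sum>i<idx k. f i) \<in> B k} \<in> sets (\<Pi>\<^sub>M i\<in>{..<n}. borel)"
      by simp
  qed
  have *: "emeasure M {\<omega> \<in> space M. \<forall>k\<in>K. X (r + k) \<omega> - X r \<omega> \<in> B k} =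
      emeasure (\<Pi>\<^sub>M i\<in>{..<n}. distr M borel (X (\<tau> (Suc i) - \<tau> i))) E" if r: "r \<ge> 0" for r
  proof -
    have "(\<Sum>i<idx k. Y r i \<omega>) = X (r + k) \<omega> - X r \<omega>" if "k \<in> K" for k \<omega>
      using idx[OF that] \<tau>(2) unfolding Y_def by (subst sum_lessThan_telescope) simp
    then have "(\<Sum>i<idx k. (\<lambda>i\<in>{..<n}. Y r i \<omega>) i) = X (r + k) \<omega> - X r \<omega>" if "k \<in> K" for k \<omega>
      using that idx[OF that] by (auto intro!: sum.cong simp: restrict_def subset_eq)
    then have "(\<lambda>\<omega>. \<lambda>i\<in>{..<n}. Y r i \<omega>) -` E \<inter> space M = {\<omega> \<in> space M. \<forall>k\<in>K. X (r + k) \<omega> - X r \<omega> \<in> B k}"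
      by (auto simp: E_def space_PiM simp del: restrict_apply)
    moreover have "(\<lambda>\<omega>. \<lambda>i\<in>{..<n}. Y r i \<omega>) \<in> M \<rightarrow>\<^sub>M (\<Pi>\<^sub>M i\<in>{..<n}. borel)"
      using Ym[OF r] by (intro measurable_restrict)
    ultimately show ?thesis
      using E by (simp add: law[OF r, symmetric] emeasure_distr)
  qed
  have "{\<omega> \<in> space M. \<forall>k\<in>K. X k \<omega> \<in> B k} = {\<omega> \<in> space M. \<forall>k\<in>K. X (0 + k) \<omega> - X 0 \<omega> \<in> B k}"
    by (auto simp: X_zero)
  then show ?thesis using *[of s] *[of 0] assms(3) by simp
qed

text \<open>A single grid through \<open>J\<close>, \<open>s\<close> and \<open>s + K\<close>
  reduces the claim to two disjoint blocks of an independent family: increments before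
  \<open>s\<close> determine the past, since \<open>X 0 = 0\<close>, and those after
  \<open>s\<close> the future. \<open>increments_stationary\<close> then moves the future back to
  time 0.\<close>

lemma increments_indep:
  assumes J: "finite J" "J \<subseteq> {0..s}" and K: "finite K" "K \<subseteq> {0..}" and s: "s \<ge> 0"
    and A: "\<And>j. j \<in> J \<Longrightarrow> A j \<in> sets borel" and B: "\<And>k. k \<in> K \<Longrightarrow> B k \<in> sets borel"
  shows "emeasure M {\<omega> \<in> space M. (\<forall>j\<in>J. x + X j \<omega> \<in> A j) \<and> (\<forall>k\<in>K. X (s + k) \<omega> - X s \<omega> \<in> B k)} =
    emeasure M {\<omega> \<in> space M. \<forall>j\<in>J. x + X j \<omega> \<in> A j} * emeasure M {\<omega> \<in> space M. \<forall>k\<in>K. X k \<omega> \<in> B k}"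
proof -
  define T where "T = insert 0 (insert s (J \<union> (+) s ` K))"
  have T: "finite T" "T \<subseteq> {0..}" "0 \<in> T"
    using assms by (auto simp: T_def)
  obtain \<tau> :: "nat \<Rightarrow> real" and n where \<tau>: "mono \<tau>" "\<tau> 0 = 0" "\<tau> ` {..n} = T" "n = card T - 1"
    by (rule finite_enumeration[OF T])
  have "\<exists>i\<in>{..n}. \<tau> i = t" if "t \<in> T" for t
    using that \<tau>(3) by (metis imageE)
  then obtain idx where idx: "\<And>t. t \<in> T \<Longrightarrow> idx t \<le> n \<and> \<tau> (idx t) = t"
    by (metis atMost_iff)
  \<comment> \<open>The grid index of time \<open>s\<close>, where the two blocks meet.\<close>
  define p where "p = idx s"
  have "s \<in> T" by (simp add: T_def)
  then have p: "\<tau> p = s" "p \<le> n" using idx by (auto simp: p_def)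
  have mono_idx: "idx t \<le> idx t'" if "t \<in> T" "t' \<in> T" "t \<le> t'" for t t'
  proof (cases "t = t'")
    case False
    then have "\<not> idx t' \<le> idx t"
      using that idx[OF that(1)] idx[OF that(2)] monoD[OF \<tau>(1), of "idx t'" "idx t"] by auto
    then show ?thesis by simp
  qed simp
  have pos: "\<tau> i \<ge> 0" for i using monoD[OF \<tau>(1), of 0 i] \<tau>(2) by simp
  define Y where "Y i \<omega> = X (\<tau> (Suc i)) \<omega> - X (\<tau> i) \<omega>" for i \<omega>
  have indep: "indep_vars (\<lambda>_. borel) Y {..<n}"
    using X_indep[of \<tau> n] \<tau> unfolding Y_def by simp
  define U where "U \<omega> = restrict (\<lambda>i. Y i \<omega>) {..<p}" for \<omega>
  define V where "V \<omega> = restrict (\<lambda>i. Y i \<omega>) {p..<n}" for \<omega>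
  have UV: "indep_var (\<Pi>\<^sub>M i\<in>{..<p}. borel) U (\<Pi>\<^sub>M i\<in>{p..<n}. borel) V"
    unfolding U_def V_def by (rule indep_var_restrict[OF indep]) (use p in auto)
  define E where "E = {f \<in> space (\<Pi>\<^sub>M i\<in>{..<p}. (borel :: real measure)). \<forall>j\<in>J. x + (\<Sum>i<idx j. f i) \<in> A j}"
  define F where "F = {f \<in> space (\<Pi>\<^sub>M i\<in>{p..<n}. (borel :: real measure)). \<forall>k\<in>K. (\<Sum>i=p..<idx (s + k). f i) \<in> B k}"
  have JT: "j \<in> T" "idx j \<le> p" if "j \<in> J" for j
    using that J(2) mono_idx[of j s] by (auto simp: T_def p_def)
  have KT: "s + k \<in> T" "p \<le> idx (s + k)" "idx (s + k) \<le> n" if "k \<in> K" for k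
    using that K(2) mono_idx[of s "s + k"] idx[of "s + k"] by (auto simp: T_def p_def)
  have E: "E \<in> sets (\<Pi>\<^sub>M i\<in>{..<p}. (borel :: real measure))"
    unfolding E_def
  proof (rule sets.sets_Collect_finite_All[OF _ J(1)])
    fix j assume j: "j \<in> J"
    have "(\<lambda>f. x + (\<Sum>i<idx j. f i)) \<in> borel_measurable (\<Pi>\<^sub>M i\<in>{..<p}. (borel :: real measure))"
      using JT[OF j] by (intro borel_measurable_add borel_measurable_sum measurable_component_singleton borel_measurable_const) auto
    from measurable_sets_Collect[OF this, of "\<lambda>x. x \<in> A j"] A[OF j]
    show "{f \<in> space (\<Pi>\<^sub>M i\<in>{..<p}. (borel :: real measure)). x + (\<Sum>i<idx j. f i) \<in> A j} \<in> sets (\<Pi>\<^sub>M i\<in>{..<p}. borel)"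
      by simp
  qed
  have F: "F \<in> sets (\<Pi>\<^sub>M i\<in>{p..<n}. (borel :: real measure))"
    unfolding F_def
  proof (rule sets.sets_Collect_finite_All[OF _ K(1)])
    fix k assume k: "k \<in> K"
    have "(\<lambda>f. \<Sum>i=p..<idx (s + k). f i) \<in> borel_measurable (\<Pi>\<^sub>M i\<in>{p..<n}. (borel :: real measure))"
      using KT[OF k] by (intro borel_measurable_sum measurable_component_singleton) auto
    from measurable_sets_Collect[OF this, of "\<lambda>x. x \<in> B k"] B[OF k]
    show "{f \<in> space (\<Pi>\<^sub>M i\<in>{p..<n}. (borel :: real measure)). (\<Sum>i=p..<idx (s + k). f i) \<in> B k} \<in> sets (\<Pi>\<^sub>M i\<in>{p..<n}. borel)"
      by simp
  qed
  have UE: "U \<omega> \<in> E \<longleftrightarrow> (\<forall>j\<in>J. x + X j \<omega> \<in> A j)" if \<omega>: "\<omega> \<in> space M" for \<omega>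
  proof -
    have "(\<Sum>i<idx j. U \<omega> i) = X j \<omega>" if j: "j \<in> J" for j
    proof -
      have "(\<Sum>i<idx j. U \<omega> i) = (\<Sum>i<idx j. Y i \<omega>)"
        using JT[OF j] by (intro sum.cong) (auto simp: U_def)
      also have "\<dots> = X j \<omega>"
        using idx[OF JT(1)[OF j]] \<tau>(2) X_zero[OF \<omega>] unfolding Y_def by (subst sum_lessThan_telescope) simp
      finally show ?thesis .
    qed
    moreover have "U \<omega> \<in> space (\<Pi>\<^sub>M i\<in>{..<p}. borel)" by (auto simp: U_def space_PiM)
    ultimately show ?thesis by (simp add: E_def)
  qed
  have VF: "V \<omega> \<in> F \<longleftrightarrow> (\<forall>k\<in>K. X (s + k) \<omega> - X s \<omega> \<in> B k)" for \<omega>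
  proof -
    have "(\<Sum>i=p..<idx (s + k). V \<omega> i) = X (s + k) \<omega> - X s \<omega>" if k: "k \<in> K" for k
    proof -
      have "(\<Sum>i=p..<idx (s + k). V \<omega> i) = (\<Sum>i=p..<idx (s + k). Y i \<omega>)"
        using KT[OF k] by (intro sum.cong) (auto simp: V_def)
      also have "\<dots> = X (s + k) \<omega> - X s \<omega>"
        using idx[OF KT(1)[OF k]] p KT(2)[OF k] unfolding Y_def
        by (subst sum_Suc_diff'[of p "idx (s + k)" "\<lambda>i. X (\<tau> i) \<omega>"]) auto
      finally show ?thesis .
    qed
    moreover have "V \<omega> \<in> space (\<Pi>\<^sub>M i\<in>{p..<n}. borel)" by (auto simp: V_def space_PiM)
    ultimately show ?thesis by (simp add: F_def)
  qed
  have "prob ((\<lambda>\<omega>. (U \<omega>, V \<omega>)) -` (E \<times> F) \<inter> space M) = prob (U -` E \<inter> space M) * prob (V -` F \<inter> space M)"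
    by (rule indep_varD[OF UV E F])
  moreover have "(\<lambda>\<omega>. (U \<omega>, V \<omega>)) -` (E \<times> F) \<inter> space M =
      {\<omega> \<in> space M. (\<forall>j\<in>J. x + X j \<omega> \<in> A j) \<and> (\<forall>k\<in>K. X (s + k) \<omega> - X s \<omega> \<in> B k)}"
    using UE VF by auto
  moreover have "U -` E \<inter> space M = {\<omega> \<in> space M. \<forall>j\<in>J. x + X j \<omega> \<in> A j}" using UE by auto
  moreover have "V -` F \<inter> space M = {\<omega> \<in> space M. \<forall>k\<in>K. X (s + k) \<omega> - X s \<omega> \<in> B k}" using VF by auto
  ultimately show ?thesis
    using increments_stationary[OF K s B] by (simp add: emeasure_eq_measure ennreal_mult)
qed

lemma cylinder_sets:
  assumes "finite K" "K \<subseteq> {0..}" "\<And>k. k \<in> K \<Longrightarrow> B k \<in> sets borel" "f \<in> N \<rightarrow>\<^sub>M path_space"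
  shows "{w \<in> space N. \<forall>k\<in>K. f w k \<in> B k} \<in> sets N"
proof (rule sets.sets_Collect_finite_All[OF _ assms(1)])
  fix k assume k: "k \<in> K"
  have "(\<lambda>w. f w k) \<in> borel_measurable N"
    using k assms(2) by (intro measurable_compose[OF assms(4) path_eval_measurable]) auto
  from measurable_sets_Collect[OF this, of "\<lambda>x. x \<in> B k"] assms(3)[OF k]
  show "{w \<in> space N. f w k \<in> B k} \<in> sets N" by simp
qed

lemma path_incr_measurable1: "path_incr s \<in> path_space \<rightarrow>\<^sub>M path_space"
  by measurable

abbreviation past :: "real \<Rightarrow> (real \<Rightarrow> real) measure" where
  "past s \<equiv> (\<Pi>\<^sub>M t\<in>{0..s}. borel)"

lemma markov_cylinders:
  assumes J: "finite J" "J \<subseteq> {0..s}" and K: "finite K" "K \<subseteq> {0..}" and s: "s \<ge> 0"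
    and A: "\<And>j. j \<in> J \<Longrightarrow> A j \<in> sets borel" and B: "\<And>k. k \<in> K \<Longrightarrow> B k \<in> sets borel"
  shows "emeasure (P x) {w \<in> space path_space. (\<forall>j\<in>J. w j \<in> A j) \<and> (\<forall>k\<in>K. path_incr s w k \<in> B k)} =
    emeasure (P x) {w \<in> space path_space. \<forall>j\<in>J. w j \<in> A j} *
    emeasure (P 0) {w \<in> space path_space. \<forall>k\<in>K. w k \<in> B k}"
proof -
  have J0: "J \<subseteq> {0..}" using J by auto
  have m1: "{w \<in> space path_space. \<forall>j\<in>J. w j \<in> A j} \<in> sets path_space"
    by (rule cylinder_sets[OF J(1) J0 A measurable_ident_sets[OF refl]])
  have m2: "{w \<in> space path_space. \<forall>k\<in>K. w k \<in> B k} \<in> sets path_space"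
    by (rule cylinder_sets[OF K B measurable_ident_sets[OF refl]])
  have m3: "{w \<in> space path_space. (\<forall>j\<in>J. w j \<in> A j) \<and> (\<forall>k\<in>K. path_incr s w k \<in> B k)} \<in> sets path_space"
    by (rule sets.sets_Collect_conj[OF cylinder_sets[OF K B path_incr_measurable1] m1])
  have **: "path_incr s (\<lambda>t\<in>{0..}. x + X t \<omega>) k = X (s + k) \<omega> - X s \<omega>" if "k \<in> K" for k \<omega>
    using that s K by (auto simp: path_incr_def)
  have e1: "emeasure (P x) {w \<in> space path_space. (\<forall>j\<in>J. w j \<in> A j) \<and> (\<forall>k\<in>K. path_incr s w k \<in> B k)} =
     emeasure M {\<omega> \<in> space M. (\<forall>j\<in>J. x + X j \<omega> \<in> A j) \<and> (\<forall>k\<in>K. X (s + k) \<omega> - X s \<omega> \<in> B k)}"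
    using J0 K(2) by (subst emeasure_P[OF m3]) (auto intro!: arg_cong[where f="emeasure M"] simp: ** subset_eq)
  have e2: "emeasure (P x) {w \<in> space path_space. \<forall>j\<in>J. w j \<in> A j} =
     emeasure M {\<omega> \<in> space M. \<forall>j\<in>J. x + X j \<omega> \<in> A j}"
    using J0 by (subst emeasure_P[OF m1]) (auto intro!: arg_cong[where f="emeasure M"] simp: subset_eq)
  have e3: "emeasure (P 0) {w \<in> space path_space. \<forall>k\<in>K. w k \<in> B k} =
     emeasure M {\<omega> \<in> space M. \<forall>k\<in>K. X k \<omega> \<in> B k}"
    using K(2) by (subst emeasure_P[OF m2]) (auto intro!: arg_cong[where f="emeasure M"] simp: subset_eq)
  show ?thesis
    unfolding e1 e2 e3 by (rule increments_indep[OF J K s A B])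
qed

text \<open>The product formula for cylinders is extended one factor at a time, since either side is
  a measure in each factor: to all past events for a fixed future cylinder, then to all future
  events for a fixed past event.\<close>

theorem markov:
  assumes s: "s \<ge> 0"
  shows "distr (P x) (past s \<Otimes>\<^sub>M path_space) (\<lambda>w. (restrict w {0..s}, path_incr s w)) =
    distr (P x) (past s) (\<lambda>w. restrict w {0..s}) \<Otimes>\<^sub>M P 0"
proof -
  have rm [measurable]: "(\<lambda>w. restrict w {0..s}) \<in> path_space \<rightarrow>\<^sub>M past s"
    by (rule path_restrict_measurable[OF s])
  let ?r = "\<lambda>w. restrict w {0..s}"
  define RE where "RE E = ?r -` E \<inter> space path_space" for E
  have RE [measurable]: "RE E \<in> sets path_space" if "E \<in> sets (past s)" for E
    unfolding RE_def using that by (rule measurable_sets[OF rm])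
  define DC where "DC C = path_incr s -` C \<inter> space path_space" for C
  have DC [measurable]: "DC C \<in> sets path_space" if "C \<in> sets path_space" for C
    unfolding DC_def using that by (rule measurable_sets[OF path_incr_measurable1])
  define cyl where "cyl K B = {w \<in> space path_space. \<forall>k\<in>K. w k \<in> B k}" for K :: "real set" and B :: "real \<Rightarrow> real set"
  have cyl: "cyl K B \<in> sets path_space" if "finite K" "K \<subseteq> {0..}" "\<And>k. k \<in> K \<Longrightarrow> B k \<in> sets borel" for K B
    unfolding cyl_def by (rule cylinder_sets[OF that measurable_ident_sets[OF refl]])
  have step1: "emeasure (P x) (RE E \<inter> DC (cyl K B)) = emeasure (P x) (RE E) * emeasure (P 0) (cyl K B)"
    if K: "finite K" "K \<subseteq> {0..}" and B: "\<And>k. k \<in> K \<Longrightarrow> B k \<in> sets borel" and E: "E \<in> sets (past s)" for K B E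
  proof -
    note c = cyl[OF K B]
    let ?M = "distr (density (P x) (indicator (DC (cyl K B)))) (past s) ?r"
    let ?N = "density (distr (P x) (past s) ?r) (\<lambda>_. emeasure (P 0) (cyl K B))"
    have M: "emeasure ?M F = emeasure (P x) (RE F \<inter> DC (cyl K B))" if "F \<in> sets (past s)" for F
    proof -
      have "emeasure ?M F = emeasure (density (P x) (indicator (DC (cyl K B)))) (RE F)"
        using that by (subst emeasure_distr) (auto simp: RE_def)
      also have "\<dots> = emeasure (P x) (DC (cyl K B) \<inter> RE F)"
        using that c by (intro emeasure_restricted) (auto intro: RE DC)
      finally show ?thesis by (simp add: Int_commute)
    qed
    have N: "emeasure ?N F = emeasure (P 0) (cyl K B) * emeasure (P x) (RE F)" if "F \<in> sets (past s)" for F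
      using that by (simp add: emeasure_density_const emeasure_distr RE_def)
    have "?M = ?N"
    proof (rule measure_eqI_PiM_infinite)
      fix A :: "real \<Rightarrow> real set" and J :: "real set"
      assume J: "finite J" "J \<subseteq> {0..s}" and A: "\<And>i. i \<in> J \<Longrightarrow> A i \<in> sets borel"
      let ?F = "prod_emb {0..s} (\<lambda>_. borel) J (Pi\<^sub>E J A)"
      have F: "?F \<in> sets (past s)" using J A by (intro sets_PiM_I) auto
      have RF: "RE ?F = {w \<in> space path_space. \<forall>j\<in>J. w j \<in> A j}"
      proof -
        have "{0..s} \<inter> J = J" using J(2) by auto
        then show ?thesis
          by (auto simp: RE_def prod_emb_def restrict_PiE_iff simp del: restrict_apply)
      qed
      have "RE ?F \<inter> DC (cyl K B) = {w \<in> space path_space. (\<forall>j\<in>J. w j \<in> A j) \<and> (\<forall>k\<in>K. path_incr s w k \<in> B k)}"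
        using measurable_space[OF path_incr_measurable1] by (auto simp: RF DC_def cyl_def)
      then show "emeasure ?M ?F = emeasure ?N ?F"
        unfolding M[OF F] N[OF F] RF
        using markov_cylinders[where x=x, OF J K s A B] by (simp add: cyl_def mult.commute)
    qed (auto intro!: finite_measure.finite_measure_distr P.finite_measure_restricted DC c)
    then have "emeasure ?M E = emeasure ?N E" by (rule arg_cong)
    then show ?thesis using M[OF E] N[OF E] by (simp add: mult.commute)
  qed
  have step2: "emeasure (P x) (RE E \<inter> DC C) = emeasure (P x) (RE E) * emeasure (P 0) C"
    if E: "E \<in> sets (past s)" and C: "C \<in> sets path_space" for E C
  proof -
    let ?M = "distr (density (P x) (indicator (RE E))) path_space (path_incr s)"
    let ?N = "density (P 0) (\<lambda>_. emeasure (P x) (RE E))"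
    have M: "emeasure ?M F = emeasure (P x) (RE E \<inter> DC F)" if "F \<in> sets path_space" for F
    proof -
      have "emeasure ?M F = emeasure (density (P x) (indicator (RE E))) (DC F)"
        using that by (subst emeasure_distr) (auto simp: DC_def)
      also have "\<dots> = emeasure (P x) (RE E \<inter> DC F)"
        using that E by (intro emeasure_restricted) (auto intro: RE DC)
      finally show ?thesis .
    qed
    have N: "emeasure ?N F = emeasure (P x) (RE E) * emeasure (P 0) F" if "F \<in> sets path_space" for F
      using that by (simp add: emeasure_density_const)
    have "?M = ?N"
    proof (rule path_measure_eqI)
      fix K :: "real set" and B :: "real \<Rightarrow> real set" assume KB: "finite K" "K \<subseteq> {0..}" "\<And>k. k \<in> K \<Longrightarrow> B k \<in> sets borel"
      show "emeasure ?M {w \<in> space path_space. \<forall>t\<in>K. w t \<in> B t} = emeasure ?N {w \<in> space path_space. \<forall>t\<in>K. w t \<in> B t}"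
        using M[OF cyl[OF KB]] N[OF cyl[OF KB]] step1[OF KB E] by (simp add: cyl_def)
    qed (auto intro!: finite_measure.finite_measure_distr P.finite_measure_restricted RE E)
    then have "emeasure ?M C = emeasure ?N C" by (rule arg_cong)
    then show ?thesis using M[OF C] N[OF C] by simp
  qed
  interpret R: prob_space "distr (P x) (past s) ?r"
    by (rule P.prob_space_distr) measurable
  show ?thesis
  proof (rule pair_measure_eqI[symmetric])
    fix A B assume A: "A \<in> sets (distr (P x) (past s) ?r)" and B: "B \<in> sets (P 0)"
    have "(\<lambda>w. (?r w, path_incr s w)) -` (A \<times> B) \<inter> space path_space = RE A \<inter> DC B"
      by (auto simp: RE_def DC_def)
    moreover have "(\<lambda>w. (?r w, path_incr s w)) \<in> P x \<rightarrow>\<^sub>M past s \<Otimes>\<^sub>M path_space"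
      by measurable
    moreover have "A \<times> B \<in> sets (past s \<Otimes>\<^sub>M path_space)" using A B by auto
    ultimately show "emeasure (distr (P x) (past s) ?r) A * emeasure (P 0) B =
        emeasure (distr (P x) (past s \<Otimes>\<^sub>M path_space) (\<lambda>w. (?r w, path_incr s w))) (A \<times> B)"
      using A B step2[of A B] by (simp add: emeasure_distr RE_def)
  qed (auto intro: R.sigma_finite_measure_axioms P.sigma_finite_measure_axioms simp: cong: sets_pair_measure_cong)
qed

end

section \<open>The strong Markov property at the first increase of an additive functional\<close>

text \<open>Open sets generate the Borel sets and are stable under intersection, and the indicator
  of an open set is an increasing limit of continuous functions built from the distance to its
  complement.\<close>

lemma measure_eqI_continuous:
  fixes \<mu> \<nu> :: "real measure"
  assumes [simp]: "sets \<mu> = sets borel" "sets \<nu> = sets borel" and fin: "finite_measure \<mu>"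
    and eq: "\<And>g :: real \<Rightarrow> real. continuous_on UNIV g \<Longrightarrow> (\<And>x. 0 \<le> g x \<and> g x \<le> 1) \<Longrightarrow>
      (\<integral>\<^sup>+x. ennreal (g x) \<partial>\<mu>) = (\<integral>\<^sup>+x. ennreal (g x) \<partial>\<nu>)"
  shows "\<mu> = \<nu>"
proof (rule measure_eqI_generator_eq[where E = "{S. open S}" and \<Omega> = UNIV and A = "\<lambda>_. UNIV"])
  have [measurable_cong]: "sets \<mu> = sets borel" "sets \<nu> = sets borel" by simp_all
  show "Int_stable {S :: real set. open S}" by (auto simp: Int_stable_def)
  show "sets \<mu> = sigma_sets UNIV {S. open S}" "sets \<nu> = sigma_sets UNIV {S. open S}"
    by (simp_all add: borel_def)
  show "emeasure \<mu> UNIV \<noteq> \<infinity>"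
    using finite_measure.emeasure_finite[OF fin] by simp
  fix U :: "real set" assume "U \<in> {S. open S}"
  then have U: "open U" by simp
  show "emeasure \<mu> U = emeasure \<nu> U"
  \<comment> \<open>The whole space is treated apart: its complement is empty, and
    \<open>infdist\<close> to the empty set is 0 by convention, so the approximating functions would
    vanish.\<close>
  proof (cases "U = UNIV")
    case True
    have "(\<integral>\<^sup>+x. ennreal 1 \<partial>\<mu>) = (\<integral>\<^sup>+x. ennreal 1 \<partial>\<nu>)"
      by (rule eq) auto
    then show ?thesis using sets_eq_imp_space_eq[of \<mu> borel] sets_eq_imp_space_eq[of \<nu> borel] by (simp add: True)
  next
    case False
    define g where "g m x = min 1 (real m * infdist x (- U))" for m x
    have gm: "continuous_on UNIV (g m)" for m
      unfolding g_def by (intro continuous_intros)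
    then have [measurable]: "g m \<in> borel_measurable borel" for m
      by (rule borel_measurable_continuous_onI)
    have inc: "incseq (\<lambda>m x. ennreal (g m x))"
      unfolding g_def
      by (intro incseq_SucI le_funI ennreal_leI min.mono order.refl mult_right_mono infdist_nonneg) simp
    have lim: "(\<lambda>m. ennreal (g m x)) \<longlonglongrightarrow> indicator U x" for x
    proof (cases "x \<in> U")
      case True
      then have pos: "infdist x (- U) > 0"
        using U False in_closed_iff_infdist_zero[of "- U" x] infdist_nonneg[of x "- U"] by (force simp: closed_def)
      obtain N :: nat where N: "real N * infdist x (- U) > 1"
        using reals_Archimedean3[OF pos] by blast
      have "\<forall>\<^sub>F m in sequentially. ennreal (g m x) = 1"
        using eventually_ge_at_top[of N]
      proof eventually_elim
        case (elim m)
        then have "real N * infdist x (- U) \<le> real m * infdist x (- U)"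
          using pos by (intro mult_right_mono) auto
        with N show ?case by (simp add: g_def)
      qed
      then show ?thesis using True by (simp add: tendsto_eventually)
    next
      case False
      then have "infdist x (- U) = 0" by simp
      then show ?thesis using False by (simp add: g_def)
    qed
    have sup: "(SUP m. ennreal (g m x)) = indicator U x" for x
      using LIMSEQ_unique[OF LIMSEQ_SUP lim[of x]] inc by (auto simp: incseq_def le_fun_def)
    have *: "emeasure M U = (SUP m. \<integral>\<^sup>+x. ennreal (g m x) \<partial>M)" if [measurable_cong]: "sets M = sets borel" for M :: "real measure"
    proof -
      have "emeasure M U = (\<integral>\<^sup>+x. indicator U x \<partial>M)"
        using U that by simp
      also have "\<dots> = (\<integral>\<^sup>+x. (SUP m. ennreal (g m x)) \<partial>M)"
        by (simp add: sup)
      also have "\<dots> = (SUP m. \<integral>\<^sup>+x. ennreal (g m x) \<partial>M)"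
        by (rule nn_integral_monotone_convergence_SUP[OF inc]) measurable
      finally show ?thesis .
    qed
    have "(\<integral>\<^sup>+x. ennreal (g m x) \<partial>\<mu>) = (\<integral>\<^sup>+x. ennreal (g m x) \<partial>\<nu>)" for m
      by (rule eq[OF gm]) (auto simp: g_def infdist_nonneg)
    then show ?thesis by (simp add: *)
  qed
qed auto

lemma finite_measure_density_le_1:
  assumes "finite_measure M" "f \<in> borel_measurable M" "\<And>x. f x \<le> 1"
  shows "finite_measure (density M f)"
proof
  have "(\<integral>\<^sup>+w. f w \<partial>M) \<le> (\<integral>\<^sup>+w. 1 \<partial>M)"
    by (intro nn_integral_mono assms)
  then show "emeasure (density M f) (space (density M f)) \<noteq> \<infinity>"
    using finite_measure.emeasure_finite[OF assms(1), of "space M"] assms(2)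
    by (auto simp: emeasure_density top_unique cong: nn_integral_cong)
qed

text \<open>Passing to the limit along dyadic times needs continuous test functions; this lemma returns to
  product events.\<close>

lemma emeasure_continuous_to_borel:
  fixes B :: "'i \<Rightarrow> real set"
  assumes "finite I" "finite_measure M1" "finite_measure M2"
    and "\<And>i. i \<in> I \<Longrightarrow> Y i \<in> borel_measurable M1" "\<And>i. i \<in> I \<Longrightarrow> Z i \<in> borel_measurable M2"
    and "\<And>f :: 'i \<Rightarrow> real \<Rightarrow> real. (\<And>i. i \<in> I \<Longrightarrow> continuous_on UNIV (f i)) \<Longrightarrow> (\<And>i x. i \<in> I \<Longrightarrow> 0 \<le> f i x \<and> f i x \<le> 1) \<Longrightarrow>
      (\<integral>\<^sup>+w. ennreal (\<Prod>i\<in>I. f i (Y i w)) \<partial>M1) = (\<integral>\<^sup>+w. ennreal (\<Prod>i\<in>I. f i (Z i w)) \<partial>M2)"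
    and "\<And>i. i \<in> I \<Longrightarrow> B i \<in> sets borel"
  shows "emeasure M1 {w \<in> space M1. \<forall>i\<in>I. Y i w \<in> B i} = emeasure M2 {w \<in> space M2. \<forall>i\<in>I. Z i w \<in> B i}"
  using assms
proof (induction I arbitrary: M1 M2 rule: finite_induct)
  case empty
  have "(\<integral>\<^sup>+w. ennreal 1 \<partial>M1) = (\<integral>\<^sup>+w. ennreal 1 \<partial>M2)"
    using empty(5)[of "\<lambda>_ _. 0"] by simp
  then show ?case by simp
next
  case (insert j I)
  have [measurable]: "Y j \<in> borel_measurable M1" "Z j \<in> borel_measurable M2"
    using insert.prems by auto
  define S1 where "S1 = {w \<in> space M1. \<forall>i\<in>I. Y i w \<in> B i}"
  define S2 where "S2 = {w \<in> space M2. \<forall>i\<in>I. Z i w \<in> B i}"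
  have [measurable]: "S1 \<in> sets M1"
    unfolding S1_def
  proof (rule sets.sets_Collect_finite_All[OF _ insert.hyps(1)])
    fix i assume i: "i \<in> I"
    then have "Y i \<in> borel_measurable M1" using insert.prems by auto
    from measurable_sets_Collect[OF this, of "\<lambda>x. x \<in> B i"] insert.prems(6)[of i] i
    show "{w \<in> space M1. Y i w \<in> B i} \<in> sets M1" by simp
  qed
  have [measurable]: "S2 \<in> sets M2"
    unfolding S2_def
  proof (rule sets.sets_Collect_finite_All[OF _ insert.hyps(1)])
    fix i assume i: "i \<in> I"
    then have "Z i \<in> borel_measurable M2" using insert.prems by auto
    from measurable_sets_Collect[OF this, of "\<lambda>x. x \<in> B i"] insert.prems(6)[of i] i
    show "{w \<in> space M2. Z i w \<in> B i} \<in> sets M2" by simp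
  qed
  \<comment> \<open>The induction hypothesis holds for arbitrary finite measures, so a test function
    of the new coordinate is absorbed as a density before the remaining coordinates are
    treated.\<close>
  have eq1: "emeasure (density M1 (\<lambda>w. ennreal (g (Y j w)))) S1 = emeasure (density M2 (\<lambda>w. ennreal (g (Z j w)))) S2"
    if g: "continuous_on UNIV g" "\<And>x. 0 \<le> g x \<and> g x \<le> 1" for g
  proof -
    have [measurable]: "g \<in> borel_measurable borel"
      using g(1) by (rule borel_measurable_continuous_onI)
    have "emeasure (density M1 (\<lambda>w. ennreal (g (Y j w)))) {w \<in> space (density M1 (\<lambda>w. ennreal (g (Y j w)))). \<forall>i\<in>I. Y i w \<in> B i} =
      emeasure (density M2 (\<lambda>w. ennreal (g (Z j w)))) {w \<in> space (density M2 (\<lambda>w. ennreal (g (Z j w)))). \<forall>i\<in>I. Z i w \<in> B i}"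
    proof (rule insert.IH)
      show "finite_measure (density M1 (\<lambda>w. ennreal (g (Y j w))))"
        by (rule finite_measure_density_le_1[OF insert.prems(1)]) (use g in auto)
      show "finite_measure (density M2 (\<lambda>w. ennreal (g (Z j w))))"
        by (rule finite_measure_density_le_1[OF insert.prems(2)]) (use g in auto)
      fix f :: "'i \<Rightarrow> real \<Rightarrow> real"
      assume f: "\<And>i. i \<in> I \<Longrightarrow> continuous_on UNIV (f i)" "\<And>i x. i \<in> I \<Longrightarrow> 0 \<le> f i x \<and> f i x \<le> 1"
      define h where "h = f(j := g)"
      have hf: "i \<in> I \<Longrightarrow> h i = f i" for i using insert.hyps by (auto simp: h_def)
      have hj: "h j = g" by (simp add: h_def)
      have f_meas: "i \<in> I \<Longrightarrow> f i \<in> borel_measurable borel" for i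
        using f(1) by (rule borel_measurable_continuous_onI)
      have [measurable]: "(\<lambda>w. \<Prod>i\<in>I. f i (Y i w)) \<in> borel_measurable M1"
        by (intro borel_measurable_prod measurable_compose[OF _ f_meas] insert.prems) auto
      have [measurable]: "(\<lambda>w. \<Prod>i\<in>I. f i (Z i w)) \<in> borel_measurable M2"
        by (intro borel_measurable_prod measurable_compose[OF _ f_meas] insert.prems) auto
      have "(\<integral>\<^sup>+w. ennreal (\<Prod>i\<in>insert j I. h i (Y i w)) \<partial>M1) = (\<integral>\<^sup>+w. ennreal (\<Prod>i\<in>insert j I. h i (Z i w)) \<partial>M2)"
        by (rule insert.prems(5)) (use f g in \<open>auto simp: h_def\<close>)
      then have "(\<integral>\<^sup>+w. ennreal (g (Y j w)) * ennreal (\<Prod>i\<in>I. f i (Y i w)) \<partial>M1) =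
          (\<integral>\<^sup>+w. ennreal (g (Z j w)) * ennreal (\<Prod>i\<in>I. f i (Z i w)) \<partial>M2)"
        using insert.hyps g f by (simp add: hf hj ennreal_mult prod_nonneg)
      then show "(\<integral>\<^sup>+w. ennreal (\<Prod>i\<in>I. f i (Y i w)) \<partial>density M1 (\<lambda>w. ennreal (g (Y j w)))) =
          (\<integral>\<^sup>+w. ennreal (\<Prod>i\<in>I. f i (Z i w)) \<partial>density M2 (\<lambda>w. ennreal (g (Z j w))))"
        by (simp add: nn_integral_density)
    qed (use insert.prems in auto)
    then show ?thesis by (simp add: S1_def S2_def)
  qed
  \<comment> \<open>With the other coordinates already confined to their sets, only the law of
    coordinate \<open>j\<close> is left, and continuous functions determine it.\<close>
  have "distr (density M1 (indicator S1)) borel (Y j) = distr (density M2 (indicator S2)) borel (Z j)"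
  proof (rule measure_eqI_continuous)
    show "finite_measure (distr (density M1 (indicator S1)) borel (Y j))"
      by (intro finite_measure.finite_measure_distr finite_measure.finite_measure_restricted insert.prems) auto
    fix g :: "real \<Rightarrow> real" assume g: "continuous_on UNIV g" "\<And>x. 0 \<le> g x \<and> g x \<le> 1"
    have [measurable]: "g \<in> borel_measurable borel"
      using g(1) by (rule borel_measurable_continuous_onI)
    show "(\<integral>\<^sup>+x. ennreal (g x) \<partial>distr (density M1 (indicator S1)) borel (Y j)) = (\<integral>\<^sup>+x. ennreal (g x) \<partial>distr (density M2 (indicator S2)) borel (Z j))"
      using eq1[OF g] by (simp add: nn_integral_distr nn_integral_density emeasure_density mult.commute)
  qed simp_all
  then have "emeasure (distr (density M1 (indicator S1)) borel (Y j)) (B j) = emeasure (distr (density M2 (indicator S2)) borel (Z j)) (B j)"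
    by simp
  moreover have "emeasure (distr (density M1 (indicator S1)) borel (Y j)) (B j) = emeasure M1 (S1 \<inter> (Y j -` B j \<inter> space M1))"
    using insert.prems(6)[of j] by (simp add: emeasure_distr emeasure_restricted)
  moreover have "emeasure (distr (density M2 (indicator S2)) borel (Z j)) (B j) = emeasure M2 (S2 \<inter> (Z j -` B j \<inter> space M2))"
    using insert.prems(6)[of j] by (simp add: emeasure_distr emeasure_restricted)
  moreover have "S1 \<inter> (Y j -` B j \<inter> space M1) = {w \<in> space M1. \<forall>i\<in>insert j I. Y i w \<in> B i}"
    "S2 \<inter> (Z j -` B j \<inter> space M2) = {w \<in> space M2. \<forall>i\<in>insert j I. Z i w \<in> B i}"
    by (auto simp: S1_def S2_def)
  ultimately show ?case by simp
qed

context levy begin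

lemma nn_integral_markov:
  assumes s: "s \<ge> 0" and [measurable]: "G \<in> borel_measurable (past s)" "\<Phi> \<in> borel_measurable path_space"
  shows "(\<integral>\<^sup>+w. G (restrict w {0..s}) * \<Phi> (path_incr s w) \<partial>P x) =
    (\<integral>\<^sup>+w. G (restrict w {0..s}) \<partial>P x) * (\<integral>\<^sup>+w. \<Phi> w \<partial>P 0)"
proof -
  have rm [measurable]: "(\<lambda>w. restrict w {0..s}) \<in> path_space \<rightarrow>\<^sub>M past s"
    by (rule path_restrict_measurable[OF s])
  let ?H = "\<lambda>(r, w'). G r * \<Phi> w'"
  have "(\<integral>\<^sup>+w. G (restrict w {0..s}) * \<Phi> (path_incr s w) \<partial>P x) =
      (\<integral>\<^sup>+z. ?H z \<partial>distr (P x) (past s \<Otimes>\<^sub>M path_space) (\<lambda>w. (restrict w {0..s}, path_incr s w)))"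
    by (subst nn_integral_distr) auto
  also have "\<dots> = (\<integral>\<^sup>+z. ?H z \<partial>(distr (P x) (past s) (\<lambda>w. restrict w {0..s}) \<Otimes>\<^sub>M P 0))"
    by (simp only: markov[OF s])
  also have "\<dots> = (\<integral>\<^sup>+r. \<integral>\<^sup>+w'. G r * \<Phi> w' \<partial>P 0 \<partial>distr (P x) (past s) (\<lambda>w. restrict w {0..s}))"
    by (subst P.nn_integral_fst[symmetric]) auto
  also have "\<dots> = (\<integral>\<^sup>+w. G (restrict w {0..s}) \<partial>P x) * (\<integral>\<^sup>+w. \<Phi> w \<partial>P 0)"
    by (simp add: nn_integral_cmult nn_integral_multc nn_integral_distr)
  finally show ?thesis .
qed

text \<open>Adaptedness of a continuous additive functional only holds up to null sets, whence the
  almost sure equality with a cylinder event.\<close>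

definition adapted_event :: "real \<Rightarrow> real \<Rightarrow> ((real \<Rightarrow> real) \<Rightarrow> bool) \<Rightarrow> bool" where
  "adapted_event x s Q \<longleftrightarrow> (\<exists>E\<in>sets (past s). AE w in P x. Q w \<longleftrightarrow> restrict w {0..s} \<in> E)"

lemma adapted_event_mono:
  assumes "adapted_event x s Q" "s \<le> s'"
  shows "adapted_event x s' Q"
proof -
  obtain E where E: "E \<in> sets (past s)" "AE w in P x. Q w \<longleftrightarrow> restrict w {0..s} \<in> E"
    using assms(1) by (auto simp: adapted_event_def)
  have rm: "(\<lambda>r. restrict r {0..s}) \<in> past s' \<rightarrow>\<^sub>M past s"
    using assms(2) by (intro measurable_restrict_subset) auto
  let ?E = "(\<lambda>r. restrict r {0..s}) -` E \<inter> space (past s')"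
  have "?E \<in> sets (past s')" by (rule measurable_sets[OF rm E(1)])
  moreover have "restrict w {0..s'} \<in> ?E \<longleftrightarrow> restrict w {0..s} \<in> E" for w
  proof -
    have "{0..s'} \<inter> {0..s} = {0..s}" using assms(2) by auto
    then show ?thesis by (simp add: space_PiM del: Int_atLeastAtMost)
  qed
  ultimately show ?thesis
    using E(2) unfolding adapted_event_def by (intro bexI[of _ ?E]) auto
qed

lemma adapted_event_not:
  assumes "adapted_event x s Q"
  shows "adapted_event x s (\<lambda>w. \<not> Q w)"
proof -
  obtain E where E: "E \<in> sets (past s)" "AE w in P x. Q w \<longleftrightarrow> restrict w {0..s} \<in> E"
    using assms(1) by (auto simp: adapted_event_def)
  then show ?thesis
    unfolding adapted_event_def
    by (intro bexI[OF _ sets.compl_sets[OF E(1)]]) (auto simp: space_PiM)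
qed

lemma adapted_event_conj:
  assumes "adapted_event x s Q" "adapted_event x s Q'"
  shows "adapted_event x s (\<lambda>w. Q w \<and> Q' w)"
proof -
  obtain E E' where "E \<in> sets (past s)" "AE w in P x. Q w \<longleftrightarrow> restrict w {0..s} \<in> E"
      "E' \<in> sets (past s)" "AE w in P x. Q' w \<longleftrightarrow> restrict w {0..s} \<in> E'"
    using assms by (auto simp: adapted_event_def)
  then show ?thesis
    unfolding adapted_event_def by (intro bexI[of _ "E \<inter> E'"]) auto
qed

lemma adapted_event_all_less:
  assumes "\<And>j :: nat. j < k \<Longrightarrow> adapted_event x s (Q j)"
  shows "adapted_event x s (\<lambda>w. \<forall>j<k. Q j w)"
  using assms
proof (induction k)
  case 0
  show ?case unfolding adapted_event_def by (intro bexI[OF _ sets.top]) (auto simp: space_PiM)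
next
  case (Suc k)
  have "adapted_event x s (\<lambda>w. (\<forall>j<k. Q j w) \<and> Q k w)"
    by (intro adapted_event_conj Suc) auto
  moreover have "(\<lambda>w. (\<forall>j<k. Q j w) \<and> Q k w) = (\<lambda>w. \<forall>j<Suc k. Q j w)"
    by (auto simp: less_Suc_eq)
  ultimately show ?case by simp
qed

lemma adapted_event_filtration:
  assumes g: "g \<in> borel_measurable (path_filtration s)" and "AE w in P x. F w = g w"
  shows "adapted_event x s (\<lambda>w. F w > (0::real))"
proof -
  have "{w \<in> space (path_filtration s). g w > 0} \<in> sets (path_filtration s)"
    using g by measurable
  moreover have "sets (path_filtration s) = {(\<lambda>w. restrict w {0..s}) -` E \<inter> space path_space |E. E \<in> sets (past s)}"
    unfolding path_filtration_def by (rule sets_vimage_algebra2) (auto simp: space_PiM)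
  ultimately obtain E where E: "E \<in> sets (past s)"
      "{w \<in> space path_space. g w > 0} = (\<lambda>w. restrict w {0..s}) -` E \<inter> space path_space"
    by (auto simp: path_filtration_def)
  then have *: "w \<in> space path_space \<Longrightarrow> g w > 0 \<longleftrightarrow> restrict w {0..s} \<in> E" for w
    by blast
  have "AE w in P x. F w > 0 \<longleftrightarrow> restrict w {0..s} \<in> E"
    by (rule AE_mp[OF assms(2)], rule AE_I2) (simp add: *)
  with E(1) show ?thesis unfolding adapted_event_def by blast
qed

end

text \<open>Isolates what the strong Markov property at the first increase needs: positivity of
  \<open>A\<close> at a fixed time is a past event up to null sets, and almost every path of
  \<open>A\<close> starts at 0 and is increasing and continuous. The rate \<open>\<alpha>\<close>
  discounts the hitting time.\<close>

locale hitting = levy M X for M :: "'a measure" and X +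
  fixes A :: "real \<Rightarrow> (real \<Rightarrow> real) \<Rightarrow> real" and \<alpha> :: real
  assumes A_joint [measurable]: "(\<lambda>(t, w). A t w) \<in> borel_measurable (borel \<Otimes>\<^sub>M path_space)"
    and A_adapted: "t \<ge> 0 \<Longrightarrow> adapted_event x t (\<lambda>w. A t w > 0)"
    and A_path: "AE w in P x. A 0 w = 0 \<and> mono_on {0..} (\<lambda>t. A t w) \<and> continuous_on {0..} (\<lambda>t. A t w)"
    and alpha: "\<alpha> > 0"
begin

text \<open>\<open>S n\<close> is the first dyadic time of level \<open>n\<close> at which \<open>A\<close> is positive; it decreases to \<open>R\<close>
  when \<open>A\<close> ever becomes positive, and is meaningless otherwise.\<close>

definition "hit w \<longleftrightarrow> (\<exists>k::nat. A (real k) w > 0)"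
definition "K n w = (LEAST k. A (real k / 2 ^ n) w > 0)"
definition "S n w = real (K n w) / 2 ^ n"
text \<open>The clipping keeps \<open>R\<close> a legitimate time even on paths where
  \<open>A\<close> never increases and the value of \<open>lim\<close> is arbitrary.\<close>

definition "R w = max 0 (lim (\<lambda>n. S n w))"
text \<open>The discount at \<open>R\<close>, with the convention that it vanishes for an infinite
  hitting time.\<close>

definition "\<rho> w = (if hit w then exp (- \<alpha> * R w) else 0)"

lemma A_measurable: "(\<lambda>w. A t w) \<in> borel_measurable path_space"
  using measurable_compose[OF measurable_Pair1'[of t borel path_space] A_joint] by simp

lemma hit_measurable [measurable]: "Measurable.pred path_space hit"
  unfolding hit_def using A_measurable by measurable

lemma K_measurable [measurable]: "K n \<in> measurable path_space (count_space UNIV)"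
  unfolding K_def using A_measurable by measurable

lemma S_measurable [measurable]: "S n \<in> borel_measurable path_space"
  unfolding S_def by measurable

lemma R_measurable [measurable]: "R \<in> borel_measurable path_space"
  unfolding R_def by measurable

lemma \<rho>_measurable [measurable]: "\<rho> \<in> borel_measurable path_space"
  unfolding \<rho>_def by measurable

lemma R_nonneg: "R w \<ge> 0" by (simp add: R_def)
lemma S_nonneg: "S n w \<ge> 0" by (simp add: S_def)

lemma \<rho>_bounds: "0 \<le> \<rho> w" "\<rho> w \<le> 1"
  using alpha R_nonneg[of w] by (auto simp: \<rho>_def)

lemma path_at_R_measurable: "(\<lambda>w. w (R w)) \<in> borel_measurable path_space"
  using path_eval_compose[OF R_measurable measurable_ident_sets[OF refl]] by (simp add: R_nonneg max_absorb2)

lemma path_at_S_measurable: "(\<lambda>w. w (S n w)) \<in> borel_measurable path_space"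
  using path_eval_compose[OF S_measurable measurable_ident_sets[OF refl]] by (simp add: S_nonneg max_absorb2)

lemma no_hit:
  assumes "\<not> hit w" "A 0 w = 0" "mono_on {0..} (\<lambda>t. A t w)" "t \<ge> 0"
  shows "A t w = 0"
proof -
  have "A t w \<le> A (real (nat \<lceil>t\<rceil>)) w"
    using assms(4) by (intro mono_onD[OF assms(3)]) auto
  also have "\<dots> \<le> 0" using assms(1) by (auto simp: hit_def not_less)
  finally show ?thesis using mono_onD[OF assms(3), of 0 t] assms by auto
qed

text \<open>\<open>R\<close> is the infimum of the times with \<open>A > 0\<close>. By continuity
  \<open>A\<close> still vanishes there, so the infimum is not attained and every \<open>S n\<close>
  lies strictly to the right of \<open>R\<close>. This makes right continuity of the path usable
  along \<open>S n\<close>.\<close>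

lemma hit_path:
  assumes "hit w" and A0: "A 0 w = 0" and mono: "mono_on {0..} (\<lambda>t. A t w)" and cont: "continuous_on {0..} (\<lambda>t. A t w)"
  shows "\<And>n. A (real (K n w) / 2 ^ n) w > 0" "\<And>n. R w < S n w" "(\<lambda>n. S n w) \<longlonglongrightarrow> R w"
    "A (R w) w = 0" "\<And>t. t > 0 \<Longrightarrow> A (R w + t) w > 0"
proof -
  define D where "D = {t. 0 \<le> t \<and> A t w > 0}"
  define r where "r = Inf D"
  obtain j :: nat where j: "A (real j) w > 0" using assms(1) by (auto simp: hit_def)
  then have D: "D \<noteq> {}" "bdd_below D" by (auto simp: D_def intro!: bdd_belowI[of _ 0] exI[of _ "real j"])
  have r0: "r \<ge> 0" unfolding r_def using D(1) by (intro cInf_greatest) (auto simp: D_def)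
  have above: "A t w > 0" if t: "t > r" for t
  proof -
    obtain d where "d \<in> D" "d < t" using cInf_lessD[OF D(1), of t] t by (auto simp: r_def)
    then show ?thesis using mono_onD[OF mono, of d t] by (auto simp: D_def)
  qed
  have Ar: "A r w = 0"
  proof (rule ccontr)
    assume "A r w \<noteq> 0"
    moreover have "A r w \<ge> 0" using mono_onD[OF mono, of 0 r] A0 r0 by auto
    ultimately have pos: "A r w > 0" by simp
    then have "r > 0" using A0 r0 by (cases "r = 0") auto
    have "((\<lambda>t. A t w) \<longlongrightarrow> A r w) (at r within {0..})"
      using cont r0 by (auto simp: continuous_on_def)
    then have "\<forall>\<^sub>F t in at r within {0..}. A t w > 0" using pos by (rule order_tendstoD)
    then obtain d where d: "d > 0" "\<And>t. t \<ge> 0 \<Longrightarrow> t \<noteq> r \<Longrightarrow> dist t r < d \<Longrightarrow> A t w > 0"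
      by (auto simp: eventually_at)
    define t where "t = max 0 (r - d / 2)"
    have t: "t \<ge> 0" "t < r" "dist t r < d" using d(1) \<open>r > 0\<close> by (auto simp: t_def dist_real_def)
    then have "t \<in> D" using d(2)[of t] by (auto simp: D_def)
    then have "r \<le> t" unfolding r_def using D(2) by (rule cInf_lower)
    with t show False by simp
  qed
  have below: "A t w \<le> 0" if "0 \<le> t" "t \<le> r" for t
    using mono_onD[OF mono, of t r] that Ar by auto
  show K: "A (real (K n w) / 2 ^ n) w > 0" for n
    unfolding K_def by (rule LeastI[of _ "j * 2 ^ n"]) (use j in simp)
  have Sr: "r < S n w" for n
    using below[of "S n w"] K[of n] S_nonneg[of n w] by (force simp: S_def)
  \<comment> \<open>By minimality \<open>A\<close> is not positive at the grid point just before
    \<open>S n\<close>, which therefore lies at or before \<open>r\<close>; the grid spacing gives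
    the bound.\<close>
  have Sr': "S n w \<le> r + (1 / 2) ^ n" for n
  proof -
    have "S n w > 0" using Sr[of n] r0 by simp
    then have k: "K n w > 0" by (auto simp: S_def intro!: gr0I)
    then have "\<not> A (real (K n w - 1) / 2 ^ n) w > 0"
      unfolding K_def by (intro not_less_Least) auto
    then have "real (K n w - 1) / 2 ^ n \<le> r" using above by force
    then show ?thesis using k by (simp add: S_def of_nat_diff diff_divide_distrib power_one_over)
  qed
  have "(\<lambda>n. r + (1 / 2) ^ n) \<longlonglongrightarrow> r + 0"
    by (rule tendsto_add[OF tendsto_const LIMSEQ_power_zero]) simp
  then have up: "(\<lambda>n. r + (1 / 2) ^ n) \<longlonglongrightarrow> r" by simp
  have lim: "(\<lambda>n. S n w) \<longlonglongrightarrow> r"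
  proof (rule tendsto_sandwich[OF _ _ tendsto_const up])
    show "\<forall>\<^sub>F n in sequentially. r \<le> S n w" by (rule always_eventually) (simp add: less_imp_le[OF Sr])
    show "\<forall>\<^sub>F n in sequentially. S n w \<le> r + (1 / 2) ^ n" by (rule always_eventually) (simp only: Sr' simp_thms)
  qed
  have Rr: "R w = r" using limI[OF lim] r0 by (simp add: R_def)
  show "R w < S n w" for n using Sr Rr by simp
  show "(\<lambda>n. S n w) \<longlonglongrightarrow> R w" "A (R w) w = 0" using lim Ar by (simp_all add: Rr)
  show "A (R w + t) w > 0" if "t > 0" for t using above[of "r + t"] that by (simp add: Rr)
qed

text \<open>Splits according to the grid index of \<open>S n\<close>. Each piece is decided at one
  fixed time, where the simple Markov property is available.\<close>

lemma hit_sum: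
  fixes G :: "nat \<Rightarrow> ennreal"
  assumes "A 0 w = 0" "mono_on {0..} (\<lambda>t. A t w)" "continuous_on {0..} (\<lambda>t. A t w)"
  shows "(if hit w then G (K n w) else 0) =
    (\<Sum>k. G k * indicator {w. A (real k / 2 ^ n) w > 0 \<and> (\<forall>j<k. \<not> A (real j / 2 ^ n) w > 0)} w)"
proof (cases "hit w")
  case True
  have "(\<Sum>k. G k * indicator {w. A (real k / 2 ^ n) w > 0 \<and> (\<forall>j<k. \<not> A (real j / 2 ^ n) w > 0)} w) = G (K n w)"
  proof (rule suminf_cmult_indicator)
    show "disjoint_family (\<lambda>k. {w. A (real k / 2 ^ n) w > 0 \<and> (\<forall>j<k. \<not> A (real j / 2 ^ n) w > 0)})"
      by (auto simp: disjoint_family_on_def) (metis nat_neq_iff)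
    show "w \<in> {v. A (real (K n w) / 2 ^ n) v > 0 \<and> (\<forall>j<K n w. \<not> A (real j / 2 ^ n) v > 0)}"
      using hit_path(1)[OF True assms, of n] not_less_Least[where P = "\<lambda>k. A (real k / 2 ^ n) w > 0"]
      by (auto simp: K_def)
  qed
  with True show ?thesis by simp
next
  case False
  have "A (real k / 2 ^ n) w = 0" for k
    by (rule no_hit[OF False assms(1,2)]) simp
  with False show ?thesis by simp
qed

text \<open>\<open>S n\<close> takes countably many values, so the strong Markov property at
  \<open>S n\<close> is the sum over \<open>k\<close> of the simple Markov property at
  \<open>k / 2 ^ n\<close>.\<close>

lemma level_identity:
  assumes [measurable]: "f \<in> borel_measurable borel" "\<Phi> \<in> borel_measurable path_space"
  shows "(\<integral>\<^sup>+w. (if hit w then ennreal (exp (- \<alpha> * S n w)) * f (w (S n w)) * \<Phi> (path_incr (S n w) w) else 0) \<partial>P x) =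
    (\<integral>\<^sup>+w. (if hit w then ennreal (exp (- \<alpha> * S n w)) * f (w (S n w)) else 0) \<partial>P x) * (\<integral>\<^sup>+w. \<Phi> w \<partial>P 0)"
proof -
  define s where "s k = real k / 2 ^ n" for k
  have s0: "s k \<ge> 0" for k by (simp add: s_def)
  \<comment> \<open>That the first positive grid value occurs at index \<open>k\<close> involves
    only times up to \<open>s k\<close>; up to a null set the event is replaced by a set of the
    past.\<close>
  have "\<exists>E\<in>sets (past (s k)). AE w in P x. (A (s k) w > 0 \<and> (\<forall>j<k. \<not> A (s j) w > 0)) \<longleftrightarrow> restrict w {0..s k} \<in> E" for k
  proof -
    have "adapted_event x (s k) (\<lambda>w. A (s k) w > 0 \<and> (\<forall>j<k. \<not> A (s j) w > 0))"
      by (intro adapted_event_conj adapted_event_all_less adapted_event_not A_adapted s0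
        adapted_event_mono[OF A_adapted[OF s0]]) (simp add: s_def divide_right_mono)
    then show ?thesis by (simp add: adapted_event_def)
  qed
  then have "\<forall>k. \<exists>E. E \<in> sets (past (s k)) \<and> (AE w in P x. (A (s k) w > 0 \<and> (\<forall>j<k. \<not> A (s j) w > 0)) \<longleftrightarrow> restrict w {0..s k} \<in> E)"
    unfolding Bex_def ..
  from choice[OF this] obtain E where EE: "\<forall>k. E k \<in> sets (past (s k)) \<and>
      (AE w in P x. (A (s k) w > 0 \<and> (\<forall>j<k. \<not> A (s j) w > 0)) \<longleftrightarrow> restrict w {0..s k} \<in> E k)" ..
  have E: "E k \<in> sets (past (s k))" for k
    using spec[OF EE, of k] by (rule conjunct1)
  have AE_E: "AE w in P x. (A (s k) w > 0 \<and> (\<forall>j<k. \<not> A (s j) w > 0)) \<longleftrightarrow> restrict w {0..s k} \<in> E k" for k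
    using spec[OF EE, of k] by (rule conjunct2)
  define Ev where "Ev k = {w. A (s k) w > 0 \<and> (\<forall>j<k. \<not> A (s j) w > 0)}" for k
  have Am [measurable]: "A t \<in> borel_measurable path_space" for t
    using A_measurable[of t] by simp
  have Ev_m [measurable]: "(\<lambda>w. indicator (Ev k) w :: ennreal) \<in> borel_measurable path_space" for k
    unfolding Ev_def indicator_def by measurable
  have w_m [measurable]: "(\<lambda>w. w (s k)) \<in> borel_measurable path_space" for k
    by (rule path_eval_measurable[OF s0])
  have [measurable]: "path_incr (s k) \<in> path_space \<rightarrow>\<^sub>M path_space" for k
    by (rule path_incr_measurable1)
  define G where "G k r = ennreal (exp (- \<alpha> * s k)) * f (r (s k)) * indicator (E k) r" for k and r :: "real \<Rightarrow> real"
  have [measurable]: "(\<lambda>r. r (s k)) \<in> borel_measurable (past (s k))" for k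
    by (rule measurable_component_singleton) (simp add: s0)
  have Gm: "G k \<in> borel_measurable (past (s k))" for k
    unfolding G_def using E[of k] by measurable
  \<comment> \<open>Stated for every \<open>\<Psi>\<close>: the constant 1 identifies the common sum
    over \<open>k\<close>, and \<open>\<Phi>\<close> then gives the factorization.\<close>
  have main: "(\<integral>\<^sup>+w. (if hit w then ennreal (exp (- \<alpha> * S n w)) * f (w (S n w)) * \<Psi> (path_incr (S n w) w) else 0) \<partial>P x) =
      (\<Sum>k. \<integral>\<^sup>+w. G k (restrict w {0..s k}) \<partial>P x) * (\<integral>\<^sup>+w. \<Psi> w \<partial>P 0)"
    if [measurable]: "\<Psi> \<in> borel_measurable path_space" for \<Psi>
  proof -
    have "(\<integral>\<^sup>+w. (if hit w then ennreal (exp (- \<alpha> * S n w)) * f (w (S n w)) * \<Psi> (path_incr (S n w) w) else 0) \<partial>P x) =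
       (\<integral>\<^sup>+w. (\<Sum>k. ennreal (exp (- \<alpha> * s k)) * f (w (s k)) * \<Psi> (path_incr (s k) w) * indicator (Ev k) w) \<partial>P x)"
    proof (rule nn_integral_cong_AE, rule AE_mp[OF A_path], rule AE_I2, rule impI)
      fix w assume "A 0 w = 0 \<and> mono_on {0..} (\<lambda>t. A t w) \<and> continuous_on {0..} (\<lambda>t. A t w)"
      then have w: "A 0 w = 0" "mono_on {0..} (\<lambda>t. A t w)" "continuous_on {0..} (\<lambda>t. A t w)" by auto
      show "(if hit w then ennreal (exp (- \<alpha> * S n w)) * f (w (S n w)) * \<Psi> (path_incr (S n w) w) else 0) =
        (\<Sum>k. ennreal (exp (- \<alpha> * s k)) * f (w (s k)) * \<Psi> (path_incr (s k) w) * indicator (Ev k) w)"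
        using hit_sum[OF w, of "\<lambda>k. ennreal (exp (- \<alpha> * s k)) * f (w (s k)) * \<Psi> (path_incr (s k) w)" n]
        by (simp only: Ev_def s_def S_def)
    qed
    also have "\<dots> = (\<Sum>k. \<integral>\<^sup>+w. ennreal (exp (- \<alpha> * s k)) * f (w (s k)) * \<Psi> (path_incr (s k) w) * indicator (Ev k) w \<partial>P x)"
      by (rule nn_integral_suminf) measurable
    also have "\<dots> = (\<Sum>k. (\<integral>\<^sup>+w. G k (restrict w {0..s k}) \<partial>P x) * (\<integral>\<^sup>+w. \<Psi> w \<partial>P 0))"
    proof (rule suminf_cong)
      fix k
      have "(\<integral>\<^sup>+w. ennreal (exp (- \<alpha> * s k)) * f (w (s k)) * \<Psi> (path_incr (s k) w) * indicator (Ev k) w \<partial>P x) =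
          (\<integral>\<^sup>+w. G k (restrict w {0..s k}) * \<Psi> (path_incr (s k) w) \<partial>P x)"
      proof (rule nn_integral_cong_AE, rule AE_mp[OF AE_E[of k]], rule AE_I2, rule impI)
        fix w assume "(A (s k) w > 0 \<and> (\<forall>j<k. \<not> A (s j) w > 0)) \<longleftrightarrow> restrict w {0..s k} \<in> E k"
        then have "w \<in> Ev k \<longleftrightarrow> restrict w {0..s k} \<in> E k" by (simp add: Ev_def)
        then show "ennreal (exp (- \<alpha> * s k)) * f (w (s k)) * \<Psi> (path_incr (s k) w) * indicator (Ev k) w =
           G k (restrict w {0..s k}) * \<Psi> (path_incr (s k) w)"
          using s0[of k] by (simp add: G_def indicator_def)
      qed
      also have "\<dots> = (\<integral>\<^sup>+w. G k (restrict w {0..s k}) \<partial>P x) * (\<integral>\<^sup>+w. \<Psi> w \<partial>P 0)"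
        by (rule nn_integral_markov[OF s0 Gm that])
      finally show "(\<integral>\<^sup>+w. ennreal (exp (- \<alpha> * s k)) * f (w (s k)) * \<Psi> (path_incr (s k) w) * indicator (Ev k) w \<partial>P x) =
        (\<integral>\<^sup>+w. G k (restrict w {0..s k}) \<partial>P x) * (\<integral>\<^sup>+w. \<Psi> w \<partial>P 0)" .
    qed
    finally show ?thesis by simp
  qed
  show ?thesis
    using main[OF assms(2)] main[of "\<lambda>_. 1"] P.emeasure_space_1[of 0] by (simp cong: if_cong)
qed

text \<open>As \<open>S n\<close> tends to \<open>R\<close> strictly from the right, position and
  increments along \<open>S n\<close> converge to those at \<open>R\<close>. All factors are bounded
  by 1, so dominated convergence carries both sides of \<open>level_identity\<close> to the
  limit.\<close>

lemma limit_identity: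
  assumes J: "finite J" "J \<subseteq> {0..}" and f: "continuous_on UNIV f" "\<And>a. 0 \<le> f a \<and> f a \<le> 1"
    and h: "\<And>t. t \<in> J \<Longrightarrow> continuous_on UNIV (h t)" "\<And>t a. t \<in> J \<Longrightarrow> 0 \<le> h t a \<and> h t a \<le> 1"
  shows "(\<integral>\<^sup>+w. ennreal (\<rho> w * f (w (R w)) * (\<Prod>t\<in>J. h t (path_incr (R w) w t))) \<partial>P x) =
    (\<integral>\<^sup>+w. ennreal (\<rho> w * f (w (R w))) \<partial>P x) * (\<integral>\<^sup>+w. ennreal (\<Prod>t\<in>J. h t (w t)) \<partial>P 0)"
proof -
  have fm [measurable]: "f \<in> borel_measurable borel"
    using f(1) by (rule borel_measurable_continuous_onI)
  have hm: "h t \<in> borel_measurable borel" if "t \<in> J" for t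
    using h(1)[OF that] by (rule borel_measurable_continuous_onI)
  define \<Phi> where "\<Phi> w = (\<Prod>t\<in>J. h t (w t))" for w :: "real \<Rightarrow> real"
  have \<Phi>m [measurable]: "\<Phi> \<in> borel_measurable path_space"
    unfolding \<Phi>_def
  proof (rule borel_measurable_prod)
    fix t assume t: "t \<in> J"
    show "(\<lambda>w. h t (w t)) \<in> borel_measurable path_space"
      by (rule measurable_compose[OF path_eval_measurable hm[OF t]]) (use t J in auto)
  qed
  have \<Phi>01: "0 \<le> \<Phi> w" "\<Phi> w \<le> 1" for w
    using h(2) by (auto simp: \<Phi>_def intro!: prod_nonneg prod_le_1)
  have wS [measurable]: "(\<lambda>w. w (S n w)) \<in> borel_measurable path_space" for n by (rule path_at_S_measurable)
  have wR [measurable]: "(\<lambda>w. w (R w)) \<in> borel_measurable path_space" by (rule path_at_R_measurable)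
  have lim: "(\<lambda>n. \<integral>\<^sup>+w. ennreal (if hit w then exp (- \<alpha> * S n w) * f (w (S n w)) * \<Psi> (path_incr (S n w) w) else 0) \<partial>P x)
      \<longlonglongrightarrow> (\<integral>\<^sup>+w. ennreal (\<rho> w * f (w (R w)) * \<Psi> (path_incr (R w) w)) \<partial>P x)"
    if [measurable]: "\<Psi> \<in> borel_measurable path_space" and \<Psi>: "\<And>w. 0 \<le> \<Psi> w \<and> \<Psi> w \<le> 1"
      and cont: "\<And>w. w \<in> space path_space \<Longrightarrow> hit w \<Longrightarrow> (\<And>n. R w < S n w) \<Longrightarrow> (\<lambda>n. S n w) \<longlonglongrightarrow> R w \<Longrightarrow>
        (\<lambda>n. \<Psi> (path_incr (S n w) w)) \<longlonglongrightarrow> \<Psi> (path_incr (R w) w)" for \<Psi>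
  proof (rule nn_integral_dominated_convergence[where w="\<lambda>_. 1"])
    show "(\<lambda>_. 1) \<in> borel_measurable (P x)" by simp
    show "(\<lambda>w. ennreal (if hit w then exp (- \<alpha> * S n w) * f (w (S n w)) * \<Psi> (path_incr (S n w) w) else 0)) \<in> borel_measurable (P x)" for n
      by measurable
    show "(\<lambda>w. ennreal (\<rho> w * f (w (R w)) * \<Psi> (path_incr (R w) w))) \<in> borel_measurable (P x)"
      by measurable
    show "(\<integral>\<^sup>+w. 1 \<partial>P x) < \<infinity>" using P.emeasure_space_1[of x] by simp
    show "AE w in P x. ennreal (if hit w then exp (- \<alpha> * S n w) * f (w (S n w)) * \<Psi> (path_incr (S n w) w) else 0) \<le> 1" for n
    proof (rule AE_I2)
      fix w
      have "exp (- \<alpha> * S n w) \<le> 1" using alpha S_nonneg[of n w] by simp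
      then have "exp (- \<alpha> * S n w) * f (w (S n w)) * \<Psi> (path_incr (S n w) w) \<le> 1"
        using f(2) \<Psi> by (intro mult_le_one mult_nonneg_nonneg) auto
      then show "ennreal (if hit w then exp (- \<alpha> * S n w) * f (w (S n w)) * \<Psi> (path_incr (S n w) w) else 0) \<le> 1"
        by (auto simp: ennreal_le_1)
    qed
    show "AE w in P x. (\<lambda>n. ennreal (if hit w then exp (- \<alpha> * S n w) * f (w (S n w)) * \<Psi> (path_incr (S n w) w) else 0))
        \<longlonglongrightarrow> ennreal (\<rho> w * f (w (R w)) * \<Psi> (path_incr (R w) w))"
    proof (rule AE_mp[OF A_path], rule AE_I2, rule impI)
      fix w assume "w \<in> space (P x)" and "A 0 w = 0 \<and> mono_on {0..} (\<lambda>t. A t w) \<and> continuous_on {0..} (\<lambda>t. A t w)"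
      then have ws: "w \<in> space path_space" and w: "A 0 w = 0" "mono_on {0..} (\<lambda>t. A t w)" "continuous_on {0..} (\<lambda>t. A t w)" by auto
      show "(\<lambda>n. ennreal (if hit w then exp (- \<alpha> * S n w) * f (w (S n w)) * \<Psi> (path_incr (S n w) w) else 0))
        \<longlonglongrightarrow> ennreal (\<rho> w * f (w (R w)) * \<Psi> (path_incr (R w) w))"
      proof (cases "hit w")
        case True
        note hp = hit_path(2,3)[OF True w]
        have "(\<lambda>n. w (S n w)) \<longlonglongrightarrow> w (R w)"
          by (rule cadlag_LIMSEQ[OF cadlag_path[OF ws] hp R_nonneg])
        then have 1: "(\<lambda>n. f (w (S n w))) \<longlonglongrightarrow> f (w (R w))"
          by (rule continuous_on_tendsto_compose[OF f(1)]) auto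
        have 2: "(\<lambda>n. exp (- \<alpha> * S n w)) \<longlonglongrightarrow> exp (- \<alpha> * R w)"
          by (intro tendsto_intros hp(2))
        have 3: "(\<lambda>n. \<Psi> (path_incr (S n w) w)) \<longlonglongrightarrow> \<Psi> (path_incr (R w) w)"
          by (rule cont[OF ws True hp])
        show ?thesis using True by (simp only: \<rho>_def if_True) (intro tendsto_ennrealI tendsto_mult 1 2 3)
      qed (simp add: \<rho>_def)
    qed
  qed
  have lev: "(\<integral>\<^sup>+w. ennreal (if hit w then exp (- \<alpha> * S n w) * f (w (S n w)) * \<Phi> (path_incr (S n w) w) else 0) \<partial>P x) =
    (\<integral>\<^sup>+w. ennreal (if hit w then exp (- \<alpha> * S n w) * f (w (S n w)) * 1 else 0) \<partial>P x) * (\<integral>\<^sup>+w. ennreal (\<Phi> w) \<partial>P 0)" for n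
  proof -
    have "(\<integral>\<^sup>+w. ennreal (if hit w then exp (- \<alpha> * S n w) * f (w (S n w)) * \<Phi> (path_incr (S n w) w) else 0) \<partial>P x) =
        (\<integral>\<^sup>+w. (if hit w then ennreal (exp (- \<alpha> * S n w)) * ennreal (f (w (S n w))) * ennreal (\<Phi> (path_incr (S n w) w)) else 0) \<partial>P x)"
      using f(2) \<Phi>01 by (intro nn_integral_cong) (simp add: ennreal_mult)
    moreover have "(\<integral>\<^sup>+w. ennreal (if hit w then exp (- \<alpha> * S n w) * f (w (S n w)) * 1 else 0) \<partial>P x) =
        (\<integral>\<^sup>+w. (if hit w then ennreal (exp (- \<alpha> * S n w)) * ennreal (f (w (S n w))) else 0) \<partial>P x)"
      using f(2) by (intro nn_integral_cong) (simp add: ennreal_mult)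
    ultimately show ?thesis
      using level_identity[where f="\<lambda>a. ennreal (f a)" and \<Phi>="\<lambda>w. ennreal (\<Phi> w)" and n=n and x=x] by simp
  qed
  have "(\<integral>\<^sup>+w. ennreal (\<Phi> w) \<partial>P 0) \<le> (\<integral>\<^sup>+w. 1 \<partial>P 0)"
    using \<Phi>01 by (intro nn_integral_mono) (auto simp: ennreal_le_1)
  then have fin: "(\<integral>\<^sup>+w. ennreal (\<Phi> w) \<partial>P 0) < \<top>"
    using P.emeasure_space_1[of 0] by (auto simp: less_top[symmetric] top_unique)
  have a: "(\<lambda>n. \<integral>\<^sup>+w. ennreal (if hit w then exp (- \<alpha> * S n w) * f (w (S n w)) * \<Phi> (path_incr (S n w) w) else 0) \<partial>P x)
      \<longlonglongrightarrow> (\<integral>\<^sup>+w. ennreal (\<rho> w * f (w (R w)) * \<Phi> (path_incr (R w) w)) \<partial>P x)"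
  proof (rule lim[OF \<Phi>m])
    fix w assume w: "w \<in> space path_space" "hit w" "\<And>n. R w < S n w" "(\<lambda>n. S n w) \<longlonglongrightarrow> R w"
    show "(\<lambda>n. \<Phi> (path_incr (S n w) w)) \<longlonglongrightarrow> \<Phi> (path_incr (R w) w)"
      unfolding \<Phi>_def
    proof (rule tendsto_prod)
      fix t assume t: "t \<in> J"
      then have t0: "t \<ge> 0" using J by auto
      have 1: "(\<lambda>n. w (S n w)) \<longlonglongrightarrow> w (R w)"
        by (rule cadlag_LIMSEQ[OF cadlag_path[OF w(1)] w(3,4) R_nonneg])
      have 2: "(\<lambda>n. w (S n w + t)) \<longlonglongrightarrow> w (R w + t)"
      proof (rule cadlag_LIMSEQ[OF cadlag_path[OF w(1)]])
        show "(\<lambda>n. S n w + t) \<longlonglongrightarrow> R w + t" by (intro tendsto_intros w(4))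
      qed (use w(3) t0 R_nonneg[of w] in auto)
      have "(\<lambda>n. w (S n w + t) - w (S n w)) \<longlonglongrightarrow> w (R w + t) - w (R w)"
        by (rule tendsto_diff[OF 2 1])
      then have "(\<lambda>n. path_incr (S n w) w t) \<longlonglongrightarrow> path_incr (R w) w t"
        using t0 by (simp add: path_incr_def S_nonneg R_nonneg max_absorb2)
      then show "(\<lambda>n. h t (path_incr (S n w) w t)) \<longlonglongrightarrow> h t (path_incr (R w) w t)"
        by (rule continuous_on_tendsto_compose[OF h(1)[OF t]]) auto
    qed
  qed (use \<Phi>01 in auto)
  have b: "(\<lambda>n. \<integral>\<^sup>+w. ennreal (if hit w then exp (- \<alpha> * S n w) * f (w (S n w)) * 1 else 0) \<partial>P x)
      \<longlonglongrightarrow> (\<integral>\<^sup>+w. ennreal (\<rho> w * f (w (R w)) * 1) \<partial>P x)"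
    by (rule lim[of "\<lambda>_. 1"]) auto
  have "(\<integral>\<^sup>+w. ennreal (\<rho> w * f (w (R w)) * \<Phi> (path_incr (R w) w)) \<partial>P x) =
      (\<integral>\<^sup>+w. ennreal (\<rho> w * f (w (R w)) * 1) \<partial>P x) * (\<integral>\<^sup>+w. ennreal (\<Phi> w) \<partial>P 0)"
    using LIMSEQ_unique[OF a[unfolded lev]] ennreal_tendsto_cmult[OF fin b] by (simp only: mult.commute)
  then show ?thesis by (simp add: \<Phi>_def)
qed

text \<open>The discounted law of the position at \<open>R\<close>; its mass is the expectation of
  \<open>\<rho>\<close> under \<open>P x\<close>, which is at most 1.\<close>

definition "\<nu> x = distr (density (P x) (\<lambda>w. ennreal (\<rho> w))) borel (\<lambda>w. w (R w))"

lemma sets_\<nu> [simp, measurable_cong]: "sets (\<nu> x) = sets borel" by (simp add: \<nu>_def)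

lemma finite_density_\<rho>: "finite_measure (density (P x) (\<lambda>w. ennreal (\<rho> w)))"
  by (rule finite_measure_density_le_1) (auto intro!: P.finite_measure_axioms simp: ennreal_le_1 \<rho>_bounds)

lemma finite_\<nu>: "finite_measure (\<nu> x)"
  unfolding \<nu>_def
  by (rule finite_measure.finite_measure_distr[OF finite_density_\<rho>]) (use path_at_R_measurable in simp)

text \<open>\<open>limit_identity\<close> gives equal integrals for products of continuous
  functions, and \<open>emeasure_continuous_to_borel\<close> turns this into equality on product
  events.\<close>

lemma strong_markov_cylinders:
  assumes J: "finite J" "J \<subseteq> {0..}" and B: "\<And>t. t \<in> J \<Longrightarrow> B t \<in> sets borel" and C: "C \<in> sets borel"
  shows "emeasure (density (P x) (\<lambda>w. ennreal (\<rho> w))) {w \<in> space path_space. w (R w) \<in> C \<and> (\<forall>t\<in>J. path_incr (R w) w t \<in> B t)} =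
    emeasure (\<nu> x) C * emeasure (P 0) {w \<in> space path_space. \<forall>t\<in>J. w t \<in> B t}"
proof -
  let ?M1 = "density (P x) (\<lambda>w. ennreal (\<rho> w))"
  let ?M2 = "\<nu> x \<Otimes>\<^sub>M P 0"
  interpret \<nu>: finite_measure "\<nu> x" by (rule finite_\<nu>)
  \<comment> \<open>Times are nonnegative, so the index \<open>- 1\<close> is free to carry the position at \<open>R\<close>.\<close>
  define Y where "Y i w = (if i = - 1 then w (R w) else path_incr (R w) w i)" for i :: real and w :: "real \<Rightarrow> real"
  define Z where "Z i = (\<lambda>(a :: real, w :: real \<Rightarrow> real). if i = - 1 then a else w i)" for i :: real
  define B' where "B' = B(- 1 := C)"
  have J1: "- 1 \<notin> J" using J by auto
  have wR [measurable]: "(\<lambda>w. w (R w)) \<in> borel_measurable path_space" by (rule path_at_R_measurable)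
  have iR [measurable]: "(\<lambda>w. path_incr (R w) w) \<in> path_space \<rightarrow>\<^sub>M path_space" by measurable
  have "emeasure ?M1 {w \<in> space ?M1. \<forall>i\<in>insert (- 1) J. Y i w \<in> B' i} = emeasure ?M2 {z \<in> space ?M2. \<forall>i\<in>insert (- 1) J. Z i z \<in> B' i}"
  proof (rule emeasure_continuous_to_borel)
    show "finite_measure ?M1" by (rule finite_density_\<rho>)
    show "finite_measure ?M2" by (rule finite_measure_pair_measure[OF P.finite_measure_axioms finite_\<nu>])
    show "Y i \<in> borel_measurable ?M1" if "i \<in> insert (- 1) J" for i
    proof (cases "i = - 1")
      case False
      then have "i \<ge> 0" using that J by auto
      from measurable_compose[OF iR path_eval_measurable[OF this]] False show ?thesis
        by (simp add: Y_def[abs_def])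
    qed (simp add: Y_def[abs_def])
    show "Z i \<in> borel_measurable ?M2" if "i \<in> insert (- 1) J" for i
    proof (cases "i = - 1")
      case False
      then have "i \<ge> 0" using that J by auto
      from measurable_compose[OF measurable_snd path_eval_measurable[OF this], of "\<nu> x"] False show ?thesis
        by (simp add: Z_def case_prod_beta' cong: measurable_cong_sets sets_pair_measure_cong)
    qed (simp add: Z_def case_prod_beta')
    fix f :: "real \<Rightarrow> real \<Rightarrow> real"
    assume f: "\<And>i. i \<in> insert (- 1) J \<Longrightarrow> continuous_on UNIV (f i)" "\<And>i x. i \<in> insert (- 1) J \<Longrightarrow> 0 \<le> f i x \<and> f i x \<le> 1"
    have fm: "f i \<in> borel_measurable borel" if "i \<in> insert (- 1) J" for i
      using f(1)[OF that] by (rule borel_measurable_continuous_onI)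
    have fm1 [measurable]: "f (- 1) \<in> borel_measurable borel" by (rule fm) simp
    have prm [measurable]: "(\<lambda>w. \<Prod>t\<in>J. f t (w t)) \<in> borel_measurable path_space"
    proof (rule borel_measurable_prod)
      fix t assume t: "t \<in> J"
      show "(\<lambda>w. f t (w t)) \<in> borel_measurable path_space"
        by (rule measurable_compose[OF path_eval_measurable fm]) (use t J in auto)
    qed
    have Jne: "t \<noteq> - 1" if "t \<in> J" for t using that J1 by auto
    have prY: "(\<Prod>i\<in>insert (- 1) J. f i (Y i w)) = f (- 1) (w (R w)) * (\<Prod>t\<in>J. f t (path_incr (R w) w t))" for w
      using J J1 Jne by (simp add: Y_def cong: prod.cong)
    have prZ: "(\<Prod>i\<in>insert (- 1) J. f i (Z i (a, w))) = f (- 1) a * (\<Prod>t\<in>J. f t (w t))" for a w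
      using J J1 Jne by (simp add: Z_def cong: prod.cong)
    have pos: "0 \<le> f (- 1) a" "0 \<le> (\<Prod>t\<in>J. f t (w t))" for a and w :: "real \<Rightarrow> real"
      using f(2) by (auto intro!: prod_nonneg)
    have [measurable]: "(\<lambda>w. \<Prod>t\<in>J. f t (path_incr (R w) w t)) \<in> borel_measurable path_space"
      by (rule measurable_compose[OF iR prm])
    have "(\<integral>\<^sup>+w. ennreal (\<Prod>i\<in>insert (- 1) J. f i (Y i w)) \<partial>?M1) =
        (\<integral>\<^sup>+w. ennreal (\<rho> w * f (- 1) (w (R w)) * (\<Prod>t\<in>J. f t (path_incr (R w) w t))) \<partial>P x)"
      unfolding prY using pos \<rho>_bounds by (simp add: nn_integral_density ennreal_mult[symmetric] mult.assoc)
    also have "\<dots> = (\<integral>\<^sup>+w. ennreal (\<rho> w * f (- 1) (w (R w))) \<partial>P x) * (\<integral>\<^sup>+w. ennreal (\<Prod>t\<in>J. f t (w t)) \<partial>P 0)"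
      by (rule limit_identity[OF J]) (use f in auto)
    also have "(\<integral>\<^sup>+w. ennreal (\<rho> w * f (- 1) (w (R w))) \<partial>P x) = (\<integral>\<^sup>+a. ennreal (f (- 1) a) \<partial>\<nu> x)"
      unfolding \<nu>_def using pos \<rho>_bounds by (simp add: nn_integral_distr nn_integral_density ennreal_mult[symmetric])
    also have "(\<integral>\<^sup>+a. ennreal (f (- 1) a) \<partial>\<nu> x) * (\<integral>\<^sup>+w. ennreal (\<Prod>t\<in>J. f t (w t)) \<partial>P 0) =
       (\<integral>\<^sup>+a. \<integral>\<^sup>+w. ennreal (\<Prod>i\<in>insert (- 1) J. f i (Z i (a, w))) \<partial>P 0 \<partial>\<nu> x)"
    proof -
      have "f (- 1) \<in> borel_measurable (\<nu> x)"
        using fm1 by (simp cong: measurable_cong_sets)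
      then show ?thesis
        unfolding prZ using pos by (simp add: ennreal_mult nn_integral_cmult, subst nn_integral_multc) simp_all
    qed
    also have "\<dots> = (\<integral>\<^sup>+z. ennreal (\<Prod>i\<in>insert (- 1) J. f i (Z i z)) \<partial>?M2)"
    proof (rule P.nn_integral_fst)
      have "(\<lambda>z. ennreal (f (- 1) (fst z) * (\<Prod>t\<in>J. f t (snd z t)))) \<in> borel_measurable ?M2"
        using measurable_compose[OF measurable_snd prm, of "\<nu> x"] by measurable
      moreover have "(\<Prod>i\<in>insert (- 1) J. f i (Z i z)) = f (- 1) (fst z) * (\<Prod>t\<in>J. f t (snd z t))" for z
        using prZ[of "fst z" "snd z"] by simp
      ultimately show "(\<lambda>z. ennreal (\<Prod>i\<in>insert (- 1) J. f i (Z i z))) \<in> borel_measurable ?M2" by (simp only:)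
    qed
    finally show "(\<integral>\<^sup>+w. ennreal (\<Prod>i\<in>insert (- 1) J. f i (Y i w)) \<partial>?M1) = (\<integral>\<^sup>+z. ennreal (\<Prod>i\<in>insert (- 1) J. f i (Z i z)) \<partial>?M2)" .
  qed (use J B C in \<open>auto simp: B'_def\<close>)
  moreover have "{w \<in> space ?M1. \<forall>i\<in>insert (- 1) J. Y i w \<in> B' i} = {w \<in> space path_space. w (R w) \<in> C \<and> (\<forall>t\<in>J. path_incr (R w) w t \<in> B t)}"
    using J1 by (auto simp: Y_def B'_def split: if_splits)
  moreover have "{z \<in> space ?M2. \<forall>i\<in>insert (- 1) J. Z i z \<in> B' i} = C \<times> {w \<in> space path_space. \<forall>t\<in>J. w t \<in> B t}"
    using J1 by (auto simp: Z_def B'_def space_pair_measure sets_eq_imp_space_eq[OF sets_\<nu>] split: if_splits)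
  moreover have "emeasure ?M2 (C \<times> {w \<in> space path_space. \<forall>t\<in>J. w t \<in> B t}) = emeasure (\<nu> x) C * emeasure (P 0) {w \<in> space path_space. \<forall>t\<in>J. w t \<in> B t}"
    by (rule P.emeasure_pair_measure_Times) (use C cylinder_sets[OF J B measurable_ident_sets[OF refl]] in auto)
  ultimately show ?thesis by simp
qed

text \<open>Cylinder sets determine a measure on \<open>path_space\<close>, so with the set for the
  position kept fixed the product formula extends from cylinders to all events of the increments
  after \<open>R\<close>.\<close>

theorem strong_markov:
  "distr (density (P x) (\<lambda>w. ennreal (\<rho> w))) (borel \<Otimes>\<^sub>M path_space) (\<lambda>w. (w (R w), path_incr (R w) w)) = \<nu> x \<Otimes>\<^sub>M P 0"
proof -
  let ?M1 = "density (P x) (\<lambda>w. ennreal (\<rho> w))"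
  interpret \<nu>: finite_measure "\<nu> x" by (rule finite_\<nu>)
  interpret M1: finite_measure ?M1 by (rule finite_density_\<rho>)
  have wR [measurable]: "(\<lambda>w. w (R w)) \<in> borel_measurable path_space" by (rule path_at_R_measurable)
  have iR [measurable]: "(\<lambda>w. path_incr (R w) w) \<in> path_space \<rightarrow>\<^sub>M path_space" by measurable
  define RC where "RC C = {w \<in> space path_space. w (R w) \<in> C}" for C
  have RC [measurable]: "RC C \<in> sets path_space" if "C \<in> sets borel" for C
    unfolding RC_def using measurable_sets[OF wR that] by (simp add: vimage_def Int_def conj_commute)
  define DF where "DF F = {w \<in> space path_space. path_incr (R w) w \<in> F}" for F
  have DF [measurable]: "DF F \<in> sets path_space" if "F \<in> sets path_space" for F
    unfolding DF_def using measurable_sets[OF iR that] by (simp add: vimage_def Int_def conj_commute)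
  have key: "emeasure ?M1 (RC C \<inter> DF F) = emeasure (\<nu> x) C * emeasure (P 0) F"
    if C: "C \<in> sets borel" and F: "F \<in> sets path_space" for C F
  proof -
    let ?M = "distr (density ?M1 (indicator (RC C))) path_space (\<lambda>w. path_incr (R w) w)"
    let ?N = "density (P 0) (\<lambda>_. emeasure (\<nu> x) C)"
    have M: "emeasure ?M F = emeasure ?M1 (RC C \<inter> DF F)" if "F \<in> sets path_space" for F
    proof -
      have "emeasure ?M F = emeasure (density ?M1 (indicator (RC C))) (DF F)"
        using that by (subst emeasure_distr) (auto simp: DF_def vimage_def Int_def conj_commute)
      also have "\<dots> = emeasure ?M1 (RC C \<inter> DF F)"
        using that C by (intro emeasure_restricted) (auto intro: RC DF)
      finally show ?thesis .
    qed
    have N: "emeasure ?N F = emeasure (\<nu> x) C * emeasure (P 0) F" if "F \<in> sets path_space" for F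
      using that by (simp add: emeasure_density_const)
    have "?M = ?N"
    proof (rule path_measure_eqI)
      fix J :: "real set" and B :: "real \<Rightarrow> real set"
      assume JB: "finite J" "J \<subseteq> {0..}" "\<And>t. t \<in> J \<Longrightarrow> B t \<in> sets borel"
      let ?F = "{w \<in> space path_space. \<forall>t\<in>J. w t \<in> B t}"
      have F: "?F \<in> sets path_space" by (rule cylinder_sets[OF JB measurable_ident_sets[OF refl]])
      have "RC C \<inter> DF ?F = {w \<in> space path_space. w (R w) \<in> C \<and> (\<forall>t\<in>J. path_incr (R w) w t \<in> B t)}"
        using measurable_space[OF iR] by (auto simp: RC_def DF_def)
      then show "emeasure ?M ?F = emeasure ?N ?F"
        unfolding M[OF F] N[OF F] using strong_markov_cylinders[where x=x, OF JB C] by simp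
    qed (auto intro!: finite_measure.finite_measure_distr M1.finite_measure_restricted RC C)
    then have "emeasure ?M F = emeasure ?N F" by (rule arg_cong)
    then show ?thesis using M[OF F] N[OF F] by simp
  qed
  show ?thesis
  proof (rule pair_measure_eqI[symmetric])
    fix A B assume A: "A \<in> sets (\<nu> x)" and B: "B \<in> sets (P 0)"
    have "(\<lambda>w. (w (R w), path_incr (R w) w)) -` (A \<times> B) \<inter> space ?M1 = RC A \<inter> DF B"
      by (auto simp: RC_def DF_def)
    moreover have "(\<lambda>w. (w (R w), path_incr (R w) w)) \<in> ?M1 \<rightarrow>\<^sub>M borel \<Otimes>\<^sub>M path_space"
      by measurable
    moreover have "A \<times> B \<in> sets (borel \<Otimes>\<^sub>M path_space)" using A B by auto
    ultimately show "emeasure (\<nu> x) A * emeasure (P 0) B =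
        emeasure (distr ?M1 (borel \<Otimes>\<^sub>M path_space) (\<lambda>w. (w (R w), path_incr (R w) w))) (A \<times> B)"
      using A B key[of A B] by (simp add: emeasure_distr)
  qed (auto intro: \<nu>.sigma_finite_measure_axioms P.sigma_finite_measure_axioms cong: sets_pair_measure_cong)
qed

end

context levy begin

lemma path_translate_measurable1: "path_translate a \<in> path_space \<rightarrow>\<^sub>M path_space"
  by measurable

lemma distr_translate: "distr (P x) path_space (path_translate a) = P (a + x)"
proof -
  have "path_translate a (\<lambda>t\<in>{0..}. x + X t \<omega>) = (\<lambda>t\<in>{0..}. a + x + X t \<omega>)" for \<omega>
    by (auto simp: path_translate_def)
  then show ?thesis
    unfolding law_from_def by (subst distr_distr) (auto simp: comp_def path_translate_measurable1)
qed

lemma nn_integral_translate: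
  assumes [measurable]: "\<Phi> \<in> borel_measurable path_space"
  shows "(\<integral>\<^sup>+w. \<Phi> w \<partial>P (a + x)) = (\<integral>\<^sup>+w. \<Phi> (path_translate a w) \<partial>P x)"
proof -
  have "(\<integral>\<^sup>+w. \<Phi> w \<partial>P (a + x)) = (\<integral>\<^sup>+w. \<Phi> w \<partial>distr (P x) path_space (path_translate a))"
    by (simp only: distr_translate)
  also have "\<dots> = (\<integral>\<^sup>+w. \<Phi> (path_translate a w) \<partial>P x)"
    by (rule nn_integral_distr) (use path_translate_measurable1 in simp_all)
  finally show ?thesis .
qed

text \<open>Translating the increments, which have law \<open>P 0\<close>, by the position at time
  \<open>s\<close> gives the process started there: the Markov property in its usual form.\<close>

lemma nn_integral_shift:
  assumes s: "s \<ge> 0" and [measurable]: "\<Phi> \<in> borel_measurable path_space"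
  shows "(\<integral>\<^sup>+w. \<Phi> (path_shift s w) \<partial>P x) = (\<integral>\<^sup>+w. (\<integral>\<^sup>+w'. \<Phi> w' \<partial>P (w s)) \<partial>P x)"
proof -
  have rm [measurable]: "(\<lambda>w. restrict w {0..s}) \<in> path_space \<rightarrow>\<^sub>M past s"
    by (rule path_restrict_measurable[OF s])
  have ev [measurable]: "(\<lambda>r. r s) \<in> borel_measurable (past s)"
    by (rule measurable_component_singleton) (simp add: s)
  let ?H = "\<lambda>z :: (real \<Rightarrow> real) \<times> (real \<Rightarrow> real). \<Phi> (path_translate (fst z s) (snd z))"
  have Hm: "?H \<in> borel_measurable (past s \<Otimes>\<^sub>M path_space)"
    using measurable_compose[OF measurable_fst ev, of path_space] by measurable
  have "(\<integral>\<^sup>+w. \<Phi> (path_shift s w) \<partial>P x) = (\<integral>\<^sup>+w. ?H (restrict w {0..s}, path_incr s w) \<partial>P x)"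
    using s by (simp add: path_shift_eq)
  also have "\<dots> = (\<integral>\<^sup>+z. ?H z \<partial>distr (P x) (past s \<Otimes>\<^sub>M path_space) (\<lambda>w. (restrict w {0..s}, path_incr s w)))"
    using Hm by (subst nn_integral_distr) auto
  also have "\<dots> = (\<integral>\<^sup>+z. ?H z \<partial>(distr (P x) (past s) (\<lambda>w. restrict w {0..s}) \<Otimes>\<^sub>M P 0))"
    by (simp only: markov[OF s])
  also have "\<dots> = (\<integral>\<^sup>+r. \<integral>\<^sup>+w'. \<Phi> (path_translate (r s) w') \<partial>P 0 \<partial>distr (P x) (past s) (\<lambda>w. restrict w {0..s}))"
    using Hm by (subst P.nn_integral_fst[symmetric]) (auto cong: measurable_cong_sets sets_pair_measure_cong)
  also have "\<dots> = (\<integral>\<^sup>+w. \<integral>\<^sup>+w'. \<Phi> (path_translate (w s) w') \<partial>P 0 \<partial>P x)"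
    using P.borel_measurable_nn_integral_fst[of "?H" "past s" 0] Hm s
    by (subst nn_integral_distr) (auto cong: measurable_cong_sets sets_pair_measure_cong)
  also have "\<dots> = (\<integral>\<^sup>+w. (\<integral>\<^sup>+w'. \<Phi> w' \<partial>P (w s)) \<partial>P x)"
    using nn_integral_translate[OF assms(2), of _ 0] by simp
  finally show ?thesis .
qed

end

section \<open>Local times and the potential density\<close>

locale levy_local_times = levy M X for M :: "'a measure" and X +
  fixes L :: "real \<Rightarrow> real \<Rightarrow> (real \<Rightarrow> real) \<Rightarrow> real" and \<alpha> :: real
  assumes local_times: "local_times M X L" and alpha: "\<alpha> > 0"
begin

lemmas lt_conjs = local_times[unfolded local_times_def]

lemma L_joint: "(\<lambda>(y, t, w). L y t w) \<in> borel_measurable (borel \<Otimes>\<^sub>M borel \<Otimes>\<^sub>M path_space)"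
  by (rule lt_conjs[THEN conjunct1])

lemma L_measurable [measurable (raw)]:
  assumes "f \<in> borel_measurable N" "g \<in> borel_measurable N" "h \<in> N \<rightarrow>\<^sub>M path_space"
  shows "(\<lambda>x. L (f x) (g x) (h x)) \<in> borel_measurable N"
  using measurable_compose[OF measurable_Pair[OF assms(1) measurable_Pair[OF assms(2,3)]] L_joint] by simp

lemma L_at: "local_time_at M X y (L y)"
  using lt_conjs[THEN conjunct2, THEN conjunct1] by blast

lemmas L_caf = L_at[unfolded local_time_at_def continuous_additive_functional_def, THEN conjunct1]

lemma L_adapted:
  assumes "t \<ge> 0"
  shows "adapted_event x t (\<lambda>w. L y t w > 0)"
proof -
  obtain g where "g \<in> borel_measurable (path_filtration t)" "AE w in P x. L y t w = g w"
    using L_caf[of y, THEN conjunct1] assms by blast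
  then show ?thesis by (rule adapted_event_filtration)
qed

lemma L_path: "AE w in P x. L y 0 w = 0 \<and> mono_on {0..} (\<lambda>t. L y t w) \<and> continuous_on {0..} (\<lambda>t. L y t w) \<and>
    (\<forall>s\<ge>0. \<forall>t\<ge>0. L y (s + t) w = L y s w + L y t (path_shift s w))"
  using L_caf[of y, THEN conjunct2] by blast

lemma L_support_off: "x \<noteq> y \<Longrightarrow> AE w in P x. \<exists>t>0. L y t w = 0"
  using L_at[of y, unfolded local_time_at_def, THEN conjunct2, THEN conjunct2] by blast

lemma L_occupation: "AE w in P x. \<forall>t\<ge>0.
    distr (restrict_space lborel {0..t}) borel w = density lborel (\<lambda>y. ennreal (L y t w))"
  using lt_conjs[THEN conjunct2, THEN conjunct2, THEN conjunct1] by blast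

lemma L_translate: "AE w in P x. \<forall>t\<ge>0. L (y + a) t (path_translate a w) = L y t w"
  using lt_conjs[THEN conjunct2, THEN conjunct2, THEN conjunct2] by blast

sublocale H: hitting M X "L y" \<alpha> for y
proof
  show "(\<lambda>(t, w). L y t w) \<in> borel_measurable (borel \<Otimes>\<^sub>M path_space)" by measurable
  show "adapted_event x t (\<lambda>w. L y t w > 0)" if "t \<ge> 0" for t x using that by (rule L_adapted)
  show "AE w in P x. L y 0 w = 0 \<and> mono_on {0..} (\<lambda>t. L y t w) \<and> continuous_on {0..} (\<lambda>t. L y t w)" for x
    by (rule AE_mp[OF L_path[where x=x and y=y]]) auto
qed (rule alpha)

text \<open>Local time with the independent exponential clock integrated out. Extended nonnegative
  integrals allow Tonelli before finiteness is known.\<close>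

definition F :: "real \<Rightarrow> (real \<Rightarrow> real) \<Rightarrow> ennreal" where
  "F y w = (\<integral>\<^sup>+t. ennreal (exponential_density \<alpha> t) * ennreal (L y t w) \<partial>lborel)"

definition u :: "real \<Rightarrow> real \<Rightarrow> ennreal" where
  "u x y = (\<integral>\<^sup>+w. F y w \<partial>P x)"

lemma F_measurable [measurable (raw)]:
  assumes [measurable]: "f \<in> borel_measurable N" "h \<in> N \<rightarrow>\<^sub>M path_space"
  shows "(\<lambda>x. F (f x) (h x)) \<in> borel_measurable N"
  unfolding F_def by measurable

lemma u_translate_eq: "u a y = (\<integral>\<^sup>+w. F y (path_translate a w) \<partial>P 0)"
  unfolding u_def using nn_integral_translate[of "F y" a 0] by simp

lemma u_measurable [measurable (raw)]:
  assumes [measurable]: "f \<in> borel_measurable N" "h \<in> borel_measurable N"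
  shows "(\<lambda>x. u (f x) (h x)) \<in> borel_measurable N"
  unfolding u_translate_eq by measurable

text \<open>Translating path and level together leaves local time unchanged, by the homogeneity
  clause of \<open>local_times\<close>. Negative times, about which that clause is silent, carry
  exponential density 0.\<close>

lemma u_homogeneous: "u x y = u 0 (y - x)"
proof -
  have "u x y = (\<integral>\<^sup>+w. F y (path_translate x w) \<partial>P 0)" by (rule u_translate_eq)
  also have "\<dots> = (\<integral>\<^sup>+w. F (y - x) w \<partial>P 0)"
  proof (rule nn_integral_cong_AE, rule AE_mp[OF L_translate[where x=0 and y="y - x" and a=x]], rule AE_I2, rule impI)
    fix w assume *: "\<forall>t\<ge>0. L (y - x + x) t (path_translate x w) = L (y - x) t w"
    show "F y (path_translate x w) = F (y - x) w"
      unfolding F_def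
    proof (rule nn_integral_cong)
      fix t :: real
      show "ennreal (exponential_density \<alpha> t) * ennreal (L y t (path_translate x w)) =
          ennreal (exponential_density \<alpha> t) * ennreal (L (y - x) t w)"
        using * by (cases "t \<ge> 0") (simp_all add: exponential_density_def)
    qed
  qed
  finally show ?thesis by (simp add: u_def)
qed

text \<open>Additivity will be applied at the random time \<open>R\<close>, hence the exceptional
  null sets are collected once, before any time is chosen.\<close>

definition good :: "real \<Rightarrow> (real \<Rightarrow> real) \<Rightarrow> bool" where
  "good y w \<longleftrightarrow> w \<in> space path_space \<and> L y 0 w = 0 \<and> mono_on {0..} (\<lambda>t. L y t w) \<and> continuous_on {0..} (\<lambda>t. L y t w) \<and>
    (\<forall>s\<ge>0. \<forall>t\<ge>0. L y (s + t) w = L y s w + L y t (path_shift s w))"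

lemma AE_good: "AE w in P x. good y w"
  by (rule AE_mp[OF L_path[where x=x and y=y]], rule AE_I2) (simp add: good_def)

lemma good_mono: "good y w \<Longrightarrow> 0 \<le> s \<Longrightarrow> s \<le> t \<Longrightarrow> L y s w \<le> L y t w"
  using mono_onD[of "{0..}" "\<lambda>t. L y t w" s t] unfolding good_def by auto

lemma good_nonneg: "good y w \<Longrightarrow> 0 \<le> t \<Longrightarrow> 0 \<le> L y t w"
  using good_mono[of y w 0 t] by (simp add: good_def)

lemma exponential_density_nn_integral: "(\<integral>\<^sup>+t. ennreal (exponential_density \<alpha> t) \<partial>lborel) = 1"
  using prob_space.emeasure_space_1[OF prob_space_exponential_density[OF alpha]] by (simp add: emeasure_density)

text \<open>After time \<open>r\<close> additivity splits off \<open>L y r w\<close>, and the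
  memoryless clock starts afresh with weight \<open>exp (- \<alpha> * r)\<close>.\<close>

lemma F_decompose:
  assumes w: "good y w" and r: "r \<ge> 0"
  shows "F y w = (\<integral>\<^sup>+t. ennreal (exponential_density \<alpha> t) * ennreal (L y t w) * indicator {..<r} t \<partial>lborel) +
    ennreal (exp (- \<alpha> * r)) * (ennreal (L y r w) + F y (path_shift r w))"
proof -
  have ws: "w \<in> space path_space" using w by (simp add: good_def)
  have Lm: "(\<lambda>t. L y t v) \<in> borel_measurable borel" if "v \<in> space path_space" for v
    using that by measurable
  have ps: "path_shift r w \<in> space path_space"
    using r ws measurable_space[OF path_translate_measurable1] measurable_space[OF path_incr_measurable1]
    by (simp add: path_shift_eq)
  note [measurable] = Lm[OF ws] Lm[OF ps]
  let ?e = "\<lambda>t. ennreal (exponential_density \<alpha> t)"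
  have e: "?e (r + t) * indicator {r..} (r + t) = ennreal (exp (- \<alpha> * r)) * ?e t" for t
    using r alpha by (auto simp: exponential_density_def indicator_def ennreal_mult[symmetric] exp_add[symmetric] algebra_simps)
  have "F y w = (\<integral>\<^sup>+t. ?e t * ennreal (L y t w) * indicator {..<r} t + ?e t * ennreal (L y t w) * indicator {r..} t \<partial>lborel)"
    unfolding F_def by (intro nn_integral_cong) (auto simp: indicator_def)
  also have "\<dots> = (\<integral>\<^sup>+t. ?e t * ennreal (L y t w) * indicator {..<r} t \<partial>lborel) + (\<integral>\<^sup>+t. ?e t * ennreal (L y t w) * indicator {r..} t \<partial>lborel)"
    by (rule nn_integral_add) measurable
  also have "(\<integral>\<^sup>+t. ?e t * ennreal (L y t w) * indicator {r..} t \<partial>lborel) =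
      (\<integral>\<^sup>+t. ?e (r + t) * ennreal (L y (r + t) w) * indicator {r..} (r + t) \<partial>lborel)"
    by (subst nn_integral_real_affine[of _ 1 r]) simp_all
  also have "\<dots> = (\<integral>\<^sup>+t. ennreal (exp (- \<alpha> * r)) * (?e t * ennreal (L y r w) + ?e t * ennreal (L y t (path_shift r w))) \<partial>lborel)"
  proof (rule nn_integral_cong)
    fix t
    show "?e (r + t) * ennreal (L y (r + t) w) * indicator {r..} (r + t) =
      ennreal (exp (- \<alpha> * r)) * (?e t * ennreal (L y r w) + ?e t * ennreal (L y t (path_shift r w)))"
    proof (cases "t \<ge> 0")
      case True
      have add: "L y (r + t) w = L y r w + L y t (path_shift r w)"
        using w r True by (simp add: good_def)
      then have "L y t (path_shift r w) \<ge> 0" using good_mono[OF w r, of "r + t"] True by simp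
      then have "ennreal (L y (r + t) w) = ennreal (L y r w) + ennreal (L y t (path_shift r w))"
        using add good_nonneg[OF w r] by (simp add: ennreal_plus)
      then have "?e (r + t) * ennreal (L y (r + t) w) * indicator {r..} (r + t) =
          (?e (r + t) * indicator {r..} (r + t)) * (ennreal (L y r w) + ennreal (L y t (path_shift r w)))"
        by (simp only: mult_ac)
      then show ?thesis unfolding e by (simp only: distrib_left mult.assoc)
    next
      case False
      then show ?thesis by (simp add: exponential_density_def)
    qed
  qed
  also have "\<dots> = ennreal (exp (- \<alpha> * r)) * (ennreal (L y r w) + F y (path_shift r w))"
    unfolding F_def by (simp add: nn_integral_cmult nn_integral_add nn_integral_multc exponential_density_nn_integral)
  finally show ?thesis .
qed

lemma F_shift_le:
  assumes "good y w" "r \<ge> 0"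
  shows "ennreal (exp (- \<alpha> * r)) * F y (path_shift r w) \<le> F y w"
  unfolding F_decompose[OF assms] by (simp add: distrib_left add_increasing)

lemma F_shift_eq:
  assumes w: "good y w" "r \<ge> 0" and L0: "L y r w = 0"
  shows "F y w = ennreal (exp (- \<alpha> * r)) * F y (path_shift r w)"
proof -
  have "(\<integral>\<^sup>+t. ennreal (exponential_density \<alpha> t) * ennreal (L y t w) * indicator {..<r} t \<partial>lborel) = (\<integral>\<^sup>+t. 0 \<partial>(lborel :: real measure))"
  proof (rule nn_integral_cong)
    fix t
    show "ennreal (exponential_density \<alpha> t) * ennreal (L y t w) * indicator {..<r} t = 0"
      using good_mono[OF w(1), of t r] L0 by (cases "t \<ge> 0") (auto simp: exponential_density_def indicator_def ennreal_neg)
  qed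
  then show ?thesis using F_decompose[OF w] by (simp add: L0)
qed

lemma nn_integral_H:
  assumes [measurable]: "\<Phi> \<in> borel_measurable (borel \<Otimes>\<^sub>M path_space)"
  shows "(\<integral>\<^sup>+w. ennreal (H.\<rho> y w) * \<Phi> (w (H.R y w), path_incr (H.R y w) w) \<partial>P x) =
    (\<integral>\<^sup>+a. \<integral>\<^sup>+w. \<Phi> (a, w) \<partial>P 0 \<partial>H.\<nu> y x)"
proof -
  have wR [measurable]: "(\<lambda>w. w (H.R y w)) \<in> borel_measurable path_space" by (rule H.path_at_R_measurable)
  have iR [measurable]: "(\<lambda>w. path_incr (H.R y w) w) \<in> path_space \<rightarrow>\<^sub>M path_space" by measurable
  have "(\<integral>\<^sup>+w. ennreal (H.\<rho> y w) * \<Phi> (w (H.R y w), path_incr (H.R y w) w) \<partial>P x) =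
     (\<integral>\<^sup>+z. \<Phi> z \<partial>distr (density (P x) (\<lambda>w. ennreal (H.\<rho> y w))) (borel \<Otimes>\<^sub>M path_space) (\<lambda>w. (w (H.R y w), path_incr (H.R y w) w)))"
    by (subst nn_integral_distr) (auto simp: nn_integral_density)
  also have "\<dots> = (\<integral>\<^sup>+z. \<Phi> z \<partial>(H.\<nu> y x \<Otimes>\<^sub>M P 0))" by (simp only: H.strong_markov)
  also have "\<dots> = (\<integral>\<^sup>+a. \<integral>\<^sup>+w. \<Phi> (a, w) \<partial>P 0 \<partial>H.\<nu> y x)"
    using assms by (subst P.nn_integral_fst) (auto cong: measurable_cong_sets sets_pair_measure_cong)
  finally show ?thesis .
qed

lemma shift_at_R: "path_shift (H.R y w) w = path_translate (w (H.R y w)) (path_incr (H.R y w) w)"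
  by (rule path_shift_eq[OF H.R_nonneg])

text \<open>Local time at \<open>y\<close> does not increase right after the process is at a point other than \<open>y\<close>.\<close>

lemma \<nu>_support: "AE a in H.\<nu> y x. a = y"
proof -
  \<comment> \<open>By monotonicity countably many small times express that local time is positive
    at once, which keeps the event measurable.\<close>
  define Q where "Q v \<longleftrightarrow> (\<forall>n :: nat. L y (1 / real (Suc n)) v > 0)" for v
  have [measurable]: "Measurable.pred path_space Q" unfolding Q_def by measurable
  have wR [measurable]: "(\<lambda>w. w (H.R y w)) \<in> borel_measurable path_space" by (rule H.path_at_R_measurable)
  define \<Phi> where "\<Phi> = (\<lambda>(a, w). if a \<noteq> y \<and> Q (path_translate a w) then 1 else 0 :: ennreal)"
  have [measurable]: "\<Phi> \<in> borel_measurable (borel \<Otimes>\<^sub>M path_space)"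
    unfolding \<Phi>_def by measurable
  have "(\<integral>\<^sup>+a. (if a \<noteq> y then 1 else 0) \<partial>H.\<nu> y x) = (\<integral>\<^sup>+w. ennreal (H.\<rho> y w) * (if w (H.R y w) \<noteq> y then 1 else 0) \<partial>P x)"
    unfolding H.\<nu>_def by (subst nn_integral_distr) (auto simp: nn_integral_density)
  also have "\<dots> = (\<integral>\<^sup>+w. ennreal (H.\<rho> y w) * \<Phi> (w (H.R y w), path_incr (H.R y w) w) \<partial>P x)"
  proof (rule nn_integral_cong_AE, rule AE_mp[OF AE_good[where x=x and y=y]], rule AE_I2, rule impI)
    fix w assume w: "good y w"
    show "ennreal (H.\<rho> y w) * (if w (H.R y w) \<noteq> y then 1 else 0) = ennreal (H.\<rho> y w) * \<Phi> (w (H.R y w), path_incr (H.R y w) w)"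
    proof (cases "H.hit y w")
      case True
      have w': "L y 0 w = 0" "mono_on {0..} (\<lambda>t. L y t w)" "continuous_on {0..} (\<lambda>t. L y t w)" using w by (auto simp: good_def)
      \<comment> \<open>Local time at \<open>y\<close> is 0 at \<open>R\<close> and positive right
        after, so by additivity the shifted path accumulates it immediately.\<close>
      have "L y t (path_shift (H.R y w) w) > 0" if t: "t > 0" for t
      proof -
        have "L y (H.R y w + t) w = L y (H.R y w) w + L y t (path_shift (H.R y w) w)"
          using w t H.R_nonneg[of y w] by (simp add: good_def)
        then show ?thesis using H.hit_path(4)[OF True w'] H.hit_path(5)[OF True w' t] by linarith
      qed
      then have "Q (path_shift (H.R y w) w)" by (simp add: Q_def)
      then show ?thesis by (simp add: \<Phi>_def shift_at_R)
    qed (simp add: H.\<rho>_def)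
  qed
  also have "\<dots> = (\<integral>\<^sup>+a. \<integral>\<^sup>+w. \<Phi> (a, w) \<partial>P 0 \<partial>H.\<nu> y x)" by (rule nn_integral_H) measurable
  also have "\<dots> = (\<integral>\<^sup>+a. 0 \<partial>H.\<nu> y x)"
  proof (rule nn_integral_cong)
    fix a
    show "(\<integral>\<^sup>+w. \<Phi> (a, w) \<partial>P 0) = 0"
    proof (cases "a = y")
      case False
      have "(\<integral>\<^sup>+w. \<Phi> (a, w) \<partial>P 0) = (\<integral>\<^sup>+w. (if Q (path_translate a w) then 1 else 0) \<partial>P 0)"
        using False by (simp add: \<Phi>_def)
      also have "\<dots> = (\<integral>\<^sup>+w. (if Q w then 1 else 0) \<partial>P a)"
        using nn_integral_translate[of "\<lambda>w. if Q w then 1 else 0" a 0] by simp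
      also have "\<dots> = (\<integral>\<^sup>+w. 0 \<partial>P a)"
      proof (rule nn_integral_cong_AE, rule AE_mp[OF L_support_off[OF False]], rule AE_mp[OF AE_good[where x=a and y=y]], rule AE_I2, intro impI)
        fix w assume w: "good y w" and "\<exists>t>0. L y t w = 0"
        then obtain t where t: "t > 0" "L y t w = 0" by auto
        obtain n :: nat where "inverse (real (Suc n)) < t" using reals_Archimedean[OF t(1)] by blast
        then have "L y (1 / real (Suc n)) w \<le> 0"
          using good_mono[OF w, of "1 / real (Suc n)" t] t(2) by (simp add: inverse_eq_divide)
        then show "(if Q w then 1 else 0) = (0 :: ennreal)" unfolding Q_def by (metis not_less)
      qed
      finally show ?thesis by simp
    qed (simp add: \<Phi>_def)
  qed
  finally have "(\<integral>\<^sup>+a. (if a \<noteq> y then 1 else 0) \<partial>H.\<nu> y x) = (0 :: ennreal)" by simp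
  then have "AE a in H.\<nu> y x. (if a \<noteq> y then 1 else 0) = (0 :: ennreal)"
    by (subst (asm) nn_integral_0_iff_AE) (auto cong: measurable_cong_sets)
  then show ?thesis by (rule AE_mp) (rule AE_I2, simp split: if_splits)
qed

text \<open>\<open>c\<close> is the expected discount at \<open>R\<close>, the mass of
  \<open>\<nu>\<close>. No local time at \<open>y\<close> is collected before \<open>R\<close>,
  whence the equality; that at \<open>z\<close> before \<open>R\<close> is dropped, whence the
  inequality. From \<open>R\<close> on the process starts anew at \<open>y\<close>, because
  \<open>\<nu>\<close> is concentrated there.\<close>

lemma u_hitting:
  obtains c where "c \<le> 1" "u x y = c * u y y" "\<And>z. c * u y z \<le> u x z"
proof
  let ?c = "emeasure (H.\<nu> y x) (space (H.\<nu> y x))"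
  have wR [measurable]: "(\<lambda>w. w (H.R y w)) \<in> borel_measurable path_space" by (rule H.path_at_R_measurable)
  have c: "?c = (\<integral>\<^sup>+w. ennreal (H.\<rho> y w) \<partial>P x)"
    unfolding H.\<nu>_def by (auto simp: emeasure_distr emeasure_density intro!: nn_integral_cong)
  show "?c \<le> 1"
  proof -
    have "?c \<le> (\<integral>\<^sup>+w. 1 \<partial>P x)" unfolding c
      by (intro nn_integral_mono) (simp add: ennreal_le_1 H.\<rho>_bounds)
    then show ?thesis using P.emeasure_space_1[of x] by simp
  qed
  have at_R: "(\<integral>\<^sup>+w. ennreal (H.\<rho> y w) * F z (path_shift (H.R y w) w) \<partial>P x) = ?c * u y z" for z
  proof -
    have "(\<integral>\<^sup>+w. ennreal (H.\<rho> y w) * F z (path_shift (H.R y w) w) \<partial>P x) =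
        (\<integral>\<^sup>+a. \<integral>\<^sup>+w. F z (path_translate a w) \<partial>P 0 \<partial>H.\<nu> y x)"
      using nn_integral_H[where \<Phi>="\<lambda>(a, w). F z (path_translate a w)" and y=y and x=x] by (simp add: shift_at_R)
    also have "\<dots> = (\<integral>\<^sup>+a. u a z \<partial>H.\<nu> y x)" by (simp only: u_translate_eq)
    also have "\<dots> = (\<integral>\<^sup>+a. u y z \<partial>H.\<nu> y x)"
      by (rule nn_integral_cong_AE, rule AE_mp[OF \<nu>_support]) auto
    finally show ?thesis by (simp add: mult.commute)
  qed
  show "?c * u y z \<le> u x z" for z
    unfolding at_R[symmetric] unfolding u_def
  proof (rule nn_integral_mono_AE, rule AE_mp[OF AE_good[where x=x and y=z]], rule AE_I2, rule impI)
    fix w assume w: "good z w"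
    show "ennreal (H.\<rho> y w) * F z (path_shift (H.R y w) w) \<le> F z w"
      using F_shift_le[OF w H.R_nonneg, of y w] by (auto simp: H.\<rho>_def)
  qed
  show "u x y = ?c * u y y"
    unfolding at_R[symmetric] unfolding u_def
  proof (rule nn_integral_cong_AE, rule AE_mp[OF AE_good[where x=x and y=y]], rule AE_I2, rule impI)
    fix w assume w: "good y w"
    then have w': "L y 0 w = 0" "mono_on {0..} (\<lambda>t. L y t w)" "continuous_on {0..} (\<lambda>t. L y t w)" by (auto simp: good_def)
    show "F y w = ennreal (H.\<rho> y w) * F y (path_shift (H.R y w) w)"
    proof (cases "H.hit y w")
      case True
      then show ?thesis
        using F_shift_eq[OF w H.R_nonneg H.hit_path(4)[OF True w']] by (simp add: H.\<rho>_def)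
    next
      case False
      have "F y w = (\<integral>\<^sup>+t. 0 \<partial>(lborel :: real measure))"
        unfolding F_def
      proof (rule nn_integral_cong)
        fix t show "ennreal (exponential_density \<alpha> t) * ennreal (L y t w) = 0"
          using H.no_hit[OF False w'(1,2), of t] by (cases "t \<ge> 0") (auto simp: exponential_density_def)
      qed
      then show ?thesis using False by (simp add: H.\<rho>_def)
    qed
  qed
qed

end

section \<open>Fourier inversion\<close>

context
  fixes f :: "real \<Rightarrow> real" and B :: real
  assumes f_meas [measurable]: "f \<in> borel_measurable borel" and f_bound: "\<And>x. \<bar>f x\<bar> \<le> B"
begin

lemma integrable_shift_mult:
  assumes "integrable lborel k"
  shows "integrable lborel (\<lambda>z. f (x + z) * k z)"
proof (rule Bochner_Integration.integrable_bound)
  show "integrable lborel (\<lambda>z. B * k z)" using assms by simp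
  have [measurable]: "k \<in> borel_measurable borel" using assms by (auto dest: borel_measurable_integrable)
  show "(\<lambda>z. f (x + z) * k z) \<in> borel_measurable lborel" by measurable
  have "0 \<le> B" using f_bound[of 0] by linarith
  then show "AE z in lborel. norm (f (x + z) * k z) \<le> norm (B * k z)"
    using f_bound by (intro AE_I2) (simp add: abs_mult mult_right_mono)
qed

text \<open>The class of kernels for which the continuity claim holds; it is enlarged from intervals
  to bounded Borel sets, to sets of finite measure and finally to all integrable functions.\<close>

definition regularizing :: "(real \<Rightarrow> real) \<Rightarrow> bool" where
  "regularizing k \<longleftrightarrow> integrable lborel k \<and> continuous_on UNIV (\<lambda>x. \<integral>z. f (x + z) * k z \<partial>lborel)"

lemma regularizing_add: "regularizing k \<Longrightarrow> regularizing l \<Longrightarrow> regularizing (\<lambda>z. k z + l z)"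
  unfolding regularizing_def by (auto simp: distrib_left integrable_shift_mult intro!: continuous_intros)

lemma regularizing_cmult: "regularizing k \<Longrightarrow> regularizing (\<lambda>z. c * k z)"
  unfolding regularizing_def by (auto simp: mult.left_commute[of _ c] integrable_shift_mult intro!: continuous_intros)

lemma regularizing_sum: "(\<And>i :: nat. i < n \<Longrightarrow> regularizing (k i)) \<Longrightarrow> regularizing (\<lambda>z. \<Sum>i<n. k i z)"
proof (induction n)
  case 0
  show ?case by (simp add: regularizing_def)
next
  case (Suc n)
  then show ?case using regularizing_add[of "\<lambda>z. \<Sum>i<n. k i z" "k n"] by simp
qed

text \<open>Because \<open>f\<close> is bounded by \<open>B\<close>, closeness of the kernels in
  integral norm makes the convolutions uniformly close, and uniform limits preserve
  continuity.\<close>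

lemma regularizing_limit:
  assumes k: "\<And>n. regularizing (k n)" and l: "integrable lborel l" and lim: "(\<lambda>n. \<integral>z. \<bar>k n z - l z\<bar> \<partial>lborel) \<longlonglongrightarrow> 0"
  shows "regularizing l"
proof -
  have B: "0 \<le> B" using f_bound[of 0] by linarith
  have ki: "integrable lborel (k n)" for n using k by (simp add: regularizing_def)
  have bd: "\<bar>(\<integral>z. f (x + z) * k n z \<partial>lborel) - (\<integral>z. f (x + z) * l z \<partial>lborel)\<bar> \<le> B * (\<integral>z. \<bar>k n z - l z\<bar> \<partial>lborel)" for n x
  proof -
    have "(\<integral>z. f (x + z) * k n z \<partial>lborel) - (\<integral>z. f (x + z) * l z \<partial>lborel) = (\<integral>z. f (x + z) * (k n z - l z) \<partial>lborel)"
      using integrable_shift_mult[OF ki] integrable_shift_mult[OF l] by (simp add: right_diff_distrib)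
    also have "\<bar>\<dots>\<bar> \<le> (\<integral>z. \<bar>f (x + z) * (k n z - l z)\<bar> \<partial>lborel)"
      by (rule integral_abs_bound)
    also have "\<dots> \<le> (\<integral>z. B * \<bar>k n z - l z\<bar> \<partial>lborel)"
    proof (rule integral_mono)
      show "integrable lborel (\<lambda>z. \<bar>f (x + z) * (k n z - l z)\<bar>)"
        using ki l by (intro integrable_abs integrable_shift_mult) simp
    qed (use ki l f_bound in \<open>auto simp: abs_mult intro!: mult_right_mono\<close>)
    finally show ?thesis by simp
  qed
  have "(\<lambda>n. B * (\<integral>z. \<bar>k n z - l z\<bar> \<partial>lborel)) \<longlonglongrightarrow> B * 0" by (intro tendsto_intros lim)
  then have lim': "(\<lambda>n. B * (\<integral>z. \<bar>k n z - l z\<bar> \<partial>lborel)) \<longlonglongrightarrow> 0" by simp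
  have "uniform_limit UNIV (\<lambda>n x. \<integral>z. f (x + z) * k n z \<partial>lborel) (\<lambda>x. \<integral>z. f (x + z) * l z \<partial>lborel) sequentially"
  proof (rule uniform_limitI)
    fix e :: real assume "e > 0"
    then have "\<forall>\<^sub>F n in sequentially. B * (\<integral>z. \<bar>k n z - l z\<bar> \<partial>lborel) < e"
      using lim' by (auto dest: order_tendstoD)
    then show "\<forall>\<^sub>F n in sequentially. \<forall>x\<in>UNIV. dist (\<integral>z. f (x + z) * k n z \<partial>lborel) (\<integral>z. f (x + z) * l z \<partial>lborel) < e"
      by eventually_elim (use bd in \<open>auto simp: dist_real_def intro: le_less_trans\<close>)
  qed
  then have "continuous_on UNIV (\<lambda>x. \<integral>z. f (x + z) * l z \<partial>lborel)"
    by (rule uniform_limit_theorem[rotated]) (use k in \<open>auto simp: regularizing_def\<close>)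
  with l show ?thesis by (simp add: regularizing_def)
qed

text \<open>Moving the interval changes the integral only on two end pieces of length
  \<open>|x - y|\<close>, so the convolution is Lipschitz with constant
  \<open>2 * B\<close>.\<close>

lemma regularizing_interval: "regularizing (indicator {a..b})"
proof -
  have i: "integrable lborel (indicator {a..b} :: real \<Rightarrow> real)" for a b :: real
    by (rule integrable_real_indicator) (auto simp: emeasure_lborel_Icc_eq)
  have B: "0 \<le> B" using f_bound[of 0] by linarith
  have sh: "(\<integral>z. f (x + z) * indicator {a..b} z \<partial>lborel) = (\<integral>z. f z * indicator {a + x..b + x} z \<partial>lborel)" for x
    by (subst lborel_integral_real_affine[of 1 "\<lambda>z. f z * indicator {a + x..b + x} z" x])
       (auto intro!: Bochner_Integration.integral_cong simp: indicator_def)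
  have fi: "integrable lborel (\<lambda>z. f z * indicator {a..b} z)" for a b using integrable_shift_mult[OF i, of 0] by simp
  have step: "\<bar>(\<integral>z. f (x + z) * indicator {a..b} z \<partial>lborel) - (\<integral>z. f (y + z) * indicator {a..b} z \<partial>lborel)\<bar> \<le> 2 * B * \<bar>x - y\<bar>"
    if xy: "x \<le> y" for x y
  proof -
    have ii: "integrable lborel (\<lambda>z. indicator {a + x..a + y} z + indicator {b + x..b + y} z :: real)"
      by (rule Bochner_Integration.integrable_add[OF i i])
    have "\<bar>(\<integral>z. f (x + z) * indicator {a..b} z \<partial>lborel) - (\<integral>z. f (y + z) * indicator {a..b} z \<partial>lborel)\<bar>
       = \<bar>\<integral>z. f z * indicator {a + x..b + x} z - f z * indicator {a + y..b + y} z \<partial>lborel\<bar>"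
      unfolding sh by (simp add: fi)
    also have "\<dots> \<le> (\<integral>z. \<bar>f z * indicator {a + x..b + x} z - f z * indicator {a + y..b + y} z\<bar> \<partial>lborel)"
      by (rule integral_abs_bound)
    also have "\<dots> \<le> (\<integral>z. B * (indicator {a + x..a + y} z + indicator {b + x..b + y} z) \<partial>lborel)"
    proof (rule integral_mono)
      fix z
      show "\<bar>f z * indicator {a + x..b + x} z - f z * indicator {a + y..b + y} z\<bar> \<le> B * (indicator {a + x..a + y} z + indicator {b + x..b + y} z)"
        using f_bound[of z] B xy by (auto simp: indicator_def)
    qed (use fi ii in auto)
    also have "\<dots> = 2 * B * \<bar>x - y\<bar>" using xy by simp
    finally show ?thesis .
  qed
  have "continuous_on UNIV (\<lambda>x. \<integral>z. f (x + z) * indicator {a..b} z \<partial>lborel)"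
  proof (rule lipschitz_on_continuous_on)
    show "(2 * B)-lipschitz_on UNIV (\<lambda>x. \<integral>z. f (x + z) * indicator {a..b} z \<partial>lborel)"
    proof (rule lipschitz_onI)
      fix x y
      show "dist (\<integral>z. f (x + z) * indicator {a..b} z \<partial>lborel) (\<integral>z. f (y + z) * indicator {a..b} z \<partial>lborel) \<le> 2 * B * dist x y"
        using step[of x y] step[of y x] by (cases "x \<le> y") (auto simp: dist_real_def abs_minus_commute)
    qed (use B in simp)
  qed
  with i show ?thesis by (simp add: regularizing_def)
qed

text \<open>Induction over the Borel sets generated by half lines; the cut to
  \<open>{- N..N}\<close> keeps every set of finite measure, so that complements stay
  integrable.\<close>

lemma regularizing_bounded_set:
  assumes "A \<in> sets borel"
  shows "regularizing (indicator (A \<inter> {- N..N}))"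
proof -
  have "Int_stable (range atMost :: real set set)" by (auto simp: Int_stable_def)
  moreover have "range atMost \<subseteq> Pow (UNIV :: real set)" by simp
  moreover have "A \<in> sigma_sets UNIV (range atMost)"
    using assms by (simp add: borel_eq_atMost)
  ultimately show ?thesis
  proof (induction rule: sigma_sets_induct_disjoint)
    case (basic A)
    then obtain a where "A = {..a}" by auto
    then have "A \<inter> {- N..N} = {- N..min a N}" by auto
    then show ?case by (simp only: regularizing_interval)
  next
    case empty
    show ?case by (simp add: regularizing_def)
  next
    case (compl A)
    have "indicator ((UNIV - A) \<inter> {- N..N}) = (\<lambda>z. indicator {- N..N} z + (- 1) * indicator (A \<inter> {- N..N}) z :: real)"
      by (auto simp: indicator_def fun_eq_iff)
    then show ?case using regularizing_add[OF regularizing_interval regularizing_cmult[OF compl(2), of "- 1"]] by simp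
  next
    case (union A)
    then have Am: "A i \<in> sets borel" for i by (auto simp: borel_eq_atMost)
    show ?case
    proof (rule regularizing_limit)
      show "regularizing (\<lambda>z. \<Sum>i<n. indicator (A i \<inter> {- N..N}) z)" for n
        by (rule regularizing_sum) (rule union.IH)
      have iN: "integrable lborel (indicator {- N..N} :: real \<Rightarrow> real)"
        by (rule integrable_real_indicator) (auto simp: emeasure_lborel_Icc_eq)
      have Um: "(\<Union>i. A i) \<inter> {- N..N} \<in> sets borel" using Am by auto
      show "integrable lborel (indicator ((\<Union>i. A i) \<inter> {- N..N}) :: real \<Rightarrow> real)"
      proof (rule integrable_real_indicator)
        have "emeasure lborel ((\<Union>i. A i) \<inter> {- N..N}) \<le> emeasure lborel {- N..N}" by (intro emeasure_mono) auto
        also have "\<dots> < \<infinity>" by (simp add: emeasure_lborel_Icc_eq)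
        finally show "emeasure lborel ((\<Union>i. A i) \<inter> {- N..N}) < \<infinity>" .
      qed (use Um in simp)
      have sum_eq: "(\<Sum>i<n. indicator (A i \<inter> {- N..N}) z) = (indicator ((\<Union>i<n. A i) \<inter> {- N..N}) z :: real)" for n z
      proof -
        have "disjoint_family_on (\<lambda>i. A i \<inter> {- N..N}) {..<n}"
          using union.hyps(1) by (auto simp: disjoint_family_on_def)
        then have "indicator (\<Union>i<n. A i \<inter> {- N..N}) z = (\<Sum>i<n. indicator (A i \<inter> {- N..N}) z :: real)"
          by (intro indicator_UN_disjoint) auto
        moreover have "(\<Union>i<n. A i \<inter> {- N..N}) = (\<Union>i<n. A i) \<inter> {- N..N}" by auto
        ultimately show ?thesis by (simp only:)
      qed
      have "(\<lambda>n. \<integral>z. \<bar>(\<Sum>i<n. indicator (A i \<inter> {- N..N}) z) - indicator ((\<Union>i. A i) \<inter> {- N..N}) z\<bar> \<partial>lborel) \<longlonglongrightarrow> (\<integral>z. (0 :: real) \<partial>(lborel :: real measure))"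
      proof (rule integral_dominated_convergence[where w="indicator {- N..N}"])
        show "AE z in lborel. (\<lambda>n. \<bar>(\<Sum>i<n. indicator (A i \<inter> {- N..N}) z) - indicator ((\<Union>i. A i) \<inter> {- N..N}) z\<bar>) \<longlonglongrightarrow> (0 :: real)"
        proof (rule AE_I2)
          fix z :: real
          have "\<forall>\<^sub>F n in sequentially. \<bar>(\<Sum>i<n. indicator (A i \<inter> {- N..N}) z) - indicator ((\<Union>i. A i) \<inter> {- N..N}) z\<bar> = (0 :: real)"
          proof (cases "z \<in> (\<Union>i. A i)")
            case True
            then obtain i where "z \<in> A i" by auto
            show ?thesis using eventually_gt_at_top[of i]
              unfolding sum_eq by eventually_elim (use \<open>z \<in> A i\<close> in \<open>auto simp: indicator_def\<close>)
          next
            case False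
            then show ?thesis unfolding sum_eq by (auto simp: indicator_def)
          qed
          then show "(\<lambda>n. \<bar>(\<Sum>i<n. indicator (A i \<inter> {- N..N}) z) - indicator ((\<Union>i. A i) \<inter> {- N..N}) z\<bar>) \<longlonglongrightarrow> (0 :: real)"
            by (rule tendsto_eventually)
        qed
        show "AE z in lborel. norm \<bar>(\<Sum>i<n. indicator (A i \<inter> {- N..N}) z) - (indicator ((\<Union>i. A i) \<inter> {- N..N}) z :: real)\<bar> \<le> (indicator {- N..N} z :: real)" for n
          unfolding sum_eq by (rule AE_I2) (auto simp: indicator_def)
      qed (use Am Um iN in auto)
      then show "(\<lambda>n. \<integral>z. \<bar>(\<Sum>i<n. indicator (A i \<inter> {- N..N}) z) - indicator ((\<Union>i. A i) \<inter> {- N..N}) z\<bar> \<partial>lborel) \<longlonglongrightarrow> (0 :: real)"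
        by simp
    qed
  qed
qed

lemma regularizing_finite_set:
  assumes A: "A \<in> sets borel" "emeasure lborel A < \<infinity>"
  shows "regularizing (indicator A)"
proof (rule regularizing_limit)
  show "regularizing (indicator (A \<inter> {- real n..real n}))" for n by (rule regularizing_bounded_set[OF A(1)])
  show iA: "integrable lborel (indicator A :: real \<Rightarrow> real)" using A by (intro integrable_real_indicator) auto
  have "(\<lambda>n. \<integral>z. \<bar>indicator (A \<inter> {- real n..real n}) z - indicator A z\<bar> \<partial>lborel) \<longlonglongrightarrow> (\<integral>z. (0 :: real) \<partial>(lborel :: real measure))"
  proof (rule integral_dominated_convergence[where w="indicator A"])
    show "AE z in lborel. (\<lambda>n. \<bar>indicator (A \<inter> {- real n..real n}) z - indicator A z\<bar>) \<longlonglongrightarrow> (0 :: real)"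
    proof (rule AE_I2)
      fix z :: real
      obtain n0 :: nat where n0: "\<bar>z\<bar> \<le> real n0" using real_arch_simple by blast
      have "\<forall>\<^sub>F n in sequentially. \<bar>indicator (A \<inter> {- real n..real n}) z - indicator A z\<bar> = (0 :: real)"
        using eventually_ge_at_top[of n0]
        by eventually_elim (use n0 in \<open>auto simp: indicator_def\<close>)
      then show "(\<lambda>n. \<bar>indicator (A \<inter> {- real n..real n}) z - indicator A z\<bar>) \<longlonglongrightarrow> (0 :: real)"
        by (rule tendsto_eventually)
    qed
    show "AE z in lborel. norm \<bar>indicator (A \<inter> {- real n..real n}) z - (indicator A z :: real)\<bar> \<le> (indicator A z :: real)" for n
      by (rule AE_I2) (auto simp: indicator_def)
  qed (use A iA in auto)
  then show "(\<lambda>n. \<integral>z. \<bar>indicator (A \<inter> {- real n..real n}) z - indicator A z\<bar> \<partial>lborel) \<longlonglongrightarrow> (0 :: real)" by simp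
qed

lemma regularizing_integrable:
  assumes "integrable lborel k"
  shows "regularizing k"
  using assms
proof (induction rule: integrable_induct)
  case (base A c)
  have "regularizing (\<lambda>z. c * indicator A z)"
    by (rule regularizing_cmult[OF regularizing_finite_set]) (use base in auto)
  then show ?case by (simp add: mult.commute)
next
  case (add k l)
  show ?case by (rule regularizing_add[OF add(3,4)])
next
  case (lim k s)
  have s: "regularizing (s n)" for n by fact
  have k: "integrable lborel k" by fact
  show ?case
  proof (rule regularizing_limit[OF s k])
    have "(\<lambda>n. \<integral>z. \<bar>s n z - k z\<bar> \<partial>lborel) \<longlonglongrightarrow> (\<integral>z. (0 :: real) \<partial>(lborel :: real measure))"
    \<comment> \<open>\<open>integrable_induct\<close> provides
      \<open>|s n z| \<le> 2 * |k z|\<close>, hence the factor 3 for the difference.\<close>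
    proof (rule integral_dominated_convergence[where w="\<lambda>z. 3 * \<bar>k z\<bar>"])
      show "AE z in lborel. (\<lambda>n. \<bar>s n z - k z\<bar>) \<longlonglongrightarrow> (0 :: real)"
      proof (rule AE_I2)
        fix z :: real assume "z \<in> space lborel"
        then have "(\<lambda>n. s n z) \<longlonglongrightarrow> k z" by (rule lim)
        then have "(\<lambda>n. \<bar>s n z - k z\<bar>) \<longlonglongrightarrow> \<bar>k z - k z\<bar>" by (intro tendsto_intros)
        then show "(\<lambda>n. \<bar>s n z - k z\<bar>) \<longlonglongrightarrow> 0" by simp
      qed
      show "AE z in lborel. norm \<bar>s n z - k z\<bar> \<le> 3 * \<bar>k z\<bar>" for n
      proof (rule AE_I2)
        fix z :: real assume "z \<in> space lborel"
        then have "norm (s n z) \<le> 2 * norm (k z)" by (rule lim)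
        then show "norm \<bar>s n z - k z\<bar> \<le> 3 * \<bar>k z\<bar>" by simp
      qed
    qed (use lim in auto)
    then show "(\<lambda>n. \<integral>z. \<bar>s n z - k z\<bar> \<partial>lborel) \<longlonglongrightarrow> (0 :: real)" by simp
  qed
qed

lemma continuous_convolution:
  assumes "integrable lborel k"
  shows "continuous_on UNIV (\<lambda>x. \<integral>z. f (x + z) * k z \<partial>lborel)"
  using regularizing_integrable[OF assms] by (simp add: regularizing_def)

end

text \<open>On an unbounded set the Henstock-Kurzweil integral is tested on boxes that contain large
  balls. Such a box meets \<open>{0..}\<close> in an interval \<open>{0..b}\<close> with
  \<open>b\<close> large, so the limit over these intervals decides.\<close>

lemma has_integral_improper:
  fixes h :: "real \<Rightarrow> real"
  assumes int: "\<And>N. N \<ge> 0 \<Longrightarrow> h integrable_on {0..N}" and lim: "((\<lambda>N. integral {0..N} h) \<longlongrightarrow> l) at_top"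
  shows "(h has_integral l) {0..}"
  unfolding has_integral_alt'
proof (intro conjI allI impI)
  have eq: "(\<lambda>x. if x \<in> {0..} then h x else 0) integrable_on {a..b} \<longleftrightarrow> h integrable_on {max 0 a..b}"
    "integral {a..b} (\<lambda>x. if x \<in> {0..} then h x else 0) = integral {max 0 a..b} h" for a b :: real
  proof -
    have "{0..} \<inter> {a..b} = {max 0 a..b}" by auto
    then show "(\<lambda>x. if x \<in> {0..} then h x else 0) integrable_on {a..b} \<longleftrightarrow> h integrable_on {max 0 a..b}"
      "integral {a..b} (\<lambda>x. if x \<in> {0..} then h x else 0) = integral {max 0 a..b} h"
      using integrable_restrict_Int[of "{0..}" h "{a..b}"] integral_restrict_Int[of "{a..b}" "{0..}" h] by simp_all
  qed
  show "(\<lambda>x. if x \<in> {0..} then h x else 0) integrable_on cbox a b" for a b :: real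
  proof (cases "b \<ge> 0")
    case True
    have "h integrable_on {max 0 a..b}"
      by (rule integrable_on_subinterval[OF int[OF True]]) auto
    then show ?thesis by (simp only: eq interval_cbox[symmetric])
  next
    case False
    then have "{max 0 a..b} = {}" by auto
    then have "h integrable_on {max 0 a..b}" by (simp only: integrable_on_empty)
    then show ?thesis by (simp only: eq interval_cbox[symmetric])
  qed
  fix e :: real assume "e > 0"
  from tendstoD[OF lim this] have "\<forall>\<^sub>F N in at_top. dist (integral {0..N} h) l < e" .
  then obtain B where B: "\<And>N. N \<ge> B \<Longrightarrow> dist (integral {0..N} h) l < e"
    by (auto simp: eventually_at_top_linorder)
  show "\<exists>B>0. \<forall>a b. ball 0 B \<subseteq> cbox a b \<longrightarrow> norm (integral (cbox a b) (\<lambda>x. if x \<in> {0..} then h x else 0) - l) < e"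
  proof (intro exI[of _ "max 1 B"] conjI allI impI)
    fix a b :: real assume "ball 0 (max 1 B) \<subseteq> cbox a b"
    \<comment> \<open>The ball is open; passing to closures puts its end points into
      \<open>{a..b}\<close>, which yields \<open>b \<ge> B\<close> and
      \<open>a \<le> 0\<close>.\<close>
    then have "closure (ball 0 (max 1 B)) \<subseteq> closure {a..b}" by (intro closure_mono) (simp only: cbox_interval)
    then have "cball 0 (max 1 B) \<subseteq> {a..b}" by (subst (asm) closure_ball) auto
    moreover have "max 1 B \<in> cball 0 (max 1 B)" "- max 1 B \<in> cball 0 (max 1 B)" by (simp_all add: dist_real_def)
    ultimately have "max 1 B \<in> {a..b}" "- max 1 B \<in> {a..b}" by blast+
    then have ab: "b \<ge> B" "a \<le> 0" by auto
    then have "max 0 a = 0" by simp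
    then show "norm (integral (cbox a b) (\<lambda>x. if x \<in> {0..} then h x else 0) - l) < e"
      using B[OF ab(1)] by (simp only: eq(2) interval_cbox[symmetric] dist_norm)
  qed simp
qed

section \<open>Gaussian summation and inversion at a point of continuity\<close>

lemma gaussian_fourier:
  assumes e: "\<epsilon> > 0"
  shows "(\<integral>l. iexp (l * t) * of_real (std_normal_density (\<epsilon> * l)) \<partial>lborel) =
    of_real (sqrt (2 * pi) / \<epsilon> * std_normal_density (t / \<epsilon>))"
proof -
  have "of_real (exp (- ((t / \<epsilon>)^2) / 2)) = char std_normal_distribution (t / \<epsilon>)"
    by (simp only: char_std_normal_distribution)
  also have "\<dots> = (\<integral>x. std_normal_density x *\<^sub>R iexp (t / \<epsilon> * x) \<partial>lborel)"
    unfolding char_def by (subst integral_density) (auto simp: normal_density_nonneg)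
  also have "\<dots> = \<epsilon> *\<^sub>R (\<integral>l. std_normal_density (\<epsilon> * l) *\<^sub>R iexp (t / \<epsilon> * (\<epsilon> * l)) \<partial>lborel)"
    using e by (subst lborel_integral_real_affine[of \<epsilon> _ 0]) auto
  also have "(\<integral>l. std_normal_density (\<epsilon> * l) *\<^sub>R iexp (t / \<epsilon> * (\<epsilon> * l)) \<partial>lborel) =
      (\<integral>l. iexp (l * t) * of_real (std_normal_density (\<epsilon> * l)) \<partial>lborel)"
    using e by (intro Bochner_Integration.integral_cong) (auto simp: scaleR_conv_of_real field_simps)
  finally have "of_real (exp (- ((t / \<epsilon>)^2) / 2)) = \<epsilon> *\<^sub>R (\<integral>l. iexp (l * t) * of_real (std_normal_density (\<epsilon> * l)) \<partial>lborel)" .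
  moreover have "exp (- ((t / \<epsilon>)^2) / 2) = sqrt (2 * pi) * std_normal_density (t / \<epsilon>)"
    by (simp add: std_normal_density_def)
  ultimately have "\<epsilon> *\<^sub>R (\<integral>l. iexp (l * t) * of_real (std_normal_density (\<epsilon> * l)) \<partial>lborel) =
      \<epsilon> *\<^sub>R of_real (sqrt (2 * pi) / \<epsilon> * std_normal_density (t / \<epsilon>))"
    using e by (simp add: scaleR_conv_of_real)
  then show ?thesis using e by (simp only: scaleR_cancel_left) simp
qed

lemma integrable_std_normal_density: "integrable lborel std_normal_density"
  using integrable_normal_density[of 1 0] by simp

lemma integral_std_normal_density: "(\<integral>x. std_normal_density x \<partial>lborel) = 1"
  using integral_normal_density[of 1 0] by simp

text \<open>The Gaussian factor makes the double integral absolutely convergent, so Fubini applies,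
  and the inner transform is again Gaussian. \<open>Re_int\<close> uses this while integrability of
  the transform is still open.\<close>

lemma gaussian_summation:
  fixes f :: "real \<Rightarrow> complex"
  assumes f: "integrable lborel f" and e: "\<epsilon> > 0"
  shows "(\<integral>l. (\<integral>s. iexp (l * s) * f s \<partial>lborel) * iexp (- l * z) * of_real (std_normal_density (\<epsilon> * l)) \<partial>lborel) =
    of_real (sqrt (2 * pi)) * (\<integral>x. f (z + \<epsilon> * x) * of_real (std_normal_density x) \<partial>lborel)"
proof -
  have [measurable]: "f \<in> borel_measurable borel" using f by (auto dest: borel_measurable_integrable)
  define k where "k s l = iexp (l * (s - z)) * f s * of_real (std_normal_density (\<epsilon> * l))" for s l :: real
  have ni: "integrable lborel (\<lambda>l. std_normal_density (\<epsilon> * l))"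
    using lborel_integrable_real_affine[OF integrable_std_normal_density, of \<epsilon> 0] e by simp
  have nk: "norm (k s l) = norm (f s) * std_normal_density (\<epsilon> * l)" for s l
    by (simp add: k_def norm_mult normal_density_nonneg)
  have km: "case_prod k \<in> borel_measurable (lborel \<Otimes>\<^sub>M lborel)"
    unfolding k_def by measurable
  have int: "integrable (lborel \<Otimes>\<^sub>M lborel) (case_prod k)"
  proof (rule lborel_pair.Fubini_integrable[OF km])
    show "integrable lborel (\<lambda>s. \<integral>l. norm (case (s, l) of (s, l) \<Rightarrow> k s l) \<partial>lborel)"
      using f by (simp add: nk)
    show "AE s in lborel. integrable lborel (\<lambda>l. case (s, l) of (s, l) \<Rightarrow> k s l)"
    proof (rule AE_I2)
      fix s :: real
      have "integrable lborel (\<lambda>l. norm (f s) * std_normal_density (\<epsilon> * l))" using ni by simp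
      then show "integrable lborel (\<lambda>l. case (s, l) of (s, l) \<Rightarrow> k s l)"
      proof (rule Bochner_Integration.integrable_bound)
        show "(\<lambda>l. case (s, l) of (s, l) \<Rightarrow> k s l) \<in> borel_measurable lborel" unfolding prod.case k_def by measurable
      qed (simp add: nk normal_density_nonneg)
    qed
  qed
  have "(\<integral>l. (\<integral>s. iexp (l * s) * f s \<partial>lborel) * iexp (- l * z) * of_real (std_normal_density (\<epsilon> * l)) \<partial>lborel) =
      (\<integral>l. \<integral>s. k s l \<partial>lborel \<partial>lborel)"
  proof (rule Bochner_Integration.integral_cong[OF refl])
    fix l :: real
    let ?C = "iexp (- l * z) * of_real (std_normal_density (\<epsilon> * l)) :: complex"
    have *: "k s l = (iexp (l * s) * f s) * ?C" for s
    proof -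
      have "iexp (l * (s - z)) = iexp (l * s) * iexp (- l * z)"
        by (simp add: exp_add[symmetric] algebra_simps)
      then show ?thesis by (simp add: k_def mult_ac)
    qed
    have "(\<integral>s. k s l \<partial>lborel) = (\<integral>s. iexp (l * s) * f s \<partial>lborel) * ?C"
      unfolding * by (rule integral_mult_left_zero)
    then show "(\<integral>s. iexp (l * s) * f s \<partial>lborel) * iexp (- l * z) * of_real (std_normal_density (\<epsilon> * l)) = (\<integral>s. k s l \<partial>lborel)"
      by (simp only: mult.assoc)
  qed
  also have "\<dots> = (\<integral>s. \<integral>l. k s l \<partial>lborel \<partial>lborel)"
    by (rule lborel_pair.Fubini_integral[OF int])
  also have "\<dots> = (\<integral>s. f s * of_real (sqrt (2 * pi) / \<epsilon> * std_normal_density ((s - z) / \<epsilon>)) \<partial>lborel)"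
  proof (rule Bochner_Integration.integral_cong[OF refl])
    fix s :: real
    have "k s l = f s * (iexp (l * (s - z)) * of_real (std_normal_density (\<epsilon> * l)))" for l
      by (simp only: k_def mult_ac)
    then show "(\<integral>l. k s l \<partial>lborel) = f s * of_real (sqrt (2 * pi) / \<epsilon> * std_normal_density ((s - z) / \<epsilon>))"
      by (simp only: integral_mult_right_zero gaussian_fourier[OF e])
  qed
  also have "\<dots> = \<epsilon> *\<^sub>R (\<integral>x. f (z + \<epsilon> * x) * of_real (sqrt (2 * pi) / \<epsilon> * std_normal_density ((z + \<epsilon> * x - z) / \<epsilon>)) \<partial>lborel)"
    using e by (subst lborel_integral_real_affine[of \<epsilon> _ z]) auto
  also have "(\<integral>x. f (z + \<epsilon> * x) * of_real (sqrt (2 * pi) / \<epsilon> * std_normal_density ((z + \<epsilon> * x - z) / \<epsilon>)) \<partial>lborel) =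
      (\<integral>x. of_real (sqrt (2 * pi) / \<epsilon>) * (f (z + \<epsilon> * x) * of_real (std_normal_density x)) \<partial>lborel)"
    using e by (intro Bochner_Integration.integral_cong refl) (simp add: mult_ac)
  also have "\<epsilon> *\<^sub>R \<dots> = of_real (sqrt (2 * pi)) * (\<integral>x. f (z + \<epsilon> * x) * of_real (std_normal_density x) \<partial>lborel)"
    using e by (simp only: integral_mult_right_zero) (simp add: scaleR_conv_of_real)
  finally show ?thesis .
qed

text \<open>Let \<open>\<epsilon>\<close> tend to 0 in \<open>gaussian_summation\<close>. The left
  side is dominated by the integrable transform; the right side is dominated through
  \<open>B\<close> and converges by continuity at \<open>z\<close>. The value
  \<open>1 / sqrt (2 * pi)\<close> of the normal density at 0 turns the constant into
  \<open>2 * pi\<close>.\<close>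

lemma fourier_inversion:
  fixes f :: "real \<Rightarrow> complex"
  assumes f: "integrable lborel f" and bound: "\<And>x. norm (f x) \<le> B" and cont: "isCont f z"
    and fh: "integrable lborel (\<lambda>l. \<integral>s. iexp (l * s) * f s \<partial>lborel)"
  shows "(\<integral>l. (\<integral>s. iexp (l * s) * f s \<partial>lborel) * iexp (- l * z) \<partial>lborel) = 2 * pi * f z"
proof -
  let ?fh = "\<lambda>l. \<integral>s. iexp (l * s) * f s \<partial>lborel"
  have [measurable]: "f \<in> borel_measurable borel" using f by (auto dest: borel_measurable_integrable)
  have fhm [measurable]: "?fh \<in> borel_measurable borel" using fh by (auto dest: borel_measurable_integrable)
  define \<epsilon> where "\<epsilon> n = 1 / real (Suc n)" for n
  have e: "\<epsilon> n > 0" for n by (simp add: \<epsilon>_def)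
  have e0: "\<epsilon> \<longlonglongrightarrow> 0" unfolding \<epsilon>_def[abs_def] using LIMSEQ_inverse_real_of_nat by (simp add: inverse_eq_divide)
  have nb: "std_normal_density x \<le> std_normal_density 0" for x
    by (simp add: std_normal_density_def divide_right_mono)
  have n0: "std_normal_density 0 = 1 / sqrt (2 * pi)" by (subst std_normal_density_def) simp
  have nc: "(\<lambda>n. std_normal_density (\<epsilon> n * l)) \<longlonglongrightarrow> std_normal_density 0" for l
  proof -
    have "(\<lambda>n. 1 / sqrt (2 * pi) * exp (- (\<epsilon> n * l)\<^sup>2 / 2)) \<longlonglongrightarrow> 1 / sqrt (2 * pi) * exp (- (0 * l)\<^sup>2 / 2)"
      by (intro tendsto_intros e0) simp
    then show ?thesis by (simp add: std_normal_density_def)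
  qed
  have "(\<lambda>n. \<integral>l. ?fh l * iexp (- l * z) * of_real (std_normal_density (\<epsilon> n * l)) \<partial>lborel) \<longlonglongrightarrow>
      (\<integral>l. ?fh l * iexp (- l * z) * of_real (std_normal_density 0) \<partial>lborel)"
  proof (rule integral_dominated_convergence[where w="\<lambda>l. norm (?fh l) * std_normal_density 0"])
    show "(\<lambda>l. ?fh l * iexp (- l * z) * of_real (std_normal_density 0)) \<in> borel_measurable lborel" by measurable
    show "(\<lambda>l. ?fh l * iexp (- l * z) * of_real (std_normal_density (\<epsilon> n * l))) \<in> borel_measurable lborel" for n by measurable
    show "integrable lborel (\<lambda>l. norm (?fh l) * std_normal_density 0)" using fh by simp
    show "AE l in lborel. (\<lambda>n. ?fh l * iexp (- l * z) * of_real (std_normal_density (\<epsilon> n * l))) \<longlonglongrightarrow> ?fh l * iexp (- l * z) * of_real (std_normal_density 0)"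
      by (intro AE_I2 tendsto_mult tendsto_const tendsto_of_real nc)
    show "AE l in lborel. norm (?fh l * iexp (- l * z) * of_real (std_normal_density (\<epsilon> n * l))) \<le> norm (?fh l) * std_normal_density 0" for n
      using nb by (intro AE_I2) (simp add: norm_mult normal_density_nonneg mult_left_mono)
  qed
  moreover have "(\<lambda>n. of_real (sqrt (2 * pi)) * (\<integral>x. f (z + \<epsilon> n * x) * of_real (std_normal_density x) \<partial>lborel)) \<longlonglongrightarrow>
      of_real (sqrt (2 * pi)) * (\<integral>x. f z * of_real (std_normal_density x) \<partial>lborel)"
  proof (intro tendsto_mult tendsto_const, rule integral_dominated_convergence[where w="\<lambda>x. B * std_normal_density x"])
    show "(\<lambda>x. f z * of_real (std_normal_density x)) \<in> borel_measurable lborel" by measurable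
    show "(\<lambda>x. f (z + \<epsilon> n * x) * of_real (std_normal_density x)) \<in> borel_measurable lborel" for n by measurable
    show "integrable lborel (\<lambda>x. B * std_normal_density x)" using integrable_std_normal_density by simp
    show "AE x in lborel. (\<lambda>n. f (z + \<epsilon> n * x) * of_real (std_normal_density x)) \<longlonglongrightarrow> f z * of_real (std_normal_density x)"
    proof (rule AE_I2)
      fix x :: real
      have "(\<lambda>n. z + \<epsilon> n * x) \<longlonglongrightarrow> z + 0 * x" by (intro tendsto_intros e0)
      then have "(\<lambda>n. f (z + \<epsilon> n * x)) \<longlonglongrightarrow> f z" using isCont_tendsto_compose[OF cont] by simp
      then show "(\<lambda>n. f (z + \<epsilon> n * x) * of_real (std_normal_density x)) \<longlonglongrightarrow> f z * of_real (std_normal_density x)"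
        by (intro tendsto_mult tendsto_const)
    qed
    show "AE x in lborel. norm (f (z + \<epsilon> n * x) * of_real (std_normal_density x)) \<le> B * std_normal_density x" for n
      using bound by (intro AE_I2) (simp add: norm_mult normal_density_nonneg mult_right_mono)
  qed
  ultimately have "(\<integral>l. ?fh l * iexp (- l * z) * of_real (std_normal_density 0) \<partial>lborel) =
      of_real (sqrt (2 * pi)) * (\<integral>x. f z * of_real (std_normal_density x) \<partial>lborel)"
    unfolding gaussian_summation[OF f e] by (rule LIMSEQ_unique)
  moreover have "(\<integral>x. of_real (std_normal_density x) \<partial>lborel) = (1 :: complex)"
    by (simp add: integral_std_normal_density)
  ultimately have *: "(\<integral>l. ?fh l * iexp (- l * z) \<partial>lborel) * of_real (1 / sqrt (2 * pi)) = of_real (sqrt (2 * pi)) * f z"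
    by (simp only: n0 integral_mult_left_zero integral_mult_right_zero) simp
  define q where "q = sqrt (2 * pi)"
  have q: "q \<noteq> 0" "q * q = 2 * pi" by (simp_all add: q_def)
  have "(\<integral>l. ?fh l * iexp (- l * z) \<partial>lborel) = (\<integral>l. ?fh l * iexp (- l * z) \<partial>lborel) * of_real (1 / q) * of_real q"
    using q(1) by simp
  also have "\<dots> = of_real (q * q) * f z"
    using * unfolding q_def[symmetric] by (simp only: of_real_mult mult_ac)
  finally show ?thesis by (simp only: q(2))
qed

text \<open>Fundamental theorem of calculus with the antiderivative
  \<open>- exp (- (s * c)) / c\<close>; it is applied with
  \<open>c = \<alpha> + \<psi> l\<close>.\<close>

lemma integral_exp_decay:
  fixes c :: complex
  assumes c: "Re c > 0"
  shows "integrable lborel (\<lambda>s. indicator {0..} s *\<^sub>R exp (- (of_real s * c)))"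
    and "(\<integral>s. indicator {0..} s *\<^sub>R exp (- (of_real s * c)) \<partial>lborel) = 1 / c"
proof -
  have c0: "c \<noteq> 0" using c by auto
  have abs: "((\<lambda>s. exp (- Re c * s)) has_integral exp (- Re c * 0) / Re c) {0..}"
    by (rule has_integral_exp_minus_to_infinity[OF c])
  have nn: "(\<integral>\<^sup>+s. ennreal (exp (- Re c * s)) * indicator {0..} s \<partial>lborel) = ennreal (0 - (- exp (- Re c * 0) / Re c))"
  proof (rule nn_integral_FTC_atLeast)
    show "((\<lambda>s. - exp (- Re c * s) / Re c) \<longlongrightarrow> 0) at_top"
      using c by real_asymp
  qed (use c in \<open>auto intro!: derivative_eq_intros\<close>)
  show int: "integrable lborel (\<lambda>s. indicator {0..} s *\<^sub>R exp (- (of_real s * c)))"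
  proof (rule integrableI_bounded)
    have "(\<integral>\<^sup>+s. ennreal (norm (indicator {0..} s *\<^sub>R exp (- (of_real s * c)))) \<partial>lborel) =
        (\<integral>\<^sup>+s. ennreal (exp (- Re c * s)) * indicator {0..} s \<partial>lborel)"
      by (intro nn_integral_cong) (auto simp: indicator_def mult.commute)
    from trans[OF this nn] show "(\<integral>\<^sup>+s. ennreal (norm (indicator {0..} s *\<^sub>R exp (- (of_real s * c)))) \<partial>lborel) < \<infinity>"
      by (simp only: ennreal_less_top infinity_ennreal_def)
  qed measurable
  have "(LBINT s=0..\<infinity>. exp (- (of_real s * c))) = 0 - (- 1 / c)"
  proof (rule interval_integral_FTC_integrable)
    show "((\<lambda>s. - exp (- (of_real s * c)) / c) has_vector_derivative exp (- (of_real s * c))) (at s)" for s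
    proof -
      have "((\<lambda>z. - exp (- (z * c)) / c) has_field_derivative exp (- (of_real s * c))) (at (of_real s))"
        using c0 by (auto intro!: derivative_eq_intros)
      from has_vector_derivative_real_field[OF this] show ?thesis .
    qed
    have "((\<lambda>s. - exp (- (complex_of_real s * c)) / c) \<longlongrightarrow> - exp (- (of_real 0 * c)) / c) (at_right 0)"
      using c0 by (intro tendsto_intros) auto
    then show "(((\<lambda>s. - exp (- (complex_of_real s * c)) / c) \<circ> real_of_ereal) \<longlongrightarrow> - 1 / c) (at_right 0)"
      unfolding zero_ereal_def ereal_tendsto_simps1 by simp
    have "((\<lambda>s. exp (- Re c * s)) \<longlongrightarrow> 0) at_top"
      using c by real_asymp
    then have "((\<lambda>s. exp (- Re c * s) / norm c) \<longlongrightarrow> 0) at_top"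
      by (rule tendsto_divide_zero)
    then have "((\<lambda>s. - exp (- (complex_of_real s * c)) / c) \<longlongrightarrow> 0) at_top"
      by (rule Lim_null_comparison[rotated]) (auto simp: norm_divide mult.commute intro!: always_eventually)
    then show "(((\<lambda>s. - exp (- (complex_of_real s * c)) / c) \<circ> real_of_ereal) \<longlongrightarrow> 0) (at_left \<infinity>)"
      unfolding ereal_tendsto_simps1 .
    have "AE s in lborel. s \<noteq> (0 :: real)" by (rule AE_lborel_singleton)
    then show "set_integrable lborel (einterval 0 \<infinity>) (\<lambda>s. exp (- (complex_of_real s * c)))"
      unfolding set_integrable_def
      by (intro iffD1[OF integrable_cong_AE int]) (auto elim!: eventually_mono simp: indicator_def einterval_def zero_ereal_def)
  qed auto
  moreover have "(LBINT s=0..\<infinity>. exp (- (of_real s * c))) = (\<integral>s. indicator {0..} s *\<^sub>R exp (- (of_real s * c)) \<partial>lborel)"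
  proof -
    have "AE s in lborel. indicator (einterval 0 \<infinity>) s *\<^sub>R exp (- (of_real s * c)) = indicator {0..} s *\<^sub>R exp (- (of_real s * c))"
      using AE_lborel_singleton[of "0 :: real"]
      by eventually_elim (auto simp: indicator_def einterval_def zero_ereal_def)
    then show ?thesis
      unfolding interval_lebesgue_integral_def set_lebesgue_integral_def by (auto intro!: integral_cong_AE)
  qed
  ultimately show "(\<integral>s. indicator {0..} s *\<^sub>R exp (- (of_real s * c)) \<partial>lborel) = 1 / c" by simp
qed

section \<open>Finiteness and continuity of the potential density\<close>

context levy_local_times begin

section \<open>The occupation formula and the potential measure\<close>

lemma L_measurable_at:
  assumes "w \<in> space path_space" "f \<in> borel_measurable N" "g \<in> borel_measurable N"
  shows "(\<lambda>x. L (f x) (g x) w) \<in> borel_measurable N"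
  by (rule L_measurable[OF assms(2,3) measurable_const[OF assms(1)]])

lemma path_measurable_time:
  assumes "w \<in> space path_space"
  shows "(\<lambda>s. w (max 0 s)) \<in> borel_measurable borel"
  using path_eval_compose[of "\<lambda>s. s" borel "\<lambda>_. w"] assms by simp

lemma occupation_integral:
  assumes ws: "w \<in> space path_space" and t: "t \<ge> 0" and [measurable]: "f \<in> borel_measurable borel"
    and occ: "\<forall>t\<ge>0. distr (restrict_space lborel {0..t}) borel w = density lborel (\<lambda>y. ennreal (L y t w))"
  shows "(\<integral>\<^sup>+y. f y * ennreal (L y t w) \<partial>lborel) = (\<integral>\<^sup>+s. f (w (max 0 s)) * indicator {0..t} s \<partial>lborel)"
proof -
  have [measurable]: "(\<lambda>y. L y t w) \<in> borel_measurable borel"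
    by (rule L_measurable_at[OF ws]) auto
  have wm: "w \<in> restrict_space lborel {0..t} \<rightarrow>\<^sub>M borel"
  proof (subst measurable_cong[where g="\<lambda>s. w (max 0 s)"])
    show "(\<lambda>s. w (max 0 s)) \<in> restrict_space lborel {0..t} \<rightarrow>\<^sub>M borel"
      using path_measurable_time[OF ws] by (intro measurable_restrict_space1) simp
  qed (auto simp: space_restrict_space max_def)
  have "(\<integral>\<^sup>+y. f y * ennreal (L y t w) \<partial>lborel) = (\<integral>\<^sup>+y. f y \<partial>density lborel (\<lambda>y. ennreal (L y t w)))"
    by (simp add: nn_integral_density mult.commute)
  also have "\<dots> = (\<integral>\<^sup>+y. f y \<partial>distr (restrict_space lborel {0..t}) borel w)"
    using occ t by simp
  also have "\<dots> = (\<integral>\<^sup>+s. f (w s) \<partial>restrict_space lborel {0..t})"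
    by (rule nn_integral_distr[OF wm]) simp
  also have "\<dots> = (\<integral>\<^sup>+s. f (w s) * indicator {0..t} s \<partial>lborel)"
    by (rule nn_integral_restrict_space) simp
  also have "\<dots> = (\<integral>\<^sup>+s. f (w (max 0 s)) * indicator {0..t} s \<partial>lborel)"
    by (intro nn_integral_cong) (auto simp: indicator_def max_def)
  finally show ?thesis .
qed

lemma exponential_tail:
  assumes s: "s \<ge> 0"
  shows "(\<integral>\<^sup>+t. ennreal (exponential_density \<alpha> t) * indicator {s..} t \<partial>lborel) = ennreal (exp (- \<alpha> * s))"
proof -
  let ?e = "\<lambda>t. ennreal (exponential_density \<alpha> t)"
  have e: "?e (s + t) * indicator {s..} (s + t) = ennreal (exp (- \<alpha> * s)) * ?e t" for t
    using s alpha by (auto simp: exponential_density_def indicator_def ennreal_mult[symmetric] exp_add[symmetric] algebra_simps)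
  have "(\<integral>\<^sup>+t. ?e t * indicator {s..} t \<partial>lborel) = (\<integral>\<^sup>+t. ?e (s + t) * indicator {s..} (s + t) \<partial>lborel)"
    by (subst nn_integral_real_affine[of _ 1 s]) simp_all
  also have "\<dots> = ennreal (exp (- \<alpha> * s))"
    unfolding e by (simp add: nn_integral_cmult exponential_density_nn_integral)
  finally show ?thesis .
qed

text \<open>Tonelli twice: at each clock value \<open>t\<close> the occupation density turns levels
  into times \<open>s \<le> t\<close>, and the clock integrated over \<open>t \<ge> s\<close> leaves
  the weight \<open>exp (- \<alpha> * s)\<close>.\<close>

lemma nn_integral_F:
  assumes ws: "w \<in> space path_space" and [measurable]: "f \<in> borel_measurable borel"
    and occ: "\<forall>t\<ge>0. distr (restrict_space lborel {0..t}) borel w = density lborel (\<lambda>y. ennreal (L y t w))"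
  shows "(\<integral>\<^sup>+z. f z * F z w \<partial>lborel) = (\<integral>\<^sup>+s. f (w (max 0 s)) * (ennreal (exp (- \<alpha> * s)) * indicator {0..} s) \<partial>lborel)"
proof -
  let ?e = "\<lambda>t. ennreal (exponential_density \<alpha> t)"
  have [measurable]: "(\<lambda>x. L (fst x) (snd x) w) \<in> borel_measurable (lborel \<Otimes>\<^sub>M lborel)"
    by (rule L_measurable_at[OF ws]) auto
  have [measurable]: "(\<lambda>t. L z t w) \<in> borel_measurable borel" for z by (rule L_measurable_at[OF ws]) auto
  have [measurable]: "(\<lambda>z. L z t w) \<in> borel_measurable borel" for t by (rule L_measurable_at[OF ws]) auto
  note wm [measurable] = path_measurable_time[OF ws]
  have fw [measurable]: "(\<lambda>s. f (w (max 0 s))) \<in> borel_measurable borel" by (rule measurable_compose[OF wm]) simp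
  have "(\<integral>\<^sup>+z. f z * F z w \<partial>lborel) = (\<integral>\<^sup>+z. \<integral>\<^sup>+t. f z * (?e t * ennreal (L z t w)) \<partial>lborel \<partial>lborel)"
    unfolding F_def by (intro nn_integral_cong nn_integral_cmult[symmetric]) measurable
  also have "\<dots> = (\<integral>\<^sup>+t. \<integral>\<^sup>+z. f z * (?e t * ennreal (L z t w)) \<partial>lborel \<partial>lborel)"
    by (rule lborel_pair.Fubini'[symmetric]) (simp add: case_prod_beta')
  also have "\<dots> = (\<integral>\<^sup>+t. \<integral>\<^sup>+s. ?e t * (f (w (max 0 s)) * indicator {0..t} s) \<partial>lborel \<partial>lborel)"
  proof (rule nn_integral_cong)
    fix t :: real
    show "(\<integral>\<^sup>+z. f z * (?e t * ennreal (L z t w)) \<partial>lborel) = (\<integral>\<^sup>+s. ?e t * (f (w (max 0 s)) * indicator {0..t} s) \<partial>lborel)"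
    proof (cases "t \<ge> 0")
      case True
      have "(\<integral>\<^sup>+z. f z * (?e t * ennreal (L z t w)) \<partial>lborel) = ?e t * (\<integral>\<^sup>+z. f z * ennreal (L z t w) \<partial>lborel)"
        by (subst nn_integral_cmult[symmetric]) (auto simp: mult.left_commute)
      also have "\<dots> = ?e t * (\<integral>\<^sup>+s. f (w (max 0 s)) * indicator {0..t} s \<partial>lborel)"
        using occupation_integral[OF ws True assms(2) occ] by simp
      finally show ?thesis by (simp add: nn_integral_cmult)
    qed (simp add: exponential_density_def)
  qed
  also have "\<dots> = (\<integral>\<^sup>+s. \<integral>\<^sup>+t. ?e t * (f (w (max 0 s)) * indicator {0..t} s) \<partial>lborel \<partial>lborel)"
  proof (rule lborel_pair.Fubini')
    have "(\<lambda>x. ?e (snd x) * (f (w (max 0 (fst x))) * (if 0 \<le> fst x \<and> fst x \<le> snd x then 1 else 0))) \<in> borel_measurable (lborel \<Otimes>\<^sub>M lborel)"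
      using measurable_compose[OF measurable_fst fw, of "lborel :: real measure"] by measurable
    then show "(\<lambda>(s, t). ?e t * (f (w (max 0 s)) * indicator {0..t} s)) \<in> borel_measurable (lborel \<Otimes>\<^sub>M lborel)"
      by (simp add: case_prod_beta' indicator_def of_bool_def)
  qed
  also have "\<dots> = (\<integral>\<^sup>+s. f (w (max 0 s)) * (ennreal (exp (- \<alpha> * s)) * indicator {0..} s) \<partial>lborel)"
  proof (rule nn_integral_cong)
    fix s :: real
    show "(\<integral>\<^sup>+t. ?e t * (f (w (max 0 s)) * indicator {0..t} s) \<partial>lborel) = f (w (max 0 s)) * (ennreal (exp (- \<alpha> * s)) * indicator {0..} s)"
    proof (cases "s \<ge> 0")
      case True
      have "(\<integral>\<^sup>+t. ?e t * (f (w (max 0 s)) * indicator {0..t} s) \<partial>lborel) = (\<integral>\<^sup>+t. f (w (max 0 s)) * (?e t * indicator {s..} t) \<partial>lborel)"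
        using True by (intro nn_integral_cong) (auto simp: indicator_def mult.commute)
      also have "\<dots> = f (w (max 0 s)) * ennreal (exp (- \<alpha> * s))"
        by (simp add: nn_integral_cmult exponential_tail[OF True])
      finally show ?thesis using True by simp
    qed simp
  qed
  finally show ?thesis .
qed

lemma path_pair_measurable:
  assumes "f \<in> borel_measurable borel"
  shows "(\<lambda>(s, w). f (w (max 0 s))) \<in> borel_measurable (borel \<Otimes>\<^sub>M path_space)"
  using measurable_compose[OF path_joint_measurable assms] by (simp add: case_prod_beta')

text \<open>Identifies the expected local time as a density of the \<alpha>-potential measure: the
  right side is the expected discounted time integral of \<open>f\<close> along the process.\<close>

lemma nn_integral_u:
  assumes f [measurable]: "f \<in> borel_measurable borel"
  shows "(\<integral>\<^sup>+z. f z * u x z \<partial>lborel) =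
    (\<integral>\<^sup>+s. (ennreal (exp (- \<alpha> * s)) * indicator {0..} s) * (\<integral>\<^sup>+w. f (w (max 0 s)) \<partial>P x) \<partial>lborel)"
proof -
  interpret Q: pair_sigma_finite lborel "P x" ..
  have [measurable]: "(\<lambda>w. f (w (max 0 s))) \<in> borel_measurable path_space" for s
    by (rule measurable_compose[OF path_eval_measurable]) auto
  have pm: "(\<lambda>(s, w). f (w (max 0 s))) \<in> borel_measurable (lborel \<Otimes>\<^sub>M P x)"
    using path_pair_measurable[OF f] by (simp cong: measurable_cong_sets sets_pair_measure_cong)
  have "(\<integral>\<^sup>+z. f z * u x z \<partial>lborel) = (\<integral>\<^sup>+z. \<integral>\<^sup>+w. f z * F z w \<partial>P x \<partial>lborel)"
    unfolding u_def by (intro nn_integral_cong nn_integral_cmult[symmetric]) measurable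
  also have "\<dots> = (\<integral>\<^sup>+w. \<integral>\<^sup>+z. f z * F z w \<partial>lborel \<partial>P x)"
    by (rule Q.Fubini'[symmetric]) measurable
  also have "\<dots> = (\<integral>\<^sup>+w. \<integral>\<^sup>+s. f (w (max 0 s)) * (ennreal (exp (- \<alpha> * s)) * indicator {0..} s) \<partial>lborel \<partial>P x)"
  proof (rule nn_integral_cong_AE, rule AE_mp[OF L_occupation[of x]], rule AE_I2, rule impI)
    fix w assume "w \<in> space (P x)"
      and "\<forall>t\<ge>0. distr (restrict_space lborel {0..t}) borel w = density lborel (\<lambda>y. ennreal (L y t w))"
    then show "(\<integral>\<^sup>+z. f z * F z w \<partial>lborel) = (\<integral>\<^sup>+s. f (w (max 0 s)) * (ennreal (exp (- \<alpha> * s)) * indicator {0..} s) \<partial>lborel)"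
      by (intro nn_integral_F f) (simp_all only: space_P)
  qed
  also have "\<dots> = (\<integral>\<^sup>+s. \<integral>\<^sup>+w. f (w (max 0 s)) * (ennreal (exp (- \<alpha> * s)) * indicator {0..} s) \<partial>P x \<partial>lborel)"
  proof (rule Q.Fubini')
    show "(\<lambda>(s, w). f (w (max 0 s)) * (ennreal (exp (- \<alpha> * s)) * indicator {0..} s)) \<in> borel_measurable (lborel \<Otimes>\<^sub>M P x)"
      using pm unfolding case_prod_beta' by (intro borel_measurable_times_ennreal) (auto cong: measurable_cong_sets sets_pair_measure_cong)
  qed
  also have "\<dots> = (\<integral>\<^sup>+s. (ennreal (exp (- \<alpha> * s)) * indicator {0..} s) * (\<integral>\<^sup>+w. f (w (max 0 s)) \<partial>P x) \<partial>lborel)"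
    by (intro nn_integral_cong) (simp add: nn_integral_multc mult.commute)
  finally show ?thesis .
qed

lemma nn_integral_exp: "(\<integral>\<^sup>+s. ennreal (exp (- \<alpha> * s)) * indicator {0..} s \<partial>lborel) = ennreal (1 / \<alpha>)"
proof -
  have "(\<integral>\<^sup>+s. ennreal (exp (- \<alpha> * s)) * indicator {0..} s \<partial>lborel) = (\<integral>\<^sup>+s. ennreal (1 / \<alpha>) * ennreal (exponential_density \<alpha> s) \<partial>lborel)"
    using alpha by (intro nn_integral_cong) (auto simp: indicator_def exponential_density_def ennreal_mult[symmetric] mult.commute)
  then show ?thesis by (simp add: nn_integral_cmult exponential_density_nn_integral)
qed

lemma nn_integral_u_total: "(\<integral>\<^sup>+z. u x z \<partial>lborel) = ennreal (1 / \<alpha>)"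
  using nn_integral_u[of "\<lambda>_. 1" x] nn_integral_exp P.emeasure_space_1[of x] by simp

section \<open>Finiteness and supermultiplicativity of the density\<close>

lemma u_le_diagonal: "u 0 s \<le> u 0 0"
proof -
  obtain c where c: "c \<le> 1" "u 0 s = c * u s s" by (rule u_hitting)
  have "u s s = u 0 0" using u_homogeneous[of s s] by simp
  then show ?thesis using c mult_right_mono[OF c(1), of "u 0 0"] by simp
qed

text \<open>If \<open>u(0,0)\<close> were infinite, then \<open>u(0,\<cdot>)\<close> would only take the values \<open>0\<close> and \<open>\<infinity>\<close>, contradicting its
  finite positive total mass.\<close>

lemma u_diagonal_finite: "u 0 0 < \<top>"
proof (rule ccontr)
  assume "\<not> u 0 0 < \<top>"
  then have top: "u s s = \<top>" for s using u_homogeneous[of s s] by (simp add: less_top[symmetric])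
  have cases: "u 0 s = 0 \<or> u 0 s = \<top>" for s
  proof -
    obtain c where "c \<le> 1" "u 0 s = c * u s s" by (rule u_hitting)
    then show ?thesis by (cases "c = 0") (auto simp: top ennreal_mult_top)
  qed
  have "AE s in lborel. u 0 s \<noteq> \<infinity>"
    by (rule nn_integral_PInf_AE) (use nn_integral_u_total[of 0] in auto)
  then have "AE s in lborel. u 0 s = 0"
    by eventually_elim (use cases in auto)
  then have "(\<integral>\<^sup>+s. u 0 s \<partial>lborel) = (\<integral>\<^sup>+s. 0 \<partial>(lborel :: real measure))" by (rule nn_integral_cong_AE)
  then show False using nn_integral_u_total[of 0] alpha by simp
qed

definition G :: "real \<Rightarrow> real" where "G s = enn2real (u 0 s)"

lemma ennreal_G: "ennreal (G s) = u 0 s"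
  unfolding G_def using le_less_trans[OF u_le_diagonal u_diagonal_finite] by simp

lemma u_eq_G: "u x y = ennreal (G (y - x))"
  using u_homogeneous[of x y] ennreal_G by simp

lemma G_measurable [measurable]: "G \<in> borel_measurable borel"
  unfolding G_def by measurable

lemma G_nonneg: "0 \<le> G s" by (simp add: G_def)

lemma G_le: "G s \<le> G 0"
  using u_le_diagonal[of s] G_nonneg[of 0] by (simp add: ennreal_G[symmetric])

lemma G_integrable: "integrable lborel G"
  by (rule integrableI_nonneg) (use nn_integral_u_total[of 0] in \<open>auto simp: G_nonneg ennreal_G\<close>)

lemma G_pos: "G 0 > 0"
proof (rule ccontr)
  assume "\<not> G 0 > 0"
  then have "G s = 0" for s using G_le[of s] G_nonneg[of s] by simp
  then have "(\<integral>\<^sup>+s. u 0 s \<partial>lborel) = 0" by (simp add: ennreal_G[symmetric])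
  then show False using nn_integral_u_total[of 0] alpha by simp
qed

text \<open>The constant of \<open>u_hitting\<close> at level \<open>s\<close> is
  \<open>c = G s / G 0\<close>; it is inserted into the inequality at \<open>z = s + r\<close>,
  which is then multiplied by \<open>G 0\<close>.\<close>

lemma G_mult: "G s * G r \<le> G 0 * G (s + r)"
proof -
  obtain c where c: "c \<le> 1" "u 0 s = c * u s s" "\<And>z. c * u s z \<le> u 0 z" using u_hitting[of 0 s] by metis
  have "u 0 s * u 0 r = u 0 0 * (c * u s (s + r))"
    using c(2) u_homogeneous[of s s] u_homogeneous[of s "s + r"] by (simp add: mult_ac)
  also have "\<dots> \<le> u 0 0 * u 0 (s + r)" by (intro mult_left_mono c(3)) simp
  finally show ?thesis using G_nonneg by (simp add: ennreal_G[symmetric] ennreal_mult[symmetric])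
qed

section \<open>Continuity of the density\<close>

lemma path_shift_measurable: "s \<ge> 0 \<Longrightarrow> path_shift s \<in> path_space \<rightarrow>\<^sub>M path_space"
proof -
  assume s: "s \<ge> 0"
  have 1: "(\<lambda>w. w s) \<in> borel_measurable path_space" by (rule path_eval_measurable[OF s])
  have "(\<lambda>w. path_translate (w s) (path_incr s w)) \<in> path_space \<rightarrow>\<^sub>M path_space"
    using measurable_compose[OF measurable_Pair[OF 1 path_incr_measurable1[of s]] path_translate_measurable] by simp
  moreover have "(\<lambda>w. path_translate (w s) (path_incr s w)) = path_shift s"
    by (rule ext) (rule path_shift_eq[OF s, symmetric])
  ultimately show ?thesis by (simp only:)
qed

text \<open>Expected discounted local time at 0 collected after time \<open>s\<close>, with the
  discount restarted at \<open>s\<close>; see \<open>V_eq\<close>.\<close>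

definition V :: "real \<Rightarrow> real \<Rightarrow> ennreal" where
  "V s x = (\<integral>\<^sup>+w. u (w (max 0 s)) 0 \<partial>P x)"

lemma V_eq:
  assumes "s \<ge> 0"
  shows "(\<integral>\<^sup>+w. F 0 (path_shift s w) \<partial>P x) = V s x"
  unfolding V_def u_def using nn_integral_shift[OF assms, of "F 0" x] assms by (simp add: max_absorb2)

text \<open>Forgetting the local time collected before \<open>s\<close> can only lower the
  total.\<close>

lemma V_le:
  assumes s: "s \<ge> 0"
  shows "ennreal (exp (- \<alpha> * s)) * V s x \<le> u x 0"
proof -
  have [measurable]: "path_shift s \<in> path_space \<rightarrow>\<^sub>M path_space" by (rule path_shift_measurable[OF s])
  have "ennreal (exp (- \<alpha> * s)) * V s x = (\<integral>\<^sup>+w. ennreal (exp (- \<alpha> * s)) * F 0 (path_shift s w) \<partial>P x)"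
    unfolding V_eq[OF s, symmetric] by (rule nn_integral_cmult[symmetric]) measurable
  also have "\<dots> \<le> (\<integral>\<^sup>+w. F 0 w \<partial>P x)"
    by (rule nn_integral_mono_AE, rule AE_mp[OF AE_good[where x=x and y=0]], rule AE_I2, rule impI) (rule F_shift_le[OF _ s])
  finally show ?thesis by (simp add: u_def)
qed

text \<open>As a function of \<open>z\<close> this is the convolution kernel of
  \<open>V_average\<close>; at \<open>z = 0\<close> it measures the loss from dropping an initial
  stretch of length \<open>d\<close>.\<close>

definition \<kappa> :: "real \<Rightarrow> real \<Rightarrow> ennreal" where
  "\<kappa> d z = (\<integral>\<^sup>+w. ennreal (L z d w) \<partial>P 0)"

text \<open>Before \<open>s\<close> at most \<open>L 0 d\<close> is collected. It enters once for
  clocks that ring before \<open>s\<close> and once for the later ones, whence the factor 2.\<close>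

lemma V_ge:
  assumes s: "0 \<le> s" "s \<le> d"
  shows "u 0 0 \<le> 2 * \<kappa> d 0 + V s 0"
proof -
  have [measurable]: "path_shift s \<in> path_space \<rightarrow>\<^sub>M path_space" by (rule path_shift_measurable[OF s(1)])
  have "u 0 0 \<le> (\<integral>\<^sup>+w. 2 * ennreal (L 0 d w) + F 0 (path_shift s w) \<partial>P 0)"
    unfolding u_def
  proof (rule nn_integral_mono_AE, rule AE_mp[OF AE_good[where x=0 and y=0]], rule AE_I2, rule impI)
    fix w assume w: "good 0 w"
    have Ls: "ennreal (L 0 t w) \<le> ennreal (L 0 d w)" if "0 \<le> t" "t \<le> s" for t
      using that s by (intro ennreal_leI good_mono[OF w]) auto
    have "(\<integral>\<^sup>+t. ennreal (exponential_density \<alpha> t) * ennreal (L 0 t w) * indicator {..<s} t \<partial>lborel)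
        \<le> (\<integral>\<^sup>+t. ennreal (exponential_density \<alpha> t) * ennreal (L 0 d w) \<partial>lborel)"
    proof (rule nn_integral_mono)
      fix t
      show "ennreal (exponential_density \<alpha> t) * ennreal (L 0 t w) * indicator {..<s} t \<le> ennreal (exponential_density \<alpha> t) * ennreal (L 0 d w)"
        using Ls[of t] by (cases "0 \<le> t \<and> t < s") (auto simp: indicator_def exponential_density_def intro!: mult_left_mono)
    qed
    also have "\<dots> = ennreal (L 0 d w)"
      by (simp add: nn_integral_multc exponential_density_nn_integral)
    finally have 1: "(\<integral>\<^sup>+t. ennreal (exponential_density \<alpha> t) * ennreal (L 0 t w) * indicator {..<s} t \<partial>lborel) \<le> ennreal (L 0 d w)" .
    have "ennreal (exp (- \<alpha> * s)) \<le> 1" using s alpha by (simp add: ennreal_le_1)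
    then have "ennreal (exp (- \<alpha> * s)) * (ennreal (L 0 s w) + F 0 (path_shift s w)) \<le> 1 * (ennreal (L 0 d w) + F 0 (path_shift s w))"
      using Ls[of s] s by (intro mult_mono add_right_mono) auto
    then have "F 0 w \<le> ennreal (L 0 d w) + (ennreal (L 0 d w) + F 0 (path_shift s w))"
      unfolding F_decompose[OF w s(1)] using 1 by (intro add_mono) auto
    then show "F 0 w \<le> 2 * ennreal (L 0 d w) + F 0 (path_shift s w)"
      by (simp add: mult_2 add.assoc)
  qed
  also have "\<dots> = 2 * \<kappa> d 0 + V s 0"
    unfolding \<kappa>_def V_eq[OF s(1), symmetric] by (simp add: nn_integral_add nn_integral_cmult)
  finally show ?thesis .
qed

text \<open>The left side is a convolution of a bounded and an integrable function, hence continuous in \<open>x\<close>;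
  this is what makes \<open>G\<close> lower semicontinuous at \<open>0\<close>.\<close>

lemma V_average:
  assumes d: "d \<ge> 0"
  shows "(\<integral>\<^sup>+z. u (x + z) 0 * \<kappa> d z \<partial>lborel) = (\<integral>\<^sup>+s. V s x * indicator {0..d} s \<partial>lborel)"
proof -
  interpret Q: pair_sigma_finite lborel "P 0" ..
  have um [measurable]: "(\<lambda>z. u (x + z) 0) \<in> borel_measurable borel" by measurable
  have "(\<integral>\<^sup>+z. u (x + z) 0 * \<kappa> d z \<partial>lborel) = (\<integral>\<^sup>+z. \<integral>\<^sup>+w. u (x + z) 0 * ennreal (L z d w) \<partial>P 0 \<partial>lborel)"
    unfolding \<kappa>_def by (intro nn_integral_cong nn_integral_cmult[symmetric]) measurable
  also have "\<dots> = (\<integral>\<^sup>+w. \<integral>\<^sup>+z. u (x + z) 0 * ennreal (L z d w) \<partial>lborel \<partial>P 0)"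
    by (rule Q.Fubini'[symmetric]) measurable
  also have "\<dots> = (\<integral>\<^sup>+w. \<integral>\<^sup>+s. u (x + w (max 0 s)) 0 * indicator {0..d} s \<partial>lborel \<partial>P 0)"
  proof (rule nn_integral_cong_AE, rule AE_mp[OF L_occupation[of 0]], rule AE_I2, rule impI)
    fix w assume "w \<in> space (P 0)"
      and "\<forall>t\<ge>0. distr (restrict_space lborel {0..t}) borel w = density lborel (\<lambda>y. ennreal (L y t w))"
    then show "(\<integral>\<^sup>+z. u (x + z) 0 * ennreal (L z d w) \<partial>lborel) = (\<integral>\<^sup>+s. u (x + w (max 0 s)) 0 * indicator {0..d} s \<partial>lborel)"
      using occupation_integral[OF _ d um, of w] by simp
  qed
  also have "\<dots> = (\<integral>\<^sup>+s. \<integral>\<^sup>+w. u (x + w (max 0 s)) 0 * indicator {0..d} s \<partial>P 0 \<partial>lborel)"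
  proof (rule Q.Fubini')
    show "(\<lambda>(s, w). u (x + w (max 0 s)) 0 * indicator {0..d} s) \<in> borel_measurable (lborel \<Otimes>\<^sub>M P 0)"
      using path_pair_measurable[OF um] unfolding case_prod_beta'
      by (intro borel_measurable_times_ennreal) (auto cong: measurable_cong_sets sets_pair_measure_cong)
  qed
  also have "\<dots> = (\<integral>\<^sup>+s. V s x * indicator {0..d} s \<partial>lborel)"
  proof (rule nn_integral_cong)
    fix s :: real
    have em: "(\<lambda>w. w (max 0 s)) \<in> borel_measurable path_space" by (rule path_eval_measurable) simp
    have m [measurable]: "(\<lambda>w. u (w (max 0 s)) 0) \<in> borel_measurable path_space"
      using em by measurable
    have [measurable]: "(\<lambda>w. u (x + w (max 0 s)) 0) \<in> borel_measurable path_space"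
      by (rule measurable_compose[OF em um])
    have "V s x = (\<integral>\<^sup>+w. u (path_translate x w (max 0 s)) 0 \<partial>P 0)"
      unfolding V_def using nn_integral_translate[OF m, of x 0] by simp
    also have "\<dots> = (\<integral>\<^sup>+w. u (x + w (max 0 s)) 0 \<partial>P 0)" by (simp add: path_translate_def)
    finally show "(\<integral>\<^sup>+w. u (x + w (max 0 s)) 0 * indicator {0..d} s \<partial>P 0) = V s x * indicator {0..d} s"
      by (simp add: nn_integral_multc)
  qed
  finally show ?thesis .
qed

text \<open>Up to time 1 the discount is at least \<open>exp (- \<alpha>)\<close>. This supplies the
  integrable majorant under which expected local time over short times tends to 0.\<close>

lemma L_le_F:
  assumes w: "good y w" and r: "0 \<le> r" "r \<le> 1"
  shows "ennreal (L y r w) \<le> ennreal (exp \<alpha>) * F y w"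
proof -
  let ?E = "ennreal (exp (- \<alpha> * r))"
  have "?E * ennreal (L y r w) \<le> ?E * (ennreal (L y r w) + F y (path_shift r w))"
    by (intro mult_left_mono) auto
  also have "\<dots> \<le> F y w" unfolding F_decompose[OF w r(1)] by (rule add_increasing) auto
  finally have "ennreal (exp \<alpha>) * (?E * ennreal (L y r w)) \<le> ennreal (exp \<alpha>) * F y w"
    by (rule mult_left_mono) simp
  moreover have "1 * ennreal (L y r w) \<le> ennreal (exp \<alpha>) * ?E * ennreal (L y r w)"
  proof (rule mult_right_mono)
    have "\<alpha> * r \<le> \<alpha>" using alpha r(2) by simp
    then have "1 \<le> exp (\<alpha> + - \<alpha> * r)" by simp
    then show "1 \<le> ennreal (exp \<alpha>) * ?E"
      by (simp only: ennreal_mult[symmetric] exp_ge_zero exp_add[symmetric]) simp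
  qed simp
  ultimately show ?thesis by (simp add: mult.assoc)
qed

text \<open>The average of \<open>V s x\<close> over \<open>s\<close> in \<open>{0..d}\<close> is
  continuous in \<open>x\<close> and at most \<open>exp (\<alpha> * d) * G (- x)\<close>; at
  \<open>x = 0\<close> it is at least \<open>G 0 - 2 * l\<close>, where \<open>l\<close> is the
  expected local time at 0 up to \<open>d\<close>. For small \<open>d\<close> both losses are small,
  so \<open>G\<close> cannot drop far below \<open>G 0\<close> near 0.\<close>

lemma G_lower:
  assumes "\<epsilon> > 0"
  shows "\<forall>\<^sub>F x in nhds 0. G x > G 0 - \<epsilon>"
proof -
  define d where "d n = 1 / real (Suc n)" for n
  have d: "0 < d n" "d n \<le> 1" for n by (auto simp: d_def)
  have d0: "d \<longlonglongrightarrow> 0" unfolding d_def[abs_def] using LIMSEQ_inverse_real_of_nat by (simp add: inverse_eq_divide)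
  have F0: "(\<integral>\<^sup>+w. ennreal (exp \<alpha>) * F 0 w \<partial>P 0) < \<infinity>"
    using u_diagonal_finite unfolding u_def by (subst nn_integral_cmult) (auto simp: ennreal_mult_less_top)
  \<comment> \<open>Local time at 0 is continuous and starts at 0, so its expectation over shrinking
    time intervals tends to 0; finiteness of \<open>u 0 0\<close> enters through the
    majorant.\<close>
  have \<kappa>_lim: "(\<lambda>n. \<kappa> (d n) 0) \<longlonglongrightarrow> (\<integral>\<^sup>+w. 0 \<partial>P 0)"
    unfolding \<kappa>_def
  proof (rule nn_integral_dominated_convergence[where w="\<lambda>w. ennreal (exp \<alpha>) * F 0 w"])
    show "(\<integral>\<^sup>+w. ennreal (exp \<alpha>) * F 0 w \<partial>P 0) < \<infinity>" by (rule F0)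
    show "AE w in P 0. ennreal (L 0 (d n) w) \<le> ennreal (exp \<alpha>) * F 0 w" for n
    proof (rule AE_mp[OF AE_good[where x=0 and y=0]], rule AE_I2, rule impI)
      fix w assume w: "good 0 w"
      show "ennreal (L 0 (d n) w) \<le> ennreal (exp \<alpha>) * F 0 w"
        by (rule L_le_F[OF w less_imp_le[OF d(1)] d(2)])
    qed
    show "AE w in P 0. (\<lambda>n. ennreal (L 0 (d n) w)) \<longlonglongrightarrow> 0"
    proof (rule AE_mp[OF AE_good[where x=0 and y=0]], rule AE_I2, rule impI)
      fix w assume w: "good 0 w"
      have "(\<lambda>n. L 0 (d n) w) \<longlonglongrightarrow> L 0 0 w"
        using w d by (intro continuous_on_tendsto_compose[OF _ d0]) (auto simp: good_def less_imp_le)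
      then have "(\<lambda>n. ennreal (L 0 (d n) w)) \<longlonglongrightarrow> ennreal (L 0 0 w)" by (rule tendsto_ennrealI)
      then show "(\<lambda>n. ennreal (L 0 (d n) w)) \<longlonglongrightarrow> 0" using w by (simp add: good_def)
    qed
  qed measurable
  have \<kappa>0_fin: "\<kappa> (d n) 0 < \<top>" for n
  proof -
    have "\<kappa> (d n) 0 \<le> (\<integral>\<^sup>+w. ennreal (exp \<alpha>) * F 0 w \<partial>P 0)"
      unfolding \<kappa>_def
    proof (rule nn_integral_mono_AE, rule AE_mp[OF AE_good[where x=0 and y=0]], rule AE_I2, rule impI)
      fix w assume w: "good 0 w"
      show "ennreal (L 0 (d n) w) \<le> ennreal (exp \<alpha>) * F 0 w"
        by (rule L_le_F[OF w less_imp_le[OF d(1)] d(2)])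
    qed
    then show ?thesis using F0 by (simp add: le_less_trans)
  qed
  define l where "l n = enn2real (\<kappa> (d n) 0)" for n
  have l: "ennreal (l n) = \<kappa> (d n) 0" "l n \<ge> 0" for n using \<kappa>0_fin by (auto simp: l_def)
  have l0: "l \<longlonglongrightarrow> 0"
  proof (rule tendsto_ennrealD)
    have "(\<lambda>n. \<kappa> (d n) 0) \<longlonglongrightarrow> 0" using \<kappa>_lim by simp
    then show "(\<lambda>n. ennreal (l n)) \<longlonglongrightarrow> ennreal 0" unfolding l(1) ennreal_0 .
  qed (use l(2) in auto)
  have "(\<lambda>n. exp (- \<alpha> * d n) * (G 0 - 2 * l n)) \<longlonglongrightarrow> exp (- \<alpha> * 0) * (G 0 - 2 * 0)"
    by (intro tendsto_intros d0 l0)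
  then have "(\<lambda>n. exp (- \<alpha> * d n) * (G 0 - 2 * l n)) \<longlonglongrightarrow> G 0" by simp
  then have "\<forall>\<^sub>F n in sequentially. exp (- \<alpha> * d n) * (G 0 - 2 * l n) > G 0 - \<epsilon>"
    using assms by (intro order_tendstoD(1)) auto
  then obtain n where n: "exp (- \<alpha> * d n) * (G 0 - 2 * l n) > G 0 - \<epsilon>"
    by (auto simp: eventually_sequentially)
  \<comment> \<open>A real version of the kernel; it agrees with \<open>\<kappa>\<close> almost
    everywhere, because the total mass is the finite time \<open>d n\<close>.\<close>
  define k where "k z = enn2real (\<kappa> (d n) z)" for z
  have \<kappa>m [measurable]: "\<kappa> (d n) \<in> borel_measurable borel" unfolding \<kappa>_def by measurable
  have \<kappa>_total: "(\<integral>\<^sup>+z. \<kappa> (d n) z \<partial>lborel) = ennreal (d n)"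
  proof -
    interpret Q: pair_sigma_finite lborel "P 0" ..
    have "(\<integral>\<^sup>+z. \<kappa> (d n) z \<partial>lborel) = (\<integral>\<^sup>+w. \<integral>\<^sup>+z. ennreal (L z (d n) w) \<partial>lborel \<partial>P 0)"
      unfolding \<kappa>_def by (rule Q.Fubini'[symmetric]) measurable
    also have "\<dots> = (\<integral>\<^sup>+w. ennreal (d n) \<partial>P 0)"
    proof (rule nn_integral_cong_AE, rule AE_mp[OF L_occupation[of 0]], rule AE_I2, rule impI)
      fix w assume "w \<in> space (P 0)"
        and "\<forall>t\<ge>0. distr (restrict_space lborel {0..t}) borel w = density lborel (\<lambda>y. ennreal (L y t w))"
      then show "(\<integral>\<^sup>+z. ennreal (L z (d n) w) \<partial>lborel) = ennreal (d n)"
        using occupation_integral[of w "d n" "\<lambda>_. 1"] d(1)[of n] by simp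
    qed
    finally show ?thesis using P.emeasure_space_1[of 0] by simp
  qed
  have AE_k: "AE z in lborel. ennreal (k z) = \<kappa> (d n) z"
  proof -
    have "AE z in lborel. \<kappa> (d n) z \<noteq> \<infinity>"
      by (rule nn_integral_PInf_AE) (use \<kappa>_total in auto)
    then show ?thesis by eventually_elim (simp add: k_def less_top)
  qed
  have km [measurable]: "k \<in> borel_measurable borel" unfolding k_def by measurable
  have ki: "integrable lborel k"
  proof (rule integrableI_nonneg)
    have "(\<integral>\<^sup>+z. ennreal (k z) \<partial>lborel) = ennreal (d n)"
      unfolding \<kappa>_total[symmetric] by (rule nn_integral_cong_AE[OF AE_k])
    then show "(\<integral>\<^sup>+z. ennreal (k z) \<partial>lborel) < \<infinity>" by simp
  qed (auto simp: k_def)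
  \<comment> \<open>By homogeneity \<open>u (x + z) 0\<close> is \<open>G (- (x + z))\<close>, so
    the time integral of \<open>V\<close> is a convolution. It is not yet divided by
    \<open>d n\<close>.\<close>
  define C where "C x = (\<integral>z. G (- (x + z)) * k z \<partial>lborel)" for x
  have Gb: "\<bar>G (- x)\<bar> \<le> G 0" for x using G_le[of "- x"] G_nonneg[of "- x"] by simp
  have C_cont: "continuous_on UNIV C"
    unfolding C_def using continuous_convolution[of "\<lambda>x. G (- x)", OF _ Gb ki] by simp
  have C_int: "integrable lborel (\<lambda>z. G (- (x + z)) * k z)" for x
    using integrable_shift_mult[of "\<lambda>x. G (- x)", OF _ Gb ki] by simp
  have C_enn: "ennreal (C x) = (\<integral>\<^sup>+s. V s x * indicator {0..d n} s \<partial>lborel)" for x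
  proof -
    have "ennreal (C x) = (\<integral>\<^sup>+z. ennreal (G (- (x + z)) * k z) \<partial>lborel)"
      unfolding C_def by (rule nn_integral_eq_integral[symmetric, OF C_int]) (simp add: G_nonneg k_def)
    also have "\<dots> = (\<integral>\<^sup>+z. u (x + z) 0 * \<kappa> (d n) z \<partial>lborel)"
      by (rule nn_integral_cong_AE, rule AE_mp[OF AE_k], rule AE_I2)
        (simp add: u_eq_G[of _ 0] ennreal_mult G_nonneg k_def)
    also have "\<dots> = (\<integral>\<^sup>+s. V s x * indicator {0..d n} s \<partial>lborel)"
      by (rule V_average) (use d(1)[of n] in simp)
    finally show ?thesis .
  qed
  have emd: "(\<integral>\<^sup>+s. c * indicator {0..d n} s \<partial>lborel) = c * ennreal (d n)" for c :: ennreal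
    using d(1)[of n] by (simp add: nn_integral_cmult_indicator)
  have upper: "C x \<le> d n * (exp (\<alpha> * d n) * G (- x))" for x
  proof -
    have "ennreal (C x) \<le> (\<integral>\<^sup>+s. (ennreal (exp (\<alpha> * d n)) * u x 0) * indicator {0..d n} s \<partial>lborel)"
      unfolding C_enn
    proof (rule nn_integral_mono)
      fix s :: real
      show "V s x * indicator {0..d n} s \<le> (ennreal (exp (\<alpha> * d n)) * u x 0) * indicator {0..d n} s"
      proof (cases "s \<in> {0..d n}")
        case True
        have "V s x = ennreal (exp (\<alpha> * s)) * (ennreal (exp (- \<alpha> * s)) * V s x)"
          by (simp add: mult.assoc[symmetric] ennreal_mult[symmetric] exp_add[symmetric])
        also have "\<dots> \<le> ennreal (exp (\<alpha> * d n)) * u x 0"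
          using True alpha by (intro mult_mono V_le ennreal_leI) auto
        finally show ?thesis using True by simp
      qed simp
    qed
    also have "\<dots> = ennreal (d n * (exp (\<alpha> * d n) * G (- x)))"
      unfolding emd using d(1)[of n] by (simp add: u_eq_G[of x 0] ennreal_mult[symmetric] G_nonneg mult.commute)
    finally show ?thesis using d(1)[of n] by (simp add: ennreal_le_iff G_nonneg)
  qed
  have lower: "d n * (G 0 - 2 * l n) \<le> C 0"
  proof -
    have "u 0 0 * ennreal (d n) = (\<integral>\<^sup>+s. u 0 0 * indicator {0..d n} s \<partial>lborel)" by (simp only: emd)
    also have "\<dots> \<le> (\<integral>\<^sup>+s. 2 * \<kappa> (d n) 0 * indicator {0..d n} s + V s 0 * indicator {0..d n} s \<partial>lborel)"
    proof (rule nn_integral_mono)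
      fix s :: real
      show "u 0 0 * indicator {0..d n} s \<le> 2 * \<kappa> (d n) 0 * indicator {0..d n} s + V s 0 * indicator {0..d n} s"
        using V_ge[of s "d n"] by (cases "s \<in> {0..d n}") auto
    qed
    also have "\<dots> = (\<integral>\<^sup>+s. 2 * \<kappa> (d n) 0 * indicator {0..d n} s \<partial>lborel) + (\<integral>\<^sup>+s. V s 0 * indicator {0..d n} s \<partial>lborel)"
    proof (rule nn_integral_add)
      have "(\<lambda>(s, w). u (w (max 0 s)) 0) \<in> borel_measurable (lborel \<Otimes>\<^sub>M P 0)"
        using path_pair_measurable[of "\<lambda>a. u a 0"] by (simp cong: measurable_cong_sets sets_pair_measure_cong)
      then have "(\<lambda>s. V s 0) \<in> borel_measurable lborel"
        unfolding V_def using P.borel_measurable_nn_integral[of "\<lambda>s w. u (w (max 0 s)) 0" lborel 0] by simp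
      then show "(\<lambda>s. V s 0 * indicator {0..d n} s) \<in> borel_measurable lborel" by simp
    qed simp
    also have "\<dots> = 2 * ennreal (l n) * ennreal (d n) + ennreal (C 0)"
      by (simp only: emd C_enn l)
    finally have *: "u 0 0 * ennreal (d n) \<le> 2 * ennreal (l n) * ennreal (d n) + ennreal (C 0)" .
    have C0: "C 0 \<ge> 0" unfolding C_def by (intro integral_nonneg_AE) (simp add: G_nonneg k_def)
    have "ennreal (G 0 * d n) \<le> ennreal (2 * l n * d n + C 0)"
    proof -
      have "ennreal (2 * l n * d n + C 0) = 2 * ennreal (l n) * ennreal (d n) + ennreal (C 0)"
        using l(2)[of n] d(1)[of n] C0 by (simp add: ennreal_plus ennreal_mult ennreal_numeral)
      then show ?thesis using * d(1)[of n] by (simp add: ennreal_G[symmetric] ennreal_mult G_nonneg)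
    qed
    then have "G 0 * d n \<le> 2 * l n * d n + C 0"
      using l(2)[of n] d(1)[of n] C0 by (subst (asm) ennreal_le_iff) auto
    then show ?thesis by (simp add: algebra_simps)
  qed
  have ex: "exp (- \<alpha> * d n) * C x / d n \<le> G (- x)" for x
  proof -
    have "exp (- \<alpha> * d n) * C x \<le> exp (- \<alpha> * d n) * (d n * (exp (\<alpha> * d n) * G (- x)))"
      by (intro mult_left_mono upper) simp
    also have "\<dots> = (exp (- \<alpha> * d n) * exp (\<alpha> * d n)) * (d n * G (- x))" by (simp only: mult_ac)
    also have "\<dots> = d n * G (- x)" by (simp add: exp_add[symmetric])
    finally show ?thesis using d(1)[of n] by (simp add: divide_le_eq mult.commute)
  qed
  have "G 0 - \<epsilon> < exp (- \<alpha> * d n) * C 0 / d n"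
  proof -
    have "exp (- \<alpha> * d n) * (G 0 - 2 * l n) \<le> exp (- \<alpha> * d n) * (C 0 / d n)"
      using lower d(1)[of n] by (intro mult_left_mono) (auto simp: le_divide_eq mult.commute)
    then show ?thesis using n by simp
  qed
  moreover have "((\<lambda>x. exp (- \<alpha> * d n) * C (- x) / d n) \<longlongrightarrow> exp (- \<alpha> * d n) * C (- 0) / d n) (nhds 0)"
  proof -
    have "isCont (\<lambda>x. C (- x)) 0"
      by (rule isCont_o2[of 0 uminus C]) (use C_cont in \<open>auto simp: continuous_on_eq_continuous_at\<close>)
    then have "((\<lambda>x. C (- x)) \<longlongrightarrow> C (- 0)) (nhds 0)"
      unfolding isCont_def by (rule iffD1[OF tendsto_at_iff_tendsto_nhds[of "\<lambda>x. C (- x)" 0]])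
    then show ?thesis by (intro tendsto_intros) (use d(1)[of n] in auto)
  qed
  ultimately have "\<forall>\<^sub>F x in nhds 0. G 0 - \<epsilon> < exp (- \<alpha> * d n) * C (- x) / d n"
    by (intro order_tendstoD(1)) auto
  then show ?thesis
  proof eventually_elim
    case (elim x)
    then show ?case using ex[of "- x"] by simp
  qed
qed

text \<open>Upper semicontinuity is free, as \<open>G\<close> attains its maximum at 0;
  \<open>G_lower\<close> gives the other half.\<close>

lemma isCont_G_zero: "isCont G 0"
proof -
  have "(G \<longlongrightarrow> G 0) (nhds 0)"
  proof (rule order_tendstoI)
    fix a assume "a < G 0"
    then show "\<forall>\<^sub>F x in nhds 0. a < G x" using G_lower[of "G 0 - a"] by simp
  next
    fix a assume "G 0 < a"
    then have "\<forall>x. G x < a" using le_less_trans[OF G_le] by blast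
    then show "\<forall>\<^sub>F x in nhds 0. G x < a" by (rule always_eventually)
  qed
  then show ?thesis by (simp add: continuous_at tendsto_at_iff_tendsto_nhds)
qed

text \<open>\<open>G_mult\<close> traps \<open>G (s + h)\<close> between
  \<open>G s * G h / G 0\<close> and \<open>G 0 * G s / G (- h)\<close>, the latter by returning
  from \<open>s + h\<close> to \<open>s\<close>. Both bounds tend to \<open>G s\<close> by
  continuity at 0.\<close>

lemma isCont_G: "isCont G s"
proof -
  have G0: "(G \<longlongrightarrow> G 0) (at 0)" using isCont_G_zero by (simp add: isCont_def)
  have G0': "((\<lambda>h. G (- h)) \<longlongrightarrow> G 0) (at 0)"
  proof (rule isCont_tendsto_compose[of 0 G])
    show "isCont G 0" by (rule isCont_G_zero)
    show "(uminus \<longlongrightarrow> (0 :: real)) (at 0)" using tendsto_minus[OF tendsto_ident_at, of "0 :: real" UNIV] by simp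
  qed
  have lo: "((\<lambda>h. G s * G h / G 0) \<longlongrightarrow> G s * G 0 / G 0) (at 0)"
    using G_pos by (intro tendsto_intros G0) simp
  have up: "((\<lambda>h. G 0 * G s / G (- h)) \<longlongrightarrow> G 0 * G s / G 0) (at 0)"
    using G_pos by (intro tendsto_intros G0') simp
  have "((\<lambda>h. G (s + h)) \<longlongrightarrow> G s) (at 0)"
  proof (rule tendsto_sandwich)
    show "((\<lambda>h. G s * G h / G 0) \<longlongrightarrow> G s) (at 0)" using lo G_pos by simp
    show "((\<lambda>h. G 0 * G s / G (- h)) \<longlongrightarrow> G s) (at 0)" using up G_pos by simp
    show "\<forall>\<^sub>F h in at 0. G s * G h / G 0 \<le> G (s + h)"
    proof (rule always_eventually, rule allI)
      fix h show "G s * G h / G 0 \<le> G (s + h)"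
        using G_mult[of s h] pos_divide_le_eq[OF G_pos, of "G s * G h" "G (s + h)"] by (simp only: mult.commute)
    qed
    have "\<forall>\<^sub>F h in at 0. G (- h) > 0" using G0' G_pos by (rule order_tendstoD)
    then show "\<forall>\<^sub>F h in at 0. G (s + h) \<le> G 0 * G s / G (- h)"
    proof eventually_elim
      case (elim h)
      then show ?case using G_mult[of "s + h" "- h"] pos_le_divide_eq[OF elim, of "G (s + h)" "G 0 * G s"] by simp
    qed
  qed
  then show ?thesis by (simp add: isCont_iff)
qed

end

section \<open>The even part and the improper integral of the odd part\<close>

lemma integral_even:
  fixes f :: "real \<Rightarrow> real"
  assumes f: "integrable lborel f" and even: "\<And>x. f (- x) = f x"
  shows "(\<integral>x. f x \<partial>lborel) = 2 * (\<integral>x. indicator {0..} x * f x \<partial>lborel)"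
proof -
  have [measurable]: "f \<in> borel_measurable borel" using f by (auto dest: borel_measurable_integrable)
  have i1: "integrable lborel (\<lambda>x. indicator {0..} x * f x)"
    using integrable_mult_indicator[OF _ f, of "{0..}"] by simp
  have i2: "integrable lborel (\<lambda>x. indicator {..<0} x * f x)"
    using integrable_mult_indicator[OF _ f, of "{..<0}"] by simp
  have "(\<integral>x. f x \<partial>lborel) = (\<integral>x. indicator {0..} x * f x + indicator {..<0} x * f x \<partial>lborel)"
    by (intro Bochner_Integration.integral_cong) (auto simp: indicator_def)
  also have "\<dots> = (\<integral>x. indicator {0..} x * f x \<partial>lborel) + (\<integral>x. indicator {..<0} x * f x \<partial>lborel)"
    by (rule Bochner_Integration.integral_add[OF i1 i2])
  also have "(\<integral>x. indicator {..<0} x * f x \<partial>lborel) = (\<integral>x. indicator {..<0} (- x) * f (- x) \<partial>lborel)"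
    by (subst lborel_integral_real_affine[of "- 1" _ 0]) auto
  also have "\<dots> = (\<integral>x. indicator {0..} x * f x \<partial>lborel)"
  proof (rule integral_cong_AE)
    show "AE x in lborel. indicator {..<0} (- x) * f (- x) = indicator {0..} x * f x"
      using AE_lborel_singleton[of "0 :: real"] by eventually_elim (auto simp: even indicator_def)
  qed measurable
  finally show ?thesis by simp
qed

lemma integral_symmetric_interval:
  fixes f :: "real \<Rightarrow> real"
  assumes f: "continuous_on UNIV f" and even: "\<And>x. f (- x) = f x" and N: "N \<ge> 0"
  shows "(\<integral>x. indicator {- N..N} x * f x \<partial>lborel) = 2 * integral {0..N} f"
proof -
  have si: "set_integrable lborel {a..b} f" for a b :: real
    using borel_integrable_compact[of "{a..b}" f] f by (simp add: set_integrable_def continuous_on_subset indicator_def of_bool_def if_distrib cong: if_cong)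
  have "integrable lborel (\<lambda>x. indicator {- N..N} x * f x)"
    using si[of "- N" N] by (simp add: set_integrable_def)
  then have "(\<integral>x. indicator {- N..N} x * f x \<partial>lborel) = 2 * (\<integral>x. indicator {0..} x * (indicator {- N..N} x * f x) \<partial>lborel)"
    by (rule integral_even) (auto simp: even indicator_def)
  also have "(\<integral>x. indicator {0..} x * (indicator {- N..N} x * f x) \<partial>lborel) = (LINT x:{0..N}|lborel. f x)"
    unfolding set_lebesgue_integral_def by (intro Bochner_Integration.integral_cong) (auto simp: indicator_def)
  also have "\<dots> = integral {0..N} f" by (rule set_borel_integral_eq_integral[OF si])
  finally show ?thesis .
qed

text \<open>The analytic hypotheses, detached from the process; \<open>fourier_kernel_G\<close>
  verifies them for \<open>1 / (\<alpha> + \<psi>)\<close>. \<open>square\<close> makes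
  \<open>\<phi>\<close> square integrable once its real part is integrable, and
  \<open>increment\<close> then makes differences of shifts integrable.\<close>

locale fourier_kernel =
  fixes G :: "real \<Rightarrow> real" and \<phi> :: "real \<Rightarrow> complex" and \<alpha> :: real
  assumes G_int: "integrable lborel G" and G_pos: "\<And>s. 0 \<le> G s" and G_bound: "\<And>s. G s \<le> G 0" and G_cont: "\<And>s. isCont G s"
    and FT: "\<And>l. (\<integral>s. iexp (l * s) * of_real (G s) \<partial>lborel) = \<phi> l"
    and alpha: "\<alpha> > 0"
    and Re_pos: "\<And>l. 0 \<le> Re (\<phi> l)"
    and square: "\<And>l. (norm (\<phi> l))\<^sup>2 \<le> Re (\<phi> l) / \<alpha>"
    and increment: "\<And>h. \<exists>K. \<forall>l. norm (\<phi> (l + h) - \<phi> l) \<le> K * (Re (\<phi> l) + (norm (\<phi> (l + h)))\<^sup>2)"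
begin

lemma G_meas [measurable]: "G \<in> borel_measurable borel"
  using G_int by (auto dest: borel_measurable_integrable)

lemma cG_int: "integrable lborel (\<lambda>s. complex_of_real (G s))"
  using G_int by simp

lemma FT_int: "integrable lborel (\<lambda>s. iexp (l * s) * of_real (G s))"
  by (rule Bochner_Integration.integrable_bound[OF cG_int]) (auto simp: norm_mult)

lemma \<phi>_cont: "isCont \<phi> l"
  unfolding continuous_at_sequentially
proof (intro allI impI)
  fix x :: "nat \<Rightarrow> real" assume x: "x \<longlonglongrightarrow> l"
  have "(\<lambda>n. \<integral>s. iexp (x n * s) * of_real (G s) \<partial>lborel) \<longlonglongrightarrow> (\<integral>s. iexp (l * s) * of_real (G s) \<partial>lborel)"
  proof (rule integral_dominated_convergence[where w=G])
    show "AE s in lborel. (\<lambda>n. iexp (x n * s) * of_real (G s)) \<longlonglongrightarrow> iexp (l * s) * of_real (G s)"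
      by (intro AE_I2 tendsto_intros x)
    show "AE s in lborel. norm (iexp (x n * s) * complex_of_real (G s)) \<le> G s" for n
      by (intro AE_I2) (simp add: norm_mult G_pos)
  qed (auto intro: G_int)
  then show "(\<phi> \<circ> x) \<longlonglongrightarrow> \<phi> l" unfolding FT comp_def .
qed

lemma \<phi>_cont_on: "continuous_on UNIV \<phi>"
  using \<phi>_cont by (simp add: continuous_on_eq_continuous_at)

lemma \<phi>_meas [measurable]: "\<phi> \<in> borel_measurable borel"
  by (rule borel_measurable_continuous_onI[OF \<phi>_cont_on])

lemma \<phi>_minus: "\<phi> (- l) = cnj (\<phi> l)"
proof -
  have "cnj (\<phi> l) = (\<integral>s. cnj (iexp (l * s) * of_real (G s)) \<partial>lborel)"
    unfolding FT[symmetric] by (rule Bochner_Integration.integral_cnj[symmetric])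
  also have "\<dots> = (\<integral>s. iexp (- l * s) * of_real (G s) \<partial>lborel)"
    by (intro Bochner_Integration.integral_cong) (auto simp: exp_cnj)
  finally show ?thesis unfolding FT by (rule sym)
qed

section \<open>The even part of the density and the cosine integral\<close>

definition v :: "real \<Rightarrow> real" where "v s = (G s + G (- s)) / 2"

lemma Gm_int: "integrable lborel (\<lambda>s. G (- s))"
  using lborel_integrable_real_affine[OF G_int, of "- 1" 0] by simp

lemma v_int: "integrable lborel v"
  unfolding v_def[abs_def] using G_int Gm_int by simp

lemma v_bound: "0 \<le> v s" "v s \<le> G 0"
  using G_pos[of s] G_pos[of "- s"] G_bound[of s] G_bound[of "- s"] by (auto simp: v_def)

lemma v_FT: "(\<integral>s. iexp (l * s) * of_real (v s) \<partial>lborel) = of_real (Re (\<phi> l))"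
proof -
  have 1: "(\<integral>s. iexp (l * s) * of_real (G (- s)) \<partial>lborel) = \<phi> (- l)"
    unfolding FT[symmetric] by (subst (2) lborel_integral_real_affine[of "- 1" _ 0]) auto
  have 2: "integrable lborel (\<lambda>s. iexp (l * s) * complex_of_real (G (- s)))"
    by (rule Bochner_Integration.integrable_bound[where f="\<lambda>s. complex_of_real (G (- s))"]) (use Gm_int in \<open>auto simp: norm_mult\<close>)
  have "(\<integral>s. iexp (l * s) * of_real (v s) \<partial>lborel) = (\<integral>s. (iexp (l * s) * of_real (G s) + iexp (l * s) * of_real (G (- s))) / 2 \<partial>lborel)"
    by (intro Bochner_Integration.integral_cong) (auto simp: v_def algebra_simps)
  also have "\<dots> = (\<phi> l + cnj (\<phi> l)) / 2"
    by (simp only: integral_divide_zero Bochner_Integration.integral_add[OF FT_int 2] FT 1 \<phi>_minus)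
  also have "\<dots> = of_real (Re (\<phi> l))" by (simp add: complex_add_cnj)
  finally show ?thesis .
qed

text \<open>Integrated against a Gaussian, the nonnegative function \<open>Re (\<phi> l)\<close>
  gives a Gaussian average of \<open>v\<close>, hence at most \<open>sqrt (2 * pi) * G 0\<close>.
  Fatou's lemma removes the Gaussian.\<close>

lemma Re_int: "integrable lborel (\<lambda>l. Re (\<phi> l))"
proof (rule integrableI_nonneg)
  show "AE l in lborel. 0 \<le> Re (\<phi> l)" by (simp add: Re_pos)
  show "(\<lambda>l. Re (\<phi> l)) \<in> borel_measurable lborel" by measurable
  define \<epsilon> where "\<epsilon> n = 1 / real (Suc n)" for n
  have e: "\<epsilon> n > 0" for n by (simp add: \<epsilon>_def)
  have e0: "\<epsilon> \<longlonglongrightarrow> 0" unfolding \<epsilon>_def[abs_def] using LIMSEQ_inverse_real_of_nat by (simp add: inverse_eq_divide)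
  have n0: "std_normal_density 0 = 1 / sqrt (2 * pi)" by (subst std_normal_density_def) simp
  have nb: "std_normal_density x \<le> 1 / sqrt (2 * pi)" for x
    by (simp add: std_normal_density_def divide_right_mono)
  have nc: "(\<lambda>n. std_normal_density (\<epsilon> n * l)) \<longlonglongrightarrow> 1 / sqrt (2 * pi)" for l
  proof -
    have "(\<lambda>n. 1 / sqrt (2 * pi) * exp (- (\<epsilon> n * l)\<^sup>2 / 2)) \<longlonglongrightarrow> 1 / sqrt (2 * pi) * exp (- (0 * l)\<^sup>2 / 2)"
      by (intro tendsto_intros e0) simp
    then show ?thesis by (simp add: std_normal_density_def)
  qed
  have Re_le: "Re (\<phi> l) \<le> (\<integral>s. G s \<partial>lborel)" for l
  proof -
    have "norm (\<phi> l) \<le> (\<integral>s. norm (iexp (l * s) * complex_of_real (G s)) \<partial>lborel)"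
      unfolding FT[symmetric] by (rule integral_norm_bound)
    also have "\<dots> = (\<integral>s. G s \<partial>lborel)" by (simp add: norm_mult G_pos)
    finally show ?thesis using complex_Re_le_cmod[of "\<phi> l"] by linarith
  qed
  define g where "g n l = Re (\<phi> l) * std_normal_density (\<epsilon> n * l)" for n l
  have g_int: "integrable lborel (g n)" for n
  proof (rule Bochner_Integration.integrable_bound)
    show "integrable lborel (\<lambda>l. (\<integral>s. G s \<partial>lborel) * std_normal_density (\<epsilon> n * l))"
      using lborel_integrable_real_affine[OF integrable_std_normal_density, of "\<epsilon> n" 0] e[of n] by simp
    show "g n \<in> borel_measurable lborel" unfolding g_def by measurable
    show "AE l in lborel. norm (g n l) \<le> norm ((\<integral>s. G s \<partial>lborel) * std_normal_density (\<epsilon> n * l))"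
      using Re_le Re_pos order_trans[OF Re_pos Re_le]
      by (intro AE_I2) (auto simp: g_def abs_mult normal_density_nonneg intro!: mult_right_mono)
  qed
  have g_bound: "(\<integral>l. g n l \<partial>lborel) \<le> sqrt (2 * pi) * G 0" for n
  proof -
    have "complex_of_real (\<integral>l. g n l \<partial>lborel) = (\<integral>l. of_real (g n l) \<partial>lborel)" by simp
    also have "\<dots> = (\<integral>l. (\<integral>s. iexp (l * s) * of_real (v s) \<partial>lborel) * iexp (- l * 0) * of_real (std_normal_density (\<epsilon> n * l)) \<partial>lborel)"
      unfolding v_FT g_def by simp
    also have "\<dots> = of_real (sqrt (2 * pi)) * (\<integral>x. of_real (v (0 + \<epsilon> n * x)) * of_real (std_normal_density x) \<partial>lborel)"
      by (rule gaussian_summation[OF _ e]) (use v_int in simp)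
    also have "\<dots> = of_real (sqrt (2 * pi) * (\<integral>x. v (\<epsilon> n * x) * std_normal_density x \<partial>lborel))"
      by (simp add: of_real_mult[symmetric] del: of_real_mult)
    finally have "(\<integral>l. g n l \<partial>lborel) = sqrt (2 * pi) * (\<integral>x. v (\<epsilon> n * x) * std_normal_density x \<partial>lborel)"
      by (simp only: of_real_eq_iff)
    also have "\<dots> \<le> sqrt (2 * pi) * (\<integral>x. G 0 * std_normal_density x \<partial>lborel)"
    proof (intro mult_left_mono integral_mono)
      have vm: "v \<in> borel_measurable borel" using v_int by (auto dest: borel_measurable_integrable)
      show "integrable lborel (\<lambda>x. v (\<epsilon> n * x) * std_normal_density x)"
      proof (rule Bochner_Integration.integrable_bound)
        show "integrable lborel (\<lambda>x. G 0 * std_normal_density x)" using integrable_std_normal_density by simp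
        show "(\<lambda>x. v (\<epsilon> n * x) * std_normal_density x) \<in> borel_measurable lborel" using vm by measurable
      qed (use v_bound in \<open>auto simp: abs_mult normal_density_nonneg G_pos intro!: mult_right_mono\<close>)
    qed (use v_bound integrable_std_normal_density in \<open>auto simp: normal_density_nonneg intro!: mult_right_mono\<close>)
    also have "\<dots> = sqrt (2 * pi) * G 0" by (simp add: integral_std_normal_density)
    finally show ?thesis .
  qed
  have "(\<integral>\<^sup>+l. ennreal (Re (\<phi> l) * (1 / sqrt (2 * pi))) \<partial>lborel) = (\<integral>\<^sup>+l. liminf (\<lambda>n. ennreal (g n l)) \<partial>lborel)"
  proof (rule nn_integral_cong)
    fix l :: real
    have "(\<lambda>n. ennreal (g n l)) \<longlonglongrightarrow> ennreal (Re (\<phi> l) * (1 / sqrt (2 * pi)))"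
      unfolding g_def by (intro tendsto_ennrealI tendsto_mult tendsto_const nc)
    then show "ennreal (Re (\<phi> l) * (1 / sqrt (2 * pi))) = liminf (\<lambda>n. ennreal (g n l))"
      by (intro lim_imp_Liminf[symmetric]) auto
  qed
  also have "\<dots> \<le> liminf (\<lambda>n. \<integral>\<^sup>+l. ennreal (g n l) \<partial>lborel)"
    by (rule nn_integral_liminf) (unfold g_def, measurable)
  also have "\<dots> \<le> liminf (\<lambda>n. ennreal (sqrt (2 * pi) * G 0))"
  proof (rule Liminf_mono, rule always_eventually, rule allI)
    fix n
    have "(\<integral>\<^sup>+l. ennreal (g n l) \<partial>lborel) = ennreal (\<integral>l. g n l \<partial>lborel)"
      by (rule nn_integral_eq_integral[OF g_int]) (simp add: g_def Re_pos normal_density_nonneg)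
    then show "(\<integral>\<^sup>+l. ennreal (g n l) \<partial>lborel) \<le> ennreal (sqrt (2 * pi) * G 0)"
      using g_bound[of n] by (simp add: ennreal_leI)
  qed
  also have "\<dots> = ennreal (sqrt (2 * pi) * G 0)" by (simp add: Liminf_const)
  finally have "(\<integral>\<^sup>+l. ennreal (1 / sqrt (2 * pi)) * ennreal (Re (\<phi> l)) \<partial>lborel) < \<infinity>"
    by (simp add: ennreal_mult[symmetric] Re_pos mult.commute le_less_trans)
  then show "(\<integral>\<^sup>+l. ennreal (Re (\<phi> l)) \<partial>lborel) < \<infinity>"
    by (subst (asm) nn_integral_cmult) (auto simp: ennreal_mult_less_top)
qed

lemma sq_int: "integrable lborel (\<lambda>l. (norm (\<phi> l))\<^sup>2)"
proof (rule Bochner_Integration.integrable_bound)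
  show "integrable lborel (\<lambda>l. Re (\<phi> l) / \<alpha>)" using Re_int by simp
qed (use square Re_pos alpha in auto)

text \<open>Inversion of the transform of \<open>v\<close> at \<open>z\<close>: taking real parts
  leaves the cosine, and evenness of the integrand halves the line.\<close>

lemma R_limit: "((\<lambda>l. cos (l * z) * Re (\<phi> l)) has_integral pi * v z) {0..}"
proof -
  let ?f = "\<lambda>l. cos (l * z) * Re (\<phi> l)"
  have fi: "integrable lborel ?f"
    by (rule Bochner_Integration.integrable_bound[OF Re_int]) (auto simp: abs_mult Re_pos intro!: mult_left_le_one_le)
  have inv: "(\<integral>l. of_real (Re (\<phi> l)) * iexp (- l * z) \<partial>lborel) = 2 * pi * complex_of_real (v z)"
  proof -
    have "(\<integral>l. (\<integral>s. iexp (l * s) * complex_of_real (v s) \<partial>lborel) * iexp (- l * z) \<partial>lborel) = 2 * pi * complex_of_real (v z)"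
    proof (rule fourier_inversion)
      show "integrable lborel (\<lambda>s. complex_of_real (v s))" using v_int by simp
      show "norm (complex_of_real (v s)) \<le> G 0" for s using v_bound[of s] by simp
      have "isCont (\<lambda>s. G (- s)) z" by (rule isCont_o2[of z uminus G]) (auto intro: G_cont)
      then show "isCont (\<lambda>s. complex_of_real (v s)) z"
        unfolding v_def using G_cont by (intro continuous_intros) auto
      show "integrable lborel (\<lambda>l. \<integral>s. iexp (l * s) * complex_of_real (v s) \<partial>lborel)"
        unfolding v_FT using Re_int by simp
    qed
    then show ?thesis by (simp only: v_FT)
  qed
  have ci: "integrable lborel (\<lambda>l. complex_of_real (Re (\<phi> l)) * iexp (- l * z))"
    by (rule Bochner_Integration.integrable_bound[OF Re_int]) (auto simp: norm_mult)
  have "Re (\<integral>l. of_real (Re (\<phi> l)) * iexp (- l * z) \<partial>lborel) = (\<integral>l. Re (of_real (Re (\<phi> l)) * iexp (- l * z)) \<partial>lborel)"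
    using integral_Re[OF ci] by simp
  also have "\<dots> = (\<integral>l. ?f l \<partial>lborel)"
    by (intro Bochner_Integration.integral_cong) (auto simp: Re_exp mult.commute)
  finally have 1: "(\<integral>l. ?f l \<partial>lborel) = 2 * pi * v z" using inv by simp
  have "(\<integral>l. ?f l \<partial>lborel) = 2 * (\<integral>l. indicator {0..} l * ?f l \<partial>lborel)"
    by (rule integral_even[OF fi]) (simp add: \<phi>_minus)
  then have 2: "(LINT l:{0..}|lborel. ?f l) = pi * v z" using 1 by (simp add: set_lebesgue_integral_def)
  have "set_integrable lborel {0..} ?f"
    unfolding set_integrable_def by (rule integrable_mult_indicator[OF _ fi]) simp
  from set_borel_integral_eq_integral[OF this] 2 show ?thesis
    by (simp add: has_integral_integral)
qed

section \<open>Symmetric partial integrals and the sine integral\<close>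

definition w :: "real \<Rightarrow> real \<Rightarrow> complex" where "w z l = \<phi> l * iexp (- l * z)"

lemma norm_w: "norm (w z l) = norm (\<phi> l)"
  by (simp add: w_def norm_mult)

lemma w_cont: "continuous_on UNIV (w z)"
  unfolding w_def by (intro continuous_intros \<phi>_cont_on)

lemma w_interval_int: "integrable lborel (\<lambda>l. indicator {a..b} l *\<^sub>R w z l)"
  using borel_integrable_compact[of "{a..b}" "w z"] continuous_on_subset[OF w_cont[of z], of "{a..b}"]
  by (simp add: indicator_def of_bool_def if_distrib if_distribR cong: if_cong)

text \<open>The windows move to infinity at fixed length, so square integrability suffices: in
  \<open>|\<phi>| \<le> \<eta> + |\<phi>|^2 / \<eta>\<close> the first term costs
  \<open>\<eta>\<close> times the length, and the integral of the second tends to 0 for fixed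
  \<open>\<eta>\<close>.\<close>

lemma boundary_vanishes:
  assumes h: "h > 0"
  shows "((\<lambda>N. \<integral>l. (indicator {- N.. - N + h} l + indicator {N..N + h} l) * norm (\<phi> l) \<partial>lborel) \<longlongrightarrow> 0) at_top"
proof (rule tendstoI)
  define d :: "real \<Rightarrow> real \<Rightarrow> real" where "d N l = indicator {- N.. - N + h} l + indicator {N..N + h} l" for N l
  have d0: "0 \<le> d N l" "d N l \<le> 2" for N l by (auto simp: d_def indicator_def)
  have [measurable]: "d N \<in> borel_measurable borel" for N unfolding d_def by measurable
  have ii: "integrable lborel (indicator {a..b} :: real \<Rightarrow> real)" for a b :: real
    by (rule integrable_real_indicator) (auto simp: emeasure_lborel_Icc_eq)
  have d_int: "integrable lborel (d N)" and d_tot: "(\<integral>l. d N l \<partial>lborel) = 2 * h" for N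
    unfolding d_def using h by (simp_all add: ii)
  have sq: "((\<lambda>N. \<integral>l. d N l * (norm (\<phi> l))\<^sup>2 \<partial>lborel) \<longlongrightarrow> (\<integral>l. 0 \<partial>(lborel :: real measure))) at_top"
  proof (rule integral_dominated_convergence_at_top[where w="\<lambda>l. 2 * (norm (\<phi> l))\<^sup>2"])
    show "AE l in lborel. ((\<lambda>N. d N l * (norm (\<phi> l))\<^sup>2) \<longlongrightarrow> 0) at_top"
    proof (rule AE_I2)
      fix l :: real
      have "\<forall>\<^sub>F N in at_top. d N l * (norm (\<phi> l))\<^sup>2 = 0"
        using eventually_gt_at_top[of "\<bar>l\<bar> + h"]
      proof eventually_elim
        case (elim N)
        then have "l \<notin> {- N.. - N + h}" "l \<notin> {N..N + h}" by auto
        then show ?case by (simp add: d_def)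
      qed
      then show "((\<lambda>N. d N l * (norm (\<phi> l))\<^sup>2) \<longlongrightarrow> 0) at_top" by (rule tendsto_eventually)
    qed
    show "\<forall>\<^sub>F N in at_top. AE l in lborel. norm (d N l * (norm (\<phi> l))\<^sup>2) \<le> 2 * (norm (\<phi> l))\<^sup>2"
      using d0 by (intro always_eventually allI AE_I2) (auto simp: abs_mult intro!: mult_right_mono)
  qed (use sq_int in auto)
  fix e :: real assume e: "e > 0"
  \<comment> \<open>Chosen so that \<open>\<eta>\<close> times the total window length
    \<open>2 * h\<close> is \<open>e / 2\<close>.\<close>
  define \<eta> where "\<eta> = e / (4 * h)"
  have eta: "\<eta> > 0" using e h by (simp add: \<eta>_def)
  have "\<forall>\<^sub>F N in at_top. (\<integral>l. d N l * (norm (\<phi> l))\<^sup>2 \<partial>lborel) < \<eta> * e / 2"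
    using sq e eta by (intro order_tendstoD(2)) auto
  then show "\<forall>\<^sub>F N in at_top. dist (\<integral>l. (indicator {- N.. - N + h} l + indicator {N..N + h} l) * norm (\<phi> l) \<partial>lborel) 0 < e"
  proof eventually_elim
    case (elim N)
    have dsq: "integrable lborel (\<lambda>l. d N l * (norm (\<phi> l))\<^sup>2)"
    proof (rule Bochner_Integration.integrable_bound)
      show "integrable lborel (\<lambda>l. 2 * (norm (\<phi> l))\<^sup>2)" using sq_int by simp
    qed (use d0 in \<open>auto simp: abs_mult intro!: mult_right_mono\<close>)
    have pt: "d N l * norm (\<phi> l) \<le> \<eta> * d N l + (1 / \<eta>) * (d N l * (norm (\<phi> l))\<^sup>2)" for l
    proof -
      have "norm (\<phi> l) \<le> \<eta> + (1 / \<eta>) * (norm (\<phi> l))\<^sup>2"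
      proof (cases "norm (\<phi> l) \<le> \<eta>")
        case False
        then have "norm (\<phi> l) * \<eta> \<le> norm (\<phi> l) * norm (\<phi> l)" by (intro mult_left_mono) auto
        then have "norm (\<phi> l) \<le> (1 / \<eta>) * (norm (\<phi> l))\<^sup>2" using eta by (simp add: field_simps power2_eq_square)
        then show ?thesis using eta by linarith
      qed (use eta in \<open>simp add: add_increasing2\<close>)
      then have "d N l * norm (\<phi> l) \<le> d N l * (\<eta> + (1 / \<eta>) * (norm (\<phi> l))\<^sup>2)" using d0(1) by (rule mult_left_mono)
      then show ?thesis by (simp add: algebra_simps)
    qed
    have "(\<integral>l. d N l * norm (\<phi> l) \<partial>lborel) \<le> (\<integral>l. \<eta> * d N l + (1 / \<eta>) * (d N l * (norm (\<phi> l))\<^sup>2) \<partial>lborel)"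
    proof (rule integral_mono[OF _ _ pt])
      show i: "integrable lborel (\<lambda>l. \<eta> * d N l + (1 / \<eta>) * (d N l * (norm (\<phi> l))\<^sup>2))"
        by (intro Bochner_Integration.integrable_add integrable_mult_right d_int dsq)
      show "integrable lborel (\<lambda>l. d N l * norm (\<phi> l))"
        by (rule Bochner_Integration.integrable_bound[OF i])
          (use pt d0 eta in \<open>auto simp: abs_mult intro!: order_trans[OF pt abs_ge_self]\<close>)
    qed
    also have "\<dots> = \<eta> * (2 * h) + (1 / \<eta>) * (\<integral>l. d N l * (norm (\<phi> l))\<^sup>2 \<partial>lborel)"
      using d_int dsq by (subst Bochner_Integration.integral_add) (simp_all add: d_tot)
    also have "\<dots> < \<eta> * (2 * h) + (1 / \<eta>) * (\<eta> * e / 2)"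
      using elim eta by (intro add_strict_left_mono mult_strict_left_mono) auto
    also have "\<dots> = e" using eta h by (simp add: \<eta>_def field_simps)
    finally have "(\<integral>l. d N l * norm (\<phi> l) \<partial>lborel) < e" .
    moreover have "0 \<le> (\<integral>l. d N l * norm (\<phi> l) \<partial>lborel)"
      using d0 by (intro integral_nonneg_AE AE_I2) auto
    ultimately show ?case by (simp add: d_def)
  qed
qed

text \<open>\<open>w z\<close> itself need not be integrable, but its sum with its shift by
  \<open>h\<close> is, and over \<open>{- N..N}\<close> the shift alters the integral only near the
  two end points.\<close>

lemma partial_integrals:
  assumes z: "z \<noteq> 0"
  shows "((\<lambda>N. \<integral>l. indicator {- N..N} l *\<^sub>R w z l \<partial>lborel) \<longlongrightarrow> 2 * pi * complex_of_real (G z)) at_top"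
proof -
  \<comment> \<open>With this shift \<open>e\<^sup>i\<^sup>h\<^sup>z - 1 = - 2\<close> does not vanish.\<close>
  define h where "h = pi / \<bar>z\<bar>"
  have h: "h > 0" using z by (simp add: h_def)
  have hz: "iexp (h * z) = - 1"
    using z by (cases "z > 0") (simp_all add: h_def exp_pi_i exp_minus)
  obtain K where K: "\<And>l. norm (\<phi> (l + h) - \<phi> l) \<le> K * (Re (\<phi> l) + (norm (\<phi> (l + h)))\<^sup>2)"
    using increment[of h] by blast
  have shift_sq: "integrable lborel (\<lambda>l. (norm (\<phi> (l + h)))\<^sup>2)"
    using lborel_integrable_real_affine[OF sq_int, of 1 h] by (simp add: add.commute)
  have dint: "integrable lborel (\<lambda>l. \<phi> (l + h) - \<phi> l)"
  proof (rule Bochner_Integration.integrable_bound)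
    show "integrable lborel (\<lambda>l. K * (Re (\<phi> l) + (norm (\<phi> (l + h)))\<^sup>2))" using Re_int shift_sq by simp
    show "AE l in lborel. norm (\<phi> (l + h) - \<phi> l) \<le> norm (K * (Re (\<phi> l) + (norm (\<phi> (l + h)))\<^sup>2))"
      by (rule AE_I2) (simp only: real_norm_def order_trans[OF K abs_ge_self])
  qed measurable
  let ?f = "\<lambda>s. (iexp (h * s) - 1) * complex_of_real (G s)"
  have fFT: "(\<integral>s. iexp (l * s) * ?f s \<partial>lborel) = \<phi> (l + h) - \<phi> l" for l
  proof -
    have "(\<integral>s. iexp (l * s) * ?f s \<partial>lborel) = (\<integral>s. iexp ((l + h) * s) * of_real (G s) - iexp (l * s) * of_real (G s) \<partial>lborel)"
      by (intro Bochner_Integration.integral_cong) (auto simp: algebra_simps exp_add)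
    also have "\<dots> = \<phi> (l + h) - \<phi> l" by (simp only: Bochner_Integration.integral_diff[OF FT_int FT_int] FT)
    finally show ?thesis .
  qed
  have nf: "norm (iexp (h * s) - 1) \<le> 2" for s
    using norm_triangle_ineq4[of "iexp (h * s)" 1] by simp
  have f_int: "integrable lborel ?f"
  proof (rule Bochner_Integration.integrable_bound)
    show "integrable lborel (\<lambda>s. 2 * G s)" using G_int by simp
  qed (use nf G_pos in \<open>auto simp: norm_mult intro!: mult_right_mono\<close>)
  have "(\<integral>l. (\<integral>s. iexp (l * s) * ?f s \<partial>lborel) * iexp (- l * z) \<partial>lborel) = 2 * pi * ?f z"
  proof (rule fourier_inversion[OF f_int])
    show "norm (?f s) \<le> 2 * G 0" for s
      using nf[of s] G_pos[of s] G_bound[of s] by (auto simp: norm_mult intro!: mult_mono)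
    show "isCont ?f z" using G_cont by (intro continuous_intros) auto
    show "integrable lborel (\<lambda>l. \<integral>s. iexp (l * s) * ?f s \<partial>lborel)" unfolding fFT by (rule dint)
  qed
  then have inv: "(\<integral>l. (\<phi> (l + h) - \<phi> l) * iexp (- l * z) \<partial>lborel) = - (4 * pi * complex_of_real (G z))"
    unfolding fFT hz by simp
  \<comment> \<open>As \<open>iexp (h * z)\<close> is \<open>- 1\<close>, the shift flips the sign
    of the exponential, and a difference of values of \<open>\<phi>\<close> becomes a sum of values
    of \<open>w z\<close>.\<close>
  have dw: "(\<phi> (l + h) - \<phi> l) * iexp (- l * z) = - (w z (l + h) + w z l)" for l
  proof -
    have "iexp (- (l + h) * z) * iexp (h * z) = iexp (- l * z)" by (simp add: exp_add[symmetric] algebra_simps)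
    then have "iexp (- l * z) = - iexp (- (l + h) * z)" by (simp only: hz mult_minus_right mult_1_right)
    then show ?thesis by (simp add: w_def algebra_simps)
  qed
  have w2_int: "integrable lborel (\<lambda>l. w z (l + h) + w z l)"
  proof -
    have "integrable lborel (\<lambda>l. (\<phi> (l + h) - \<phi> l) * iexp (- l * z))"
      by (rule Bochner_Integration.integrable_bound[OF dint]) (auto simp: norm_mult)
    then have "integrable lborel (\<lambda>l. - (w z (l + h) + w z l))" unfolding dw .
    from Bochner_Integration.integrable_minus[OF this] show ?thesis by (simp only: minus_minus)
  qed
  have w2: "(\<integral>l. w z (l + h) + w z l \<partial>lborel) = 4 * pi * complex_of_real (G z)"
  proof -
    have "(\<integral>l. - (w z (l + h) + w z l) \<partial>lborel) = - (4 * pi * complex_of_real (G z))"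
      using inv unfolding dw .
    then show ?thesis by (simp only: integral_minus neg_equal_iff_equal)
  qed
  define T where "T N = (\<integral>l. indicator {- N..N} l *\<^sub>R (w z (l + h) + w z l) \<partial>lborel)" for N :: real
  define S where "S N = (\<integral>l. indicator {- N..N} l *\<^sub>R w z l \<partial>lborel)" for N :: real
  have T_lim: "(T \<longlongrightarrow> 4 * pi * complex_of_real (G z)) at_top"
    unfolding T_def[abs_def] w2[symmetric]
  proof (rule integral_dominated_convergence_at_top[where w="\<lambda>l. norm (w z (l + h) + w z l)"])
    show "AE l in lborel. ((\<lambda>N. indicator {- N..N} l *\<^sub>R (w z (l + h) + w z l)) \<longlongrightarrow> w z (l + h) + w z l) at_top"
    proof (rule AE_I2)
      fix l :: real
      have "\<forall>\<^sub>F N in at_top. indicator {- N..N} l *\<^sub>R (w z (l + h) + w z l) = w z (l + h) + w z l"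
        using eventually_gt_at_top[of "\<bar>l\<bar>"] by eventually_elim (auto simp: indicator_def)
      then show "((\<lambda>N. indicator {- N..N} l *\<^sub>R (w z (l + h) + w z l)) \<longlongrightarrow> w z (l + h) + w z l) at_top"
        by (rule tendsto_eventually)
    qed
    show "\<forall>\<^sub>F N in at_top. AE l in lborel. norm (indicator {- N..N} l *\<^sub>R (w z (l + h) + w z l)) \<le> norm (w z (l + h) + w z l)"
      by (intro always_eventually allI AE_I2) (auto simp: indicator_def)
  qed (use w2_int in auto)
  \<comment> \<open>The shifted integral runs over \<open>{- N + h..N + h}\<close>, whose symmetric
    difference with \<open>{- N..N}\<close> lies in the windows of
    \<open>boundary_vanishes\<close>.\<close>
  have diff: "norm (2 * S N - T N) \<le> (\<integral>l. (indicator {- N.. - N + h} l + indicator {N..N + h} l) * norm (\<phi> l) \<partial>lborel)" if N: "N \<ge> 0" for N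
  proof -
    have sh_int: "integrable lborel (\<lambda>l. indicator {- N..N} l *\<^sub>R w z (l + h))"
      using lborel_integrable_real_affine[OF w_interval_int[of "- N + h" "N + h" z], of 1 h]
      by (simp add: indicator_def add.commute)
    have sh: "(\<integral>l. indicator {- N..N} l *\<^sub>R w z (l + h) \<partial>lborel) = (\<integral>l. indicator {- N + h..N + h} l *\<^sub>R w z l \<partial>lborel)"
      by (subst (2) lborel_integral_real_affine[of 1 _ h]) (auto simp: indicator_def add.commute intro!: Bochner_Integration.integral_cong)
    have "T N = (\<integral>l. indicator {- N + h..N + h} l *\<^sub>R w z l \<partial>lborel) + S N"
      unfolding T_def S_def sh[symmetric] using sh_int w_interval_int by (simp add: scaleR_add_right)
    then have "2 * S N - T N = (\<integral>l. indicator {- N..N} l *\<^sub>R w z l \<partial>lborel) - (\<integral>l. indicator {- N + h..N + h} l *\<^sub>R w z l \<partial>lborel)"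
      by (simp add: S_def)
    also have "\<dots> = (\<integral>l. indicator {- N..N} l *\<^sub>R w z l - indicator {- N + h..N + h} l *\<^sub>R w z l \<partial>lborel)"
      by (rule Bochner_Integration.integral_diff[symmetric, OF w_interval_int w_interval_int])
    finally have eq: "2 * S N - T N = (\<integral>l. indicator {- N..N} l *\<^sub>R w z l - indicator {- N + h..N + h} l *\<^sub>R w z l \<partial>lborel)" .
    have "norm (2 * S N - T N) \<le> (\<integral>l. norm (indicator {- N..N} l *\<^sub>R w z l - indicator {- N + h..N + h} l *\<^sub>R w z l) \<partial>lborel)"
      unfolding eq by (rule integral_norm_bound)
    also have "\<dots> \<le> (\<integral>l. (indicator {- N.. - N + h} l + indicator {N..N + h} l) * norm (\<phi> l) \<partial>lborel)"
    proof (rule Bochner_Integration.integral_mono)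
      show "integrable lborel (\<lambda>l. norm (indicator {- N..N} l *\<^sub>R w z l - indicator {- N + h..N + h} l *\<^sub>R w z l))"
        by (rule integrable_norm[OF Bochner_Integration.integrable_diff[OF w_interval_int w_interval_int]])
      have "integrable lborel (\<lambda>l. norm (indicator {- N.. - N + h} l *\<^sub>R w z l) + norm (indicator {N..N + h} l *\<^sub>R w z l))"
        by (rule Bochner_Integration.integrable_add[OF integrable_norm[OF w_interval_int] integrable_norm[OF w_interval_int]])
      then show "integrable lborel (\<lambda>l. (indicator {- N.. - N + h} l + indicator {N..N + h} l) * norm (\<phi> l))"
        by (simp add: norm_w distrib_right)
      fix l
      have "\<bar>indicator {- N..N} l - indicator {- N + h..N + h} l :: real\<bar>
          \<le> indicator {- N.. - N + h} l + indicator {N..N + h} l"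
        using h N by (simp add: indicator_def)
      from mult_right_mono[OF this, of "norm (\<phi> l)"]
      show "norm (indicator {- N..N} l *\<^sub>R w z l - indicator {- N + h..N + h} l *\<^sub>R w z l)
          \<le> (indicator {- N.. - N + h} l + indicator {N..N + h} l) * norm (\<phi> l)"
        by (simp add: norm_w flip: scaleR_left_diff_distrib)
    qed
    finally show ?thesis .
  qed
  have "((\<lambda>N. 2 * S N - T N) \<longlongrightarrow> 0) at_top"
    by (rule Lim_null_comparison[OF _ boundary_vanishes[OF h]])
      (rule eventually_mono[OF eventually_ge_at_top[of 0] diff])
  from tendsto_add[OF this T_lim] have "((\<lambda>N. 2 * S N) \<longlongrightarrow> 4 * pi * complex_of_real (G z)) at_top" by simp
  then have "((\<lambda>N. 2 * S N / 2) \<longlongrightarrow> 4 * pi * complex_of_real (G z) / 2) at_top" by (rule tendsto_divide[OF _ tendsto_const]) simp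
  then show ?thesis by (simp add: S_def mult.assoc)
qed

text \<open>\<open>Re (w z l)\<close> is the cosine integrand plus the sine integrand, so
  subtracting the cosine part from \<open>partial_integrals\<close> leaves the sine part as an
  improper limit. At \<open>z = 0\<close> the integrand vanishes and
  \<open>v 0 = G 0\<close>.\<close>

lemma H_limit: "((\<lambda>l. sin (l * z) * Im (\<phi> l)) has_integral pi * (G z - v z)) {0..}"
proof (cases "z = 0")
  case True
  then show ?thesis by (simp add: v_def)
next
  case False
  let ?R = "\<lambda>l. cos (l * z) * Re (\<phi> l)" and ?H = "\<lambda>l. sin (l * z) * Im (\<phi> l)"
  have cont: "continuous_on A ?R" "continuous_on A ?H" for A
    by (intro continuous_intros continuous_on_subset[OF \<phi>_cont_on]; simp)+
  have Rew: "Re (w z l) = ?R l + ?H l" for l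
    by (simp add: w_def Re_exp Im_exp mult.commute)
  have "((\<lambda>N. Re (\<integral>l. indicator {- N..N} l *\<^sub>R w z l \<partial>lborel)) \<longlongrightarrow> Re (2 * pi * complex_of_real (G z))) at_top"
    by (intro tendsto_Re partial_integrals False)
  then have lim: "((\<lambda>N. Re (\<integral>l. indicator {- N..N} l *\<^sub>R w z l \<partial>lborel)) \<longlongrightarrow> 2 * pi * G z) at_top" by simp
  have eq: "Re (\<integral>l. indicator {- N..N} l *\<^sub>R w z l \<partial>lborel) = 2 * (integral {0..N} ?R + integral {0..N} ?H)" if N: "N \<ge> 0" for N
  proof -
    have "Re (\<integral>l. indicator {- N..N} l *\<^sub>R w z l \<partial>lborel) = (\<integral>l. Re (indicator {- N..N} l *\<^sub>R w z l) \<partial>lborel)"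
      using integral_Re[OF w_interval_int] by simp
    also have "\<dots> = (\<integral>l. indicator {- N..N} l * (?R l + ?H l) \<partial>lborel)"
      by (simp add: Rew)
    also have "\<dots> = 2 * integral {0..N} (\<lambda>l. ?R l + ?H l)"
      by (rule integral_symmetric_interval[OF _ _ N]) (auto simp: \<phi>_minus intro!: continuous_on_add cont)
    also have "integral {0..N} (\<lambda>l. ?R l + ?H l) = integral {0..N} ?R + integral {0..N} ?H"
      by (rule Henstock_Kurzweil_Integration.integral_add) (intro integrable_continuous_interval cont)+
    finally show ?thesis .
  qed
  have R_lim: "((\<lambda>N. integral {0..N} ?R) \<longlongrightarrow> pi * v z) at_top"
  proof -
    have fi: "set_integrable lborel {0..} ?R"
    proof -
      have "integrable lborel ?R"
        by (rule Bochner_Integration.integrable_bound[OF Re_int]) (auto simp: abs_mult Re_pos intro!: mult_left_le_one_le)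
      then show ?thesis unfolding set_integrable_def by (intro integrable_mult_indicator) auto
    qed
    have e: "(LINT l:{0..}|lborel. ?R l) = pi * v z"
      using set_borel_integral_eq_integral(2)[OF fi] R_limit[of z] by (simp add: integral_unique)
    have "((\<lambda>N. LINT l:{0..N}|lborel. ?R l) \<longlongrightarrow> (LINT l:{0..}|lborel. ?R l)) at_top"
      by (rule tendsto_set_lebesgue_integral_at_top[OF _ fi]) auto
    moreover have "(LINT l:{0..N}|lborel. ?R l) = integral {0..N} ?R" for N
      by (rule set_borel_integral_eq_integral(2)[OF set_integrable_subset[OF fi]]) auto
    ultimately show ?thesis by (simp add: e)
  qed
  have "((\<lambda>N. integral {0..N} ?R + integral {0..N} ?H) \<longlongrightarrow> 2 * pi * G z / 2) at_top"
  proof (rule Lim_transform_eventually)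
    show "((\<lambda>N. Re (\<integral>l. indicator {- N..N} l *\<^sub>R w z l \<partial>lborel) / 2) \<longlongrightarrow> 2 * pi * G z / 2) at_top"
      by (intro tendsto_intros lim) simp
    show "\<forall>\<^sub>F N in at_top. Re (\<integral>l. indicator {- N..N} l *\<^sub>R w z l \<partial>lborel) / 2 = integral {0..N} ?R + integral {0..N} ?H"
      using eventually_ge_at_top[of 0] by eventually_elim (simp add: eq)
  qed
  from tendsto_diff[OF this R_lim] have "((\<lambda>N. integral {0..N} ?H) \<longlongrightarrow> pi * (G z - v z)) at_top"
    by (simp add: algebra_simps)
  then show ?thesis
    by (rule has_integral_improper[rotated]) (intro integrable_continuous_interval cont)
qed

end

section \<open>The characteristic exponent\<close>

lemma norm_iexp_minus_one: "(norm (iexp x - 1))\<^sup>2 = 2 * (1 - cos x)"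
proof -
  have "(norm (iexp x - 1))\<^sup>2 = (cos x - 1)\<^sup>2 + (sin x)\<^sup>2"
    by (simp add: cmod_power2 Re_exp Im_exp)
  also have "\<dots> = 2 * (1 - cos x)" using sin_cos_squared_add[of x] by (simp add: power2_eq_square algebra_simps)
  finally show ?thesis .
qed

text \<open>Recovers \<psi> from the characteristic functions at small times by differentiation,
  without choosing a complex logarithm.\<close>

lemma exp_difference_quotient:
  "(\<lambda>n. (1 - exp (- (of_real (1 / real (Suc n)) * z))) / of_real (1 / real (Suc n))) \<longlonglongrightarrow> (z :: complex)"
proof -
  have "((\<lambda>x. exp (- (x * z))) has_field_derivative - z) (at 0)"
    by (auto intro!: derivative_eq_intros)
  then have 1: "((\<lambda>h. (exp (- ((0 + h) * z)) - exp (- (0 * z))) / h) \<longlongrightarrow> - z) (at 0)"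
    by (rule DERIV_D)
  have "(\<lambda>n. complex_of_real (1 / real (Suc n))) \<longlonglongrightarrow> of_real 0"
    using LIMSEQ_inverse_real_of_nat by (intro tendsto_of_real) (simp add: inverse_eq_divide)
  then have "filterlim (\<lambda>n. complex_of_real (1 / real (Suc n))) (at 0) sequentially"
    unfolding filterlim_at by (auto intro!: always_eventually simp del: of_nat_Suc)
  from tendsto_minus[OF filterlim_compose[OF 1 this]] show ?thesis
    by (simp add: minus_divide_left del: of_nat_Suc of_real_divide)
qed

context levy begin

lemma char_X:
  assumes "characteristic_exponent M X \<psi>" "t \<ge> 0"
  shows "(\<integral>\<omega>. iexp (l * X t \<omega>) \<partial>M) = exp (- (of_real t * \<psi> l))"
proof -
  have [measurable]: "X t \<in> borel_measurable M" by (rule X_measurable[OF assms(2)])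
  have "char (distr M borel (X t)) l = exp (- (of_real t * \<psi> l))"
    using assms by (simp add: characteristic_exponent_def)
  moreover have "char (distr M borel (X t)) l = (\<integral>\<omega>. iexp (l * X t \<omega>) \<partial>M)"
    unfolding char_def by (rule integral_distr) measurable
  ultimately show ?thesis by simp
qed

lemma integrable_iexp_X: "t \<ge> 0 \<Longrightarrow> integrable M (\<lambda>\<omega>. iexp (l * X t \<omega>))"
proof (rule integrable_const_bound[where B=1])
  assume "t \<ge> 0"
  then have [measurable]: "X t \<in> borel_measurable M" by (rule X_measurable)
  show "(\<lambda>\<omega>. iexp (l * X t \<omega>)) \<in> borel_measurable M" by measurable
qed simp

lemma Re_exponent_nonneg:
  assumes "characteristic_exponent M X \<psi>"
  shows "0 \<le> Re (\<psi> l)"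
proof -
  have "norm (\<integral>\<omega>. iexp (l * X 1 \<omega>) \<partial>M) \<le> (\<integral>\<omega>. norm (iexp (l * X 1 \<omega>)) \<partial>M)"
    by (rule integral_norm_bound)
  also have "\<dots> = 1" by (simp add: prob_space)
  finally have "exp (- Re (\<psi> l)) \<le> 1" using char_X[OF assms, of 1 l] by simp
  then show ?thesis by simp
qed

text \<open>Differentiate \<open>E (e\<^sup>i\<^sup>l\<^sup>X - 1)(e\<^sup>i\<^sup>h\<^sup>X - 1)\<close> in \<open>t\<close> at \<open>0\<close>, after bounding it by the inequality between the
  arithmetic and geometric means.\<close>

lemma exponent_increment:
  assumes \<psi>: "characteristic_exponent M X \<psi>" and r: "r > 0"
  shows "norm (\<psi> (l + h) - \<psi> l - \<psi> h) \<le> r * Re (\<psi> l) + Re (\<psi> h) / r"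
proof -
  define c where "c t v = exp (- (of_real t * \<psi> v))" for t :: real and v
  have step: "norm (c t (l + h) - c t l - c t h + 1) \<le> r * (1 - Re (c t l)) + (1 - Re (c t h)) / r" if t: "t \<ge> 0" for t
  proof -
    note i = integrable_iexp_X[OF t]
    have cv: "c t v = (\<integral>\<omega>. iexp (v * X t \<omega>) \<partial>M)" for v unfolding c_def by (rule char_X[OF \<psi> t, symmetric])
    have ci: "integrable M (\<lambda>\<omega>. cos (v * X t \<omega>))" and cR: "Re (c t v) = (\<integral>\<omega>. cos (v * X t \<omega>) \<partial>M)" for v
    proof -
      have "integrable M (\<lambda>\<omega>. Re (iexp (v * X t \<omega>)))" by (rule integrable_Re[OF i])
      then show "integrable M (\<lambda>\<omega>. cos (v * X t \<omega>))" by (simp add: Re_exp)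
      have "Re (c t v) = (\<integral>\<omega>. Re (iexp (v * X t \<omega>)) \<partial>M)" unfolding cv using integral_Re[OF i[of v]] by simp
      then show "Re (c t v) = (\<integral>\<omega>. cos (v * X t \<omega>) \<partial>M)" by (simp add: Re_exp)
    qed
    have prod: "iexp ((l + h) * x) - iexp (l * x) - iexp (h * x) + 1 = (iexp (l * x) - 1) * (iexp (h * x) - 1)" for x
    proof -
      have "iexp ((l + h) * x) = iexp (l * x) * iexp (h * x)" by (simp add: exp_add[symmetric] algebra_simps)
      then show ?thesis by (simp add: algebra_simps)
    qed
    have pt: "norm (iexp ((l + h) * x) - iexp (l * x) - iexp (h * x) + 1) \<le> r * (1 - cos (l * x)) + (1 - cos (h * x)) / r" for x
    proof -
      let ?a = "norm (iexp (l * x) - 1)" and ?b = "norm (iexp (h * x) - 1)"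
      \<comment> \<open>Expanding this square gives
        \<open>a * b \<le> r * a^2 / 2 + b^2 / (2 * r)\<close>. The weight \<open>r\<close> stays
        free because it is later chosen depending on \<open>l\<close>.\<close>
      have "0 \<le> (r * ?a - ?b)\<^sup>2 / (2 * r)" using r by simp
      also have "\<dots> = r * ?a\<^sup>2 / 2 + ?b\<^sup>2 / (2 * r) - ?a * ?b" using r by (simp add: power2_eq_square field_simps)
      finally have "?a * ?b \<le> r * ?a\<^sup>2 / 2 + ?b\<^sup>2 / (2 * r)" by simp
      also have "\<dots> = r * (1 - cos (l * x)) + (1 - cos (h * x)) / r"
        unfolding norm_iexp_minus_one using r by (simp add: field_simps)
      finally show ?thesis unfolding prod norm_mult .
    qed
    have "c t (l + h) - c t l - c t h + 1 = (\<integral>\<omega>. iexp ((l + h) * X t \<omega>) - iexp (l * X t \<omega>) - iexp (h * X t \<omega>) + 1 \<partial>M)"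
      unfolding cv using i by (simp add: prob_space del: of_real_mult of_real_add)
    also have "norm \<dots> \<le> (\<integral>\<omega>. norm (iexp ((l + h) * X t \<omega>) - iexp (l * X t \<omega>) - iexp (h * X t \<omega>) + 1) \<partial>M)"
      by (rule integral_norm_bound)
    also have "\<dots> \<le> (\<integral>\<omega>. r * (1 - cos (l * X t \<omega>)) + (1 - cos (h * X t \<omega>)) / r \<partial>M)"
    proof (rule integral_mono[OF _ _ pt])
      show "integrable M (\<lambda>\<omega>. norm (iexp ((l + h) * X t \<omega>) - iexp (l * X t \<omega>) - iexp (h * X t \<omega>) + 1))"
        by (intro integrable_norm Bochner_Integration.integrable_add Bochner_Integration.integrable_diff i integrable_const)
      show "integrable M (\<lambda>\<omega>. r * (1 - cos (l * X t \<omega>)) + (1 - cos (h * X t \<omega>)) / r)"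
        by (intro Bochner_Integration.integrable_add Bochner_Integration.integrable_diff integrable_mult_right integrable_divide ci integrable_const)
    qed
    also have "\<dots> = r * (1 - Re (c t l)) + (1 - Re (c t h)) / r"
      unfolding cR using ci by (simp add: prob_space)
    finally show ?thesis .
  qed
  \<comment> \<open>Difference quotients at time \<open>1 / Suc n\<close>. The bound in
    \<open>step\<close> is homogeneous in the quantities \<open>1 - c t v\<close>, so it survives
    division by the time and the passage to the limit.\<close>
  define D where "D n v = (1 - c (1 / real (Suc n)) v) / of_real (1 / real (Suc n))" for n v
  have Dlim: "(\<lambda>n. D n v) \<longlonglongrightarrow> \<psi> v" for v
    unfolding D_def c_def by (rule exp_difference_quotient)
  have "norm (D n (l + h) - D n l - D n h) \<le> r * Re (D n l) + Re (D n h) / r" for n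
  proof -
    define t where "t = 1 / real (Suc n)"
    have t: "t > 0" by (simp add: t_def)
    have D: "D n v = (1 - c t v) / of_real t" for v by (simp only: D_def t_def)
    have "D n (l + h) - D n l - D n h = - (c t (l + h) - c t l - c t h + 1) / of_real t"
      unfolding D diff_divide_distrib[symmetric] by simp
    then have "norm (D n (l + h) - D n l - D n h) = norm (c t (l + h) - c t l - c t h + 1) / t"
      using t by (simp only: norm_divide norm_minus_cancel norm_of_real abs_of_pos)
    also have "\<dots> \<le> (r * (1 - Re (c t l)) + (1 - Re (c t h)) / r) / t"
      using t by (intro divide_right_mono step) auto
    also have "\<dots> = r * Re (D n l) + Re (D n h) / r"
      using t r by (simp add: D field_simps)
    finally show ?thesis .
  qed
  moreover have "(\<lambda>n. norm (D n (l + h) - D n l - D n h)) \<longlonglongrightarrow> norm (\<psi> (l + h) - \<psi> l - \<psi> h)"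
    by (intro tendsto_intros Dlim)
  moreover have "(\<lambda>n. r * Re (D n l) + Re (D n h) / r) \<longlonglongrightarrow> r * Re (\<psi> l) + Re (\<psi> h) / r"
    using r by (intro tendsto_intros Dlim) auto
  ultimately show ?thesis by (intro LIMSEQ_le) auto
qed

end

context levy_local_times begin

section \<open>The transform of the density and the kernel hypotheses\<close>

lemma char_P:
  assumes "characteristic_exponent M X \<psi>" "s \<ge> 0"
  shows "(\<integral>w. iexp (l * w s) \<partial>P 0) = exp (- (of_real s * \<psi> l))"
proof -
  have em: "(\<lambda>w. w s) \<in> borel_measurable path_space" by (rule path_eval_measurable[OF assms(2)])
  have "(\<lambda>w. iexp (l * w s)) \<in> borel_measurable path_space"
    by (rule measurable_compose[OF em]) measurable
  then have "(\<integral>w. iexp (l * w s) \<partial>P 0) = (\<integral>\<omega>. iexp (l * (\<lambda>t\<in>{0..}. 0 + X t \<omega>) s) \<partial>M)"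
    unfolding law_from_def by (rule integral_distr[OF path_map_measurable])
  also have "\<dots> = (\<integral>\<omega>. iexp (l * X s \<omega>) \<partial>M)" using assms(2) by simp
  finally show ?thesis using char_X[OF assms] by simp
qed

text \<open>By \<open>nn_integral_u\<close> the measure with density \<open>G\<close> is the image
  of \<open>exp (- \<alpha> * s) ds\<close> times \<open>P 0\<close> under evaluation at
  \<open>s\<close>; its transform is therefore the Laplace transform in \<open>s\<close> of
  \<open>exp (- s * \<psi> l)\<close>.\<close>

lemma G_fourier:
  assumes \<psi>: "characteristic_exponent M X \<psi>"
  shows "(\<integral>s. iexp (l * s) * of_real (G s) \<partial>lborel) = 1 / (of_real \<alpha> + \<psi> l)"
proof -
  define E where "E s = indicator {0..} s * exp (- \<alpha> * s)" for s :: real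
  have E0: "E s \<ge> 0" for s by (simp add: E_def)
  have [measurable]: "E \<in> borel_measurable borel" unfolding E_def by measurable
  have Ee: "ennreal (E s) = ennreal (exp (- \<alpha> * s)) * indicator {0..} s" for s
    by (auto simp: E_def indicator_def)
  let ?D = "density lborel (\<lambda>s. ennreal (E s))"
  have "emeasure ?D (space ?D) = ennreal (1 / \<alpha>)"
    using nn_integral_exp by (simp add: emeasure_density Ee)
  then interpret D: finite_measure ?D by (intro finite_measureI) simp
  interpret Q: pair_sigma_finite ?D "P 0" ..
  let ?h = "\<lambda>(s, w). w (max 0 s) :: real"
  have hm: "?h \<in> borel_measurable (?D \<Otimes>\<^sub>M P 0)"
    using path_joint_measurable by (simp cong: measurable_cong_sets sets_pair_measure_cong)
  have eq: "density lborel (\<lambda>z. ennreal (G z)) = distr (?D \<Otimes>\<^sub>M P 0) borel ?h"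
  proof (rule measure_eqI)
    fix A assume "A \<in> sets (density lborel (\<lambda>z. ennreal (G z)))"
    then have A [measurable]: "A \<in> sets borel" by simp
    have Am: "(indicator A :: real \<Rightarrow> ennreal) \<in> borel_measurable borel" by measurable
    have "emeasure (density lborel (\<lambda>z. ennreal (G z))) A = (\<integral>\<^sup>+z. indicator A z * u 0 z \<partial>lborel)"
      by (simp add: emeasure_density ennreal_G mult.commute)
    also have "\<dots> = (\<integral>\<^sup>+s. ennreal (E s) * (\<integral>\<^sup>+w. indicator A (w (max 0 s)) \<partial>P 0) \<partial>lborel)"
      unfolding Ee by (rule nn_integral_u[OF Am])
    also have "\<dots> = (\<integral>\<^sup>+s. (\<integral>\<^sup>+w. indicator A (w (max 0 s)) \<partial>P 0) \<partial>?D)"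
    proof (rule nn_integral_density[symmetric])
      have "(\<lambda>(s, w). indicator A (w (max 0 s)) :: ennreal) \<in> borel_measurable (lborel \<Otimes>\<^sub>M P 0)"
        using path_pair_measurable[OF Am] by (simp cong: measurable_cong_sets sets_pair_measure_cong)
      then show "(\<lambda>s. \<integral>\<^sup>+w. indicator A (w (max 0 s)) \<partial>P 0) \<in> borel_measurable lborel"
        by (rule P.borel_measurable_nn_integral)
    qed measurable
    also have "\<dots> = (\<integral>\<^sup>+z. indicator A (?h z) \<partial>(?D \<Otimes>\<^sub>M P 0))"
    proof -
      have "(\<lambda>z. indicator A (?h z) :: ennreal) \<in> borel_measurable (?D \<Otimes>\<^sub>M P 0)"
        by (rule measurable_compose[OF hm Am])
      from P.nn_integral_fst[OF this] show ?thesis by simp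
    qed
    also have "\<dots> = (\<integral>\<^sup>+z. indicator A z \<partial>distr (?D \<Otimes>\<^sub>M P 0) borel ?h)"
      by (rule nn_integral_distr[OF hm, symmetric]) (use Am in simp)
    also have "\<dots> = emeasure (distr (?D \<Otimes>\<^sub>M P 0) borel ?h) A" by simp
    finally show "emeasure (density lborel (\<lambda>z. ennreal (G z))) A = emeasure (distr (?D \<Otimes>\<^sub>M P 0) borel ?h) A" .
  qed simp
  have Rp: "Re (of_real \<alpha> + \<psi> l) > 0" using Re_exponent_nonneg[OF \<psi>, of l] alpha by simp
  have "(\<integral>s. iexp (l * s) * of_real (G s) \<partial>lborel) = (\<integral>z. iexp (l * z) \<partial>density lborel (\<lambda>z. ennreal (G z)))"
    by (subst integral_density) (auto simp: G_nonneg scaleR_conv_of_real mult.commute)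
  also have "\<dots> = (\<integral>z. iexp (l * ?h z) \<partial>(?D \<Otimes>\<^sub>M P 0))"
    unfolding eq by (rule integral_distr[OF hm]) measurable
  also have "\<dots> = (\<integral>s. \<integral>w. iexp (l * ?h (s, w)) \<partial>P 0 \<partial>?D)"
  proof (rule Q.integral_fst'[symmetric])
    interpret DP: finite_measure "?D \<Otimes>\<^sub>M P 0"
      by (rule finite_measure_pair_measure[OF P.finite_measure_axioms D.finite_measure_axioms])
    show "integrable (?D \<Otimes>\<^sub>M P 0) (\<lambda>z. iexp (l * ?h z))"
    proof (rule DP.integrable_const_bound[where B=1])
      show "(\<lambda>z. iexp (l * ?h z)) \<in> borel_measurable (?D \<Otimes>\<^sub>M P 0)"
        by (rule measurable_compose[OF hm]) measurable
    qed simp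
  qed
  also have "\<dots> = (\<integral>s. exp (- (of_real (max 0 s) * \<psi> l)) \<partial>?D)"
    by (simp only: prod.case char_P[OF \<psi> max.cobounded1])
  also have "\<dots> = (\<integral>s. E s *\<^sub>R exp (- (of_real (max 0 s) * \<psi> l)) \<partial>lborel)"
    by (rule integral_density) (auto simp: E0)
  also have "\<dots> = (\<integral>s. indicator {0..} s *\<^sub>R exp (- (of_real s * (of_real \<alpha> + \<psi> l))) \<partial>lborel)"
  proof (rule Bochner_Integration.integral_cong[OF refl])
    fix s :: real
    show "E s *\<^sub>R exp (- (of_real (max 0 s) * \<psi> l)) = indicator {0..} s *\<^sub>R exp (- (of_real s * (of_real \<alpha> + \<psi> l)))"
    proof (cases "s \<ge> 0")
      case True
      have "complex_of_real (exp (- \<alpha> * s)) = exp (- (of_real s * of_real \<alpha>))"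
        by (simp add: exp_of_real[symmetric] mult.commute)
      then show ?thesis using True
        by (simp add: E_def scaleR_conv_of_real max_absorb2 exp_add[symmetric] algebra_simps)
    qed (simp add: E_def)
  qed
  also have "\<dots> = 1 / (of_real \<alpha> + \<psi> l)" by (rule integral_exp_decay(2)[OF Rp])
  finally show ?thesis .
qed

text \<open>For \<open>z = \<alpha> + \<psi>\<close>, the bound \<open>Re z \<ge> \<alpha>\<close>
  and \<open>Re (1 / z) = Re z / |z|^2\<close> give positivity and the square bound. For the
  increment, \<open>1 / z' - 1 / z = (z - z') / (z * z')\<close> reduces the claim to the growth of
  \<open>\<psi>\<close> under a shift.\<close>

lemma fourier_kernel_G:
  assumes \<psi>: "characteristic_exponent M X \<psi>"
  shows "fourier_kernel G (\<lambda>l. 1 / (of_real \<alpha> + \<psi> l)) \<alpha>"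
proof
  define z where "z l = of_real \<alpha> + \<psi> l" for l
  have Rz: "Re (z l) \<ge> \<alpha>" for l using Re_exponent_nonneg[OF \<psi>, of l] by (simp add: z_def)
  have z0: "z l \<noteq> 0" "Re (z l) > 0" for l using Rz[of l] alpha by auto
  have Re1: "Re (1 / z l) = Re (z l) * (norm (1 / z l))\<^sup>2" for l
    by (simp add: Re_divide norm_divide power_divide cmod_power2)
  show "0 \<le> Re (1 / (of_real \<alpha> + \<psi> l))" for l
    unfolding z_def[symmetric] Re1 using z0(2)[of l] by simp
  show "(norm (1 / (of_real \<alpha> + \<psi> l)))\<^sup>2 \<le> Re (1 / (of_real \<alpha> + \<psi> l)) / \<alpha>" for l
    unfolding z_def[symmetric] Re1 using Rz[of l] alpha by (simp add: pos_le_divide_eq mult.commute mult_right_mono)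
  show "(\<integral>s. iexp (l * s) * of_real (G s) \<partial>lborel) = 1 / (of_real \<alpha> + \<psi> l)" for l by (rule G_fourier[OF \<psi>])
  show "\<exists>K. \<forall>l. norm (1 / (of_real \<alpha> + \<psi> (l + h)) - 1 / (of_real \<alpha> + \<psi> l))
      \<le> K * (Re (1 / (of_real \<alpha> + \<psi> l)) + (norm (1 / (of_real \<alpha> + \<psi> (l + h))))\<^sup>2)" for h
  proof (intro exI allI)
    fix l
    \<comment> \<open>In units of \<open>q\<close> the summands bound \<open>norm (\<psi> h)\<close>
      (as \<open>q \<ge> sqrt \<alpha>\<close>), then \<open>r * Re (\<psi> l)\<close> and
      \<open>Re (\<psi> h) / r\<close>, where \<open>r = 1 / q\<close> in
      \<open>exponent_increment\<close>.\<close>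
    define K where "K = norm (\<psi> h) / sqrt \<alpha> + 1 + Re (\<psi> h)"
    \<comment> \<open>A growth of order \<open>q\<close> is exactly what can be afforded:
      \<open>(q * |1 / z l|)^2 = Re (1 / z l)\<close>.\<close>
    define q where "q = sqrt (Re (z l))"
    have q: "q > 0" "q\<^sup>2 = Re (z l)" using z0(2)[of l] by (simp_all add: q_def)
    have qa: "sqrt \<alpha> \<le> q" using Rz[of l] by (simp add: q_def)
    have Rh: "Re (\<psi> h) \<ge> 0" by (rule Re_exponent_nonneg[OF \<psi>])
    have K0: "K \<ge> 0" using Rh alpha by (simp add: K_def)
    have "norm (z (l + h) - z l) = norm ((\<psi> (l + h) - \<psi> l - \<psi> h) + \<psi> h)" by (simp add: z_def)
    also have "\<dots> \<le> norm (\<psi> (l + h) - \<psi> l - \<psi> h) + norm (\<psi> h)" by (rule norm_triangle_ineq)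
    also have "norm (\<psi> (l + h) - \<psi> l - \<psi> h) \<le> (1 / q) * Re (\<psi> l) + Re (\<psi> h) / (1 / q)"
      by (rule exponent_increment[OF \<psi>]) (use q in simp)
    also have "(1 / q) * Re (\<psi> l) \<le> (1 / q) * q\<^sup>2"
      using q alpha by (intro mult_left_mono) (auto simp: z_def)
    also have "(1 / q) * q\<^sup>2 = q" using q(1) by (simp add: power2_eq_square)
    finally have "norm (z (l + h) - z l) \<le> q + Re (\<psi> h) * q + norm (\<psi> h)" by simp
    also have "norm (\<psi> h) \<le> norm (\<psi> h) / sqrt \<alpha> * q"
      using mult_right_mono[OF qa norm_ge_zero[of "\<psi> h"]] alpha by (simp add: field_simps)
    finally have d: "norm (z (l + h) - z l) \<le> K * q" by (simp add: K_def algebra_simps)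
    let ?a = "q * norm (1 / z l)" and ?b = "norm (1 / z (l + h))"
    have "1 / z (l + h) - 1 / z l = (z l - z (l + h)) * (1 / z l) * (1 / z (l + h))"
      using z0 by (simp add: field_simps)
    then have "norm (1 / z (l + h) - 1 / z l) = norm (z (l + h) - z l) * norm (1 / z l) * ?b"
      by (simp only: norm_mult norm_minus_commute)
    also have "\<dots> \<le> (K * q) * norm (1 / z l) * ?b" by (intro mult_right_mono d) auto
    also have "\<dots> = K * (?a * ?b)" by simp
    also have "\<dots> \<le> K * (?a\<^sup>2 + ?b\<^sup>2)"
    proof (rule mult_left_mono[OF _ K0])
      have "0 \<le> ?a * ?b" using q by simp
      moreover have "2 * (?a * ?b) \<le> ?a\<^sup>2 + ?b\<^sup>2" using sum_squares_bound[of ?a ?b] by (simp only: mult.assoc)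
      ultimately show "?a * ?b \<le> ?a\<^sup>2 + ?b\<^sup>2" by linarith
    qed
    also have "?a\<^sup>2 = Re (1 / z l)" unfolding Re1 power_mult_distrib q(2) ..
    finally show "norm (1 / (of_real \<alpha> + \<psi> (l + h)) - 1 / (of_real \<alpha> + \<psi> l))
      \<le> (norm (\<psi> h) / sqrt \<alpha> + 1 + Re (\<psi> h)) * (Re (1 / (of_real \<alpha> + \<psi> l)) + (norm (1 / (of_real \<alpha> + \<psi> (l + h))))\<^sup>2)"
      unfolding z_def K_def .
  qed
qed (auto intro: G_integrable G_nonneg G_le isCont_G alpha)

text \<open>Local time is known to be nonnegative only for almost every path and clock value, so the
  extended integral is computed first: the clock integrates out to \<open>F\<close>, the path to
  \<open>u\<close>.\<close>

lemma has_bochner_integral_local_time: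
  "has_bochner_integral (law_from_exp M X \<alpha> x) (\<lambda>(w, \<xi>). L y \<xi> w) (G (y - x))"
proof -
  let ?D = "density lborel (\<lambda>t. ennreal (exponential_density \<alpha> t))"
  interpret D: prob_space ?D by (rule prob_space_exponential_density[OF alpha])
  interpret Q: pair_sigma_finite "P x" ?D ..
  have m: "(\<lambda>(w, \<xi>). L y \<xi> w) \<in> borel_measurable (P x \<Otimes>\<^sub>M ?D)"
  proof -
    have "(\<lambda>z. L y (snd z) (fst z)) \<in> borel_measurable (path_space \<Otimes>\<^sub>M borel)" by measurable
    then show ?thesis by (simp add: case_prod_beta' cong: measurable_cong_sets sets_pair_measure_cong)
  qed
  show ?thesis
    unfolding law_from_exp_def
  proof (rule has_bochner_integral_nn_integral)
    show "(\<lambda>(w, \<xi>). L y \<xi> w) \<in> borel_measurable (P x \<Otimes>\<^sub>M ?D)" by (rule m)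
    show "0 \<le> G (y - x)" by (rule G_nonneg)
    show "AE z in P x \<Otimes>\<^sub>M ?D. 0 \<le> (case z of (w, \<xi>) \<Rightarrow> L y \<xi> w)"
    proof (rule Q.AE_pair_measure)
      show "{z \<in> space (P x \<Otimes>\<^sub>M ?D). 0 \<le> (case z of (w, \<xi>) \<Rightarrow> L y \<xi> w)} \<in> sets (P x \<Otimes>\<^sub>M ?D)"
        using borel_measurable_le[OF borel_measurable_const m, of 0] by simp
      show "AE w in P x. AE \<xi> in ?D. 0 \<le> (case (w, \<xi>) of (w, \<xi>) \<Rightarrow> L y \<xi> w)"
      proof (rule AE_mp[OF AE_good[where x=x and y=y]], rule AE_I2, rule impI)
        fix w assume w: "good y w"
        show "AE \<xi> in ?D. 0 \<le> (case (w, \<xi>) of (w, \<xi>) \<Rightarrow> L y \<xi> w)"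
          using good_nonneg[OF w] by (subst AE_density) (auto simp: exponential_density_def)
      qed
    qed
    have wsp: "(\<integral>\<^sup>+\<xi>. ennreal (L y \<xi> w) \<partial>?D) = F y w" if "w \<in> space path_space" for w
    proof -
      have "(\<lambda>\<xi>. L y \<xi> w) \<in> borel_measurable lborel" by (rule L_measurable_at[OF that]) auto
      then show ?thesis unfolding F_def by (subst nn_integral_density) auto
    qed
    have "(\<integral>\<^sup>+z. ennreal (case z of (w, \<xi>) \<Rightarrow> L y \<xi> w) \<partial>(P x \<Otimes>\<^sub>M ?D)) = (\<integral>\<^sup>+w. \<integral>\<^sup>+\<xi>. ennreal (L y \<xi> w) \<partial>?D \<partial>P x)"
      using D.nn_integral_fst[of "\<lambda>z. ennreal (case z of (w, \<xi>) \<Rightarrow> L y \<xi> w)" "P x"] m by simp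
    also have "\<dots> = u x y" unfolding u_def by (rule nn_integral_cong) (simp add: wsp)
    finally show "(\<integral>\<^sup>+z. ennreal (case z of (w, \<xi>) \<Rightarrow> L y \<xi> w) \<partial>(P x \<Otimes>\<^sub>M ?D)) = ennreal (G (y - x))"
      by (simp add: u_eq_G)
  qed
qed

end

theorem lemma5p2:
  fixes M :: "'a measure" and X :: "real \<Rightarrow> 'a \<Rightarrow> real" and \<psi> :: "real \<Rightarrow> complex"
    and L :: "real \<Rightarrow> real \<Rightarrow> (real \<Rightarrow> real) \<Rightarrow> real" and \<alpha> x y :: real
  assumes "levy_process M X"
    and "characteristic_exponent M X \<psi>"
    and "local_times M X L"
    and "\<alpha> > 0"
  shows "integrable (law_from_exp M X \<alpha> x) (\<lambda>(w, \<xi>). L y \<xi> w) \<and>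
    integrable (law_from_exp M X \<alpha> y) (\<lambda>(w, \<xi>). L x \<xi> w) \<and>
    R_integrand \<psi> \<alpha> x y integrable_on {0..} \<and>
    H_integrand \<psi> \<alpha> x y integrable_on {0..} \<and>
    potential_density M X L \<alpha> x y = R_fun \<psi> \<alpha> x y + H_fun \<psi> \<alpha> x y \<and>
    potential_density M X L \<alpha> y x = R_fun \<psi> \<alpha> x y - H_fun \<psi> \<alpha> x y"
proof -
  interpret levy_local_times M X L \<alpha> using assms by unfold_locales
  define \<phi> where "\<phi> l = 1 / (of_real \<alpha> + \<psi> l)" for l
  interpret fourier_kernel G \<phi> \<alpha> unfolding \<phi>_def by (rule fourier_kernel_G[OF assms(2)])
  define z where "z = y - x"
  have Re1: "Re (1 / c) = Re c / (cmod c)\<^sup>2" and Im1: "Im (1 / c) = - (Im c / (cmod c)\<^sup>2)" for c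
    by (simp_all add: Re_divide Im_divide cmod_power2)
  \<comment> \<open>The integrands use \<open>x - y\<close> while \<open>G\<close> is taken at
    \<open>y - x\<close>. The cosine ignores the sign; for the sine it cancels against the one in
    \<open>Im (1 / c)\<close>.\<close>
  have neg: "l * (x - y) = - (l * z)" for l by (simp add: z_def algebra_simps)
  have "R_integrand \<psi> \<alpha> x y = (\<lambda>l. cos (l * z) * Re (\<phi> l))"
    unfolding R_integrand_def \<phi>_def Re1 neg cos_minus by (simp only: times_divide_eq_right)
  then have R: "(R_integrand \<psi> \<alpha> x y has_integral pi * v z) {0..}"
    using R_limit[of z] by simp
  have "H_integrand \<psi> \<alpha> x y = (\<lambda>l. sin (l * z) * Im (\<phi> l))"
    unfolding H_integrand_def \<phi>_def Im1 neg sin_minus by simp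
  then have H: "(H_integrand \<psi> \<alpha> x y has_integral pi * (G z - v z)) {0..}"
    using H_limit[of z] by simp
  have "R_fun \<psi> \<alpha> x y = v z" "H_fun \<psi> \<alpha> x y = G z - v z"
    unfolding R_fun_def H_fun_def using R H by (simp_all add: integral_unique)
  moreover have "potential_density M X L \<alpha> x y = G z"
    unfolding potential_density_def z_def
    by (rule has_bochner_integral_integral_eq[OF has_bochner_integral_local_time])
  \<comment> \<open>As \<open>v\<close> is the even part of \<open>G\<close>, the value
    \<open>G (- z)\<close> equals \<open>v z - (G z - v z)\<close>, which is the second
    identity.\<close>
  moreover have "potential_density M X L \<alpha> y x = G (- z)"
    unfolding potential_density_def using has_bochner_integral_integral_eq[OF has_bochner_integral_local_time[of y x]]
    by (simp add: z_def)
  moreover have "integrable (law_from_exp M X \<alpha> x) (\<lambda>(w, \<xi>). L y \<xi> w)" "integrable (law_from_exp M X \<alpha> y) (\<lambda>(w, \<xi>). L x \<xi> w)"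
    using has_bochner_integral_local_time by (auto dest: has_bochner_integral_integrable simp: has_bochner_integral_iff)
  ultimately show ?thesis
    using R H has_integral_integrable by (simp add: v_def field_simps) blast
qed

end
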